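(* The asymptotic fingerprinting capacity $C_c^\infty(q)$, i.e. the fingerprinting capacity $C_c(q)=\max_F\min_{\vec\theta}\frac1c I(Y;\vec\Sigma\mid\vec P)$ in the limit of large coalition size $c\to\infty$, for an alphabet of size $q$, is given by $$C_c^\infty(q)=\frac{q-1}{2c^2\ln q}.$$
   Context: Setting. Let $\mathcal Q$ be an alphabet of size $q$ and let $c$ be the number of colluders. A bias vector $\vec P\in[0,1]^q$ with $\sum_{\alpha\in\mathcal Q}P_\alpha=1$ is drawn from a distribution $F$. Given $\vec P=\vec p$, each colluder independently receives symbol $\alpha\in\mathcal Q$ with probability $p_\alpha$. Let $\Sigma_\alpha\in\{0,1,\ldots,c\}$ be the number of colluders who receive $\alpha$, so that $\sum_\alpha\Sigma_\alpha=c$ and $\vec\Sigma$ is multinomial-distributed: $\mathrm{Prob}[\vec\Sigma=\vec\sigma\mid\vec P=\vec p]=\binom{c}{\vec\sigma}\prod_\alpha p_\alpha^{\sigma_\alpha}$, where $\binom{c}{\vec\sigma}$ is the multinomial coefficient. Attack. The colluders output a symbol $Y\in\mathcal Q$ according to a strategy $\vec\theta$, i.e. a set of probabilities $\theta_{y|\vec\sigma}=\mathrm{Prob}[Y=y\mid\vec\Sigma=\vec\sigma]\in[0,1]$ with $\sum_y\theta_{y|\vec\sigma}=1$ for all $\vec\sigma$, subject to the Marking Assumption: $\sigma_\alpha=0$ implies $\theta_{\alpha|\vec\sigma}=0$, and $\sigma_\alpha=c$ implies $\theta_{\alpha|\vec\sigma}=1$. Capacity. The fingerprinting capacity for coalition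 size $c$ and alphabet size $q$ is the value of the two-player game $$C_c(q)=\max_F\min_{\vec\theta}\frac1c I(Y;\vec\Sigma\mid\vec P)=\max_F\min_{\vec\theta}\frac1c\int F(\vec p)\,I(Y;\vec\Sigma\mid\vec P=\vec p)\,\mathrm d^q\vec p,$$ where $I$ denotes mutual information, measured in $q$-ary symbols (base-$q$ logarithm). $C_c^\infty(q)$ denotes this capacity in the limit $c\to\infty$, expressed as a function of $c$ (leading order in $1/c$). Continuum assumption. It is assumed that in the limit $c\to\infty$ the attack strategy satisfies the following condition: there exists a set of bounded and twice differentiable functions $g_y:[0,1]^q\to[0,1]$, $y\in\mathcal Q$, such that (1) $g_\alpha(\vec\sigma/c)=\theta_{\alpha|\vec\sigma}$ for all $\alpha,\vec\sigma$; (2) $x_\alpha=0$ implies $g_\alpha(\vec x)=0$; (3) $\sum_\alpha x_\alpha=1$ implies $\sum_\alpha g_\alpha(\vec x)=1$. *)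

theory Defs
  imports
    "HOL-Probability.Probability"
    "HOL-Library.Landau_Symbols"
    "HOL-Combinatorics.Multiset_Permutations"
begin

text \<open>
  The alphabet is a finite type \<open>'a\<close> and \<open>q = CARD('a)\<close>. A bias vector is a point of
  \<open>real ^ 'a\<close>; a tally vector \<open>\<sigma>\<close> is a function \<open>'a \<Rightarrow> nat\<close>.
\<close>

definition bias_vectors :: "(real ^ 'a) set" where
  "bias_vectors = {p. (\<forall>\<alpha>. p $ \<alpha> \<in> {0..1}) \<and> (\<Sum>\<alpha>\<in>UNIV. p $ \<alpha>) = 1}"

definition tallies :: "nat \<Rightarrow> ('a :: finite \<Rightarrow> nat) set" where
  "tallies c = {\<sigma>. (\<Sum>\<alpha>\<in>UNIV. \<sigma> \<alpha>) = c}"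

text \<open>
  A distribution of the bias vector is an arbitrary Borel probability measure on the simplex;
  atoms are allowed, so it need not have a density.
\<close>

definition bias_distributions :: "(real ^ 'a) measure set" where
  "bias_distributions = {F. prob_space F \<and> sets F = sets (restrict_space borel bias_vectors)}"

definition symbol_pmf :: "real ^ 'a \<Rightarrow> 'a :: finite pmf" where
  "symbol_pmf p = embed_pmf (\<lambda>\<alpha>. p $ \<alpha>)"

definition tally_pmf :: "nat \<Rightarrow> real ^ 'a \<Rightarrow> ('a :: finite \<Rightarrow> nat) pmf" where
  "tally_pmf c p = map_pmf count_list (replicate_pmf c (symbol_pmf p))"

lemma pmf_symbol_pmf:
  assumes "p \<in> bias_vectors"
  shows "pmf (symbol_pmf p) \<alpha> = p $ \<alpha>"
  unfolding symbol_pmf_def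
proof (rule pmf_embed_pmf)
  show "0 \<le> p $ x" for x
    using assms by (simp add: bias_vectors_def)
  then show "(\<integral>\<^sup>+ x. ennreal (p $ x) \<partial>count_space UNIV) = 1"
    using assms by (simp add: bias_vectors_def nn_integral_count_space_finite)
qed

lemma pmf_replicate_pmf:
  fixes P :: "'a :: finite pmf"
  shows "pmf (replicate_pmf n P) xs =
    (if length xs = n then (\<Prod>\<alpha>\<in>UNIV. pmf P \<alpha> ^ count_list xs \<alpha>) else 0)"
proof (induction n arbitrary: xs)
  case 0
  then show ?case by (auto simp: indicator_def)
next
  case (Suc n)
  have rep: "replicate_pmf (Suc n) P = map_pmf (\<lambda>(x, xs). x # xs) (pair_pmf P (replicate_pmf n P))"
    by (simp add: pair_pmf_def map_pmf_def bind_assoc_pmf bind_return_pmf)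
  show ?case
  proof (cases xs)
    case Nil
    have "[] \<notin> set_pmf (replicate_pmf (Suc n) P)"
      unfolding set_replicate_pmf by simp
    then show ?thesis using Nil by (simp add: set_pmf_iff del: replicate_pmf.simps)
  next
    case (Cons y ys)
    have inj: "inj (\<lambda>(x :: 'a, xs). x # xs)" by (auto simp: inj_def)
    have "pmf (replicate_pmf (Suc n) P) xs = pmf P y * pmf (replicate_pmf n P) ys"
      using pmf_map_inj'[OF inj, of "pair_pmf P (replicate_pmf n P)" "(y, ys)"]
      by (simp add: rep Cons pmf_pair del: replicate_pmf.simps)
    also have "\<dots> = (if length xs = Suc n then pmf P y * (\<Prod>\<alpha>\<in>UNIV. pmf P \<alpha> ^ count_list ys \<alpha>) else 0)"
      by (simp add: Suc Cons)
    also have "pmf P y * (\<Prod>\<alpha>\<in>UNIV. pmf P \<alpha> ^ count_list ys \<alpha>) = (\<Prod>\<alpha>\<in>UNIV. pmf P \<alpha> ^ count_list xs \<alpha>)"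
      by (simp add: Cons prod.remove[of UNIV y])
    finally show ?thesis .
  qed
qed

text \<open>The tally vector is multinomially distributed.\<close>

lemma pmf_tally_pmf:
  fixes p :: "real ^ 'a :: finite"
  assumes p: "p \<in> bias_vectors"
  shows "pmf (tally_pmf c p) \<sigma> =
    (if \<sigma> \<in> tallies c
     then fact c / (\<Prod>\<alpha>\<in>UNIV. fact (\<sigma> \<alpha>)) * (\<Prod>\<alpha>\<in>UNIV. (p $ \<alpha>) ^ \<sigma> \<alpha>) else 0)"
proof -
  define M where "M = Abs_multiset \<sigma>"
  have cM: "count M = \<sigma>"
    by (simp add: M_def)
  have cl: "count_list xs = count (mset xs)" for xs :: "'a list"
    by (simp add: fun_eq_iff count_mset)
  have size: "size M = (\<Sum>\<alpha>\<in>UNIV. \<sigma> \<alpha>)"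
    unfolding size_multiset_overloaded_eq cM[symmetric]
    by (rule sum.mono_neutral_left) (auto simp: not_in_iff)
  have vi: "count_list -` {\<sigma>} = permutations_of_multiset M"
    by (auto simp: permutations_of_multiset_def cl cM[symmetric] count_inject)
  have len: "length xs = size M" if "xs \<in> permutations_of_multiset M" for xs
    using that by (auto simp: permutations_of_multiset_def)
  have cnt: "count_list xs = \<sigma>" if "xs \<in> permutations_of_multiset M" for xs
    using that vi by blast
  have "pmf (tally_pmf c p) \<sigma> =
      (\<Sum>xs\<in>permutations_of_multiset M. pmf (replicate_pmf c (symbol_pmf p)) xs)"
    unfolding tally_pmf_def pmf_map vi by (simp add: measure_measure_pmf_finite)
  also have "\<dots> = (\<Sum>xs\<in>permutations_of_multiset M.
      if size M = c then (\<Prod>\<alpha>\<in>UNIV. (p $ \<alpha>) ^ \<sigma> \<alpha>) else 0)"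
    by (intro sum.cong refl) (simp add: pmf_replicate_pmf pmf_symbol_pmf[OF p] len cnt)
  also have "\<dots> = (if size M = c then real (card (permutations_of_multiset M)) *
      (\<Prod>\<alpha>\<in>UNIV. (p $ \<alpha>) ^ \<sigma> \<alpha>) else 0)"
    by simp
  also have "real (card (permutations_of_multiset M)) = fact (size M) / (\<Prod>\<alpha>\<in>UNIV. fact (\<sigma> \<alpha>))"
  proof -
    have "(\<Prod>x\<in>set_mset M. fact (count M x)) = (\<Prod>x\<in>UNIV. fact (count M x) :: nat)"
      by (rule prod.mono_neutral_left) (auto simp: not_in_iff)
    then have "card (permutations_of_multiset M) * (\<Prod>x\<in>UNIV. fact (\<sigma> x)) = fact (size M)"
      using card_permutations_of_multiset_aux[of M] by (simp add: cM)
    then have "real (card (permutations_of_multiset M)) * (\<Prod>x\<in>UNIV. fact (\<sigma> x)) = fact (size M)"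
      by (metis (mono_tags, lifting) of_nat_fact of_nat_mult of_nat_prod prod.cong)
    then show ?thesis by (simp add: field_simps)
  qed
  finally show ?thesis by (simp add: tallies_def size)
qed

text \<open>
  An attack strategy is a kernel \<open>\<theta>\<close> with \<open>\<theta>\<^bsub>y|\<sigma>\<^esub> = pmf (\<theta> \<sigma>) y\<close>. Only its values on
  \<open>tallies c\<close> matter.
\<close>

definition marking_assumption ::
  "nat \<Rightarrow> (('a :: finite \<Rightarrow> nat) \<Rightarrow> 'a pmf) \<Rightarrow> bool" where
  "marking_assumption c \<theta> \<longleftrightarrow>
    (\<forall>\<sigma>\<in>tallies c. \<forall>\<alpha>. (\<sigma> \<alpha> = 0 \<longrightarrow> pmf (\<theta> \<sigma>) \<alpha> = 0) \<and> (\<sigma> \<alpha> = c \<longrightarrow> pmf (\<theta> \<sigma>) \<alpha> = 1))"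

definition twice_differentiable_on ::
  "('b :: real_normed_vector \<Rightarrow> real) \<Rightarrow> 'b set \<Rightarrow> bool" where
  "twice_differentiable_on f S \<longleftrightarrow>
    (\<exists>f' :: 'b \<Rightarrow> 'b \<Rightarrow>\<^sub>L real.
      (\<forall>x\<in>S. (f has_derivative blinfun_apply (f' x)) (at x within S)) \<and> f' differentiable_on S)"

definition unit_cube :: "(real ^ 'a) set" where
  "unit_cube = {x. \<forall>\<alpha>. x $ \<alpha> \<in> {0..1}}"

text \<open>
  The profiles \<open>g\<close> of the continuum assumption. They live on the whole cube and do not mention
  the coalition size; their boundedness is part of the range condition.
\<close>

definition continuum_profile :: "('a :: finite \<Rightarrow> real ^ 'a \<Rightarrow> real) \<Rightarrow> bool" where
  "continuum_profile g \<longleftrightarrow>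
    (\<forall>y. g y ` unit_cube \<subseteq> {0..1} \<and> twice_differentiable_on (g y) unit_cube) \<and>
    (\<forall>x\<in>unit_cube. \<forall>\<alpha>. x $ \<alpha> = 0 \<longrightarrow> g \<alpha> x = 0) \<and>
    (\<forall>x\<in>unit_cube. (\<Sum>\<alpha>\<in>UNIV. x $ \<alpha>) = 1 \<longrightarrow> (\<Sum>\<alpha>\<in>UNIV. g \<alpha> x) = 1)"

definition continuum_assumption ::
  "nat \<Rightarrow> (('a :: finite \<Rightarrow> nat) \<Rightarrow> 'a pmf) \<Rightarrow> bool" where
  "continuum_assumption c \<theta> \<longleftrightarrow>
    (\<exists>g. continuum_profile g \<and>
      (\<forall>\<sigma>\<in>tallies c. \<forall>\<alpha>. g \<alpha> (\<chi> \<beta>. real (\<sigma> \<beta>) / real c) = pmf (\<theta> \<sigma>) \<alpha>))"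

definition attack_strategies :: "nat \<Rightarrow> (('a :: finite \<Rightarrow> nat) \<Rightarrow> 'a pmf) set" where
  "attack_strategies c = {\<theta>. marking_assumption c \<theta> \<and> continuum_assumption c \<theta>}"

text \<open>The joint law of \<open>(\<Sigma>, Y)\<close> given \<open>P = p\<close>.\<close>

definition tally_output_pmf ::
  "nat \<Rightarrow> (('a :: finite \<Rightarrow> nat) \<Rightarrow> 'a pmf) \<Rightarrow> real ^ 'a \<Rightarrow> (('a \<Rightarrow> nat) \<times> 'a) pmf" where
  "tally_output_pmf c \<theta> p = bind_pmf (tally_pmf c p) (\<lambda>\<sigma>. map_pmf (Pair \<sigma>) (\<theta> \<sigma>))"

text \<open>\<open>I(Y; \<Sigma> | P = p)\<close>, in base-\<open>q\<close> units.\<close>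

definition mutual_info_at ::
  "nat \<Rightarrow> (('a :: finite \<Rightarrow> nat) \<Rightarrow> 'a pmf) \<Rightarrow> real ^ 'a \<Rightarrow> real" where
  "mutual_info_at c \<theta> p =
    prob_space.mutual_information (measure_pmf (tally_output_pmf c \<theta> p)) (real CARD('a))
      (count_space UNIV) (count_space UNIV) snd fst"

text \<open>\<open>I(Y; \<Sigma> | P)\<close> for \<open>P\<close> distributed according to \<open>F\<close>.\<close>

definition cond_mutual_info ::
  "nat \<Rightarrow> (real ^ 'a) measure \<Rightarrow> (('a :: finite \<Rightarrow> nat) \<Rightarrow> 'a pmf) \<Rightarrow> real" where
  "cond_mutual_info c F \<theta> = (\<integral>p. mutual_info_at c \<theta> p \<partial>F)"

text \<open>
  The max-min value of the game, in the sense of supremum and infimum. The type argument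
  carries the alphabet.
\<close>

definition fingerprinting_capacity :: "'a :: finite itself \<Rightarrow> nat \<Rightarrow> real" where
  "fingerprinting_capacity _ c =
    (SUP F \<in> (bias_distributions :: (real ^ 'a) measure set).
      INF \<theta> \<in> attack_strategies c. cond_mutual_info c F \<theta> / real c)"

end

theory Submission
  imports Defs "HOL-Real_Asymp.Real_Asymp"
begin

text \<open>
  Given \<open>P = p\<close>, the information \<open>I(Y; \<Sigma>)\<close> is the sum over \<open>y\<close> of the entropies
  \<open>E (f ln f) - E f ln (E f)\<close> of \<open>f = \<theta>\<^bsub>y|\<Sigma>\<^esub>\<close>.

  Upper bound: the attack outputs \<open>y\<close> with probability proportional to \<open>r(\<sigma>\<^sub>y)\<close>, where
  \<open>r(k) = k exp (-2 ln c / sqrt k)\<close> is interleaving damped near the boundary of the simplex.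
  Tensorization of entropy reduces its leakage to the effect of changing one colluder's symbol, which is
  bounded pointwise, so that \<open>c * I \<le> (q - 1) / 2 + o(1)\<close> uniformly in \<open>p\<close>.

  Lower bound: for every test function with \<open>E (exp h) = 1\<close> the entropy of \<open>f\<close> is at least \<open>E (f h)\<close>. With
  \<open>h = ln (\<sigma>\<^sub>y / (c p\<^sub>y))\<close> and a Dirichlet distributed bias with all parameters \<open>\<kappa>\<close>, the bound is a
  linear functional of \<open>\<theta>\<close> whose coefficients are Dirichlet moments; for \<open>\<kappa>\<close> slightly below \<open>1 / 2\<close> they
  are at least about \<open>(q \<kappa> - 1 / 2) / c\<close>, except for tallies with small \<open>\<sigma>\<^sub>y\<close>. The latter are paid for by mixing
  in a little of the Dirichlet distributions with a smaller parameter at \<open>y\<close>. Since no smoothness of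
  \<open>\<theta>\<close> is used, the bound holds for all strategies satisfying the marking assumption.
\<close>

section \<open>Multinomial expectations and mutual information\<close>

text \<open>The obstacle is the boundary of the simplex: expansions of the information in powers of
  1/c break down where some \<open>p $ y\<close> is of order 1/c, and either side may exploit such
  \<open>p\<close>. Hence the estimates are inequalities for finite \<open>c\<close>, uniform in
  \<open>p\<close> above and integrated over \<open>p\<close> below. The constant (q - 1)/2 arises
  in two ways. Above, changing one symbol to \<open>\<beta>\<close> costs about 1/(2c) times
  1/(\<sigma> \<beta> + 1); since the mean of the latter times \<open>p $ \<beta>\<close> is at most
  1/c, the q symbols give q/2, and renormalising the weights gives back 1/2. Below, the posterior
  mean of -ln(c p/m) for a symbol held m times is about (1/2 - \<kappa>)/m + (q \<kappa> - 1/2)/c: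
  half the posterior variance of the ratio c p/m, minus the shift of its mean. At \<kappa> = 1/2,
  the Jeffreys prior, the second term is the wanted one, but the first vanishes and cannot absorb
  the error of order 1/m^2. Taking \<kappa> below 1/2 absorbs it for all large m, so only boundedly
  many m need separate treatment.\<close>

definition incr :: "'a \<Rightarrow> ('a \<Rightarrow> nat) \<Rightarrow> 'a \<Rightarrow> nat" where
  "incr \<beta> \<sigma> = \<sigma>(\<beta> := Suc (\<sigma> \<beta>))"

lemma incr_apply: "incr \<beta> \<sigma> \<alpha> = (if \<alpha> = \<beta> then Suc (\<sigma> \<alpha>) else \<sigma> \<alpha>)"
  by (simp add: incr_def)

lemma incr_commute: "incr \<alpha> (incr \<beta> \<sigma>) = incr \<beta> (incr \<alpha> \<sigma>)"
  by (auto simp: incr_def fun_eq_iff)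

lemma incr_tallies: "\<sigma> \<in> tallies n \<Longrightarrow> incr \<beta> \<sigma> \<in> tallies (Suc n)"
  by (simp add: tallies_def incr_def sum.remove[of UNIV \<beta>])

lemma finite_tallies: "finite (tallies c :: ('a :: finite \<Rightarrow> nat) set)"
proof (rule finite_subset)
  show "(tallies c :: ('a \<Rightarrow> nat) set) \<subseteq> PiE UNIV (\<lambda>_. {..c})"
    by (auto simp: tallies_def PiE_def intro: member_le_sum)
qed (auto intro: finite_PiE)

lemma tally_le: "\<sigma> \<in> tallies c \<Longrightarrow> \<sigma> \<alpha> \<le> c"
  for \<sigma> :: "'a :: finite \<Rightarrow> nat"
  using member_le_sum[of \<alpha> UNIV \<sigma>] by (auto simp: tallies_def)

text \<open>
  Expectation of \<open>f \<Sigma>\<close> for \<open>\<Sigma>\<close> multinomial, unfolded one colluder at a time; \<open>w\<close> need not be a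
  probability vector.
\<close>

primrec mex :: "('a :: finite \<Rightarrow> real) \<Rightarrow> nat \<Rightarrow> (('a \<Rightarrow> nat) \<Rightarrow> real) \<Rightarrow> real" where
  "mex w 0 f = f (\<lambda>_. 0)"
| "mex w (Suc n) f = (\<Sum>\<beta>\<in>UNIV. w \<beta> * mex w n (\<lambda>\<sigma>. f (incr \<beta> \<sigma>)))"

lemma mex_mono:
  assumes "\<And>\<beta>. w \<beta> \<ge> 0" "\<And>\<sigma>. \<sigma> \<in> tallies n \<Longrightarrow> f \<sigma> \<le> g \<sigma>"
  shows "mex w n f \<le> mex w n g"
  using assms(2)
proof (induction n arbitrary: f g)
  case 0
  then show ?case using 0[of "\<lambda>_. 0"] by (simp add: tallies_def)
next
  case (Suc n)
  then have "mex w n (\<lambda>\<sigma>. f (incr \<beta> \<sigma>)) \<le> mex w n (\<lambda>\<sigma>. g (incr \<beta> \<sigma>))" for \<beta>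
    by (intro Suc.IH Suc.prems incr_tallies)
  then show ?case by (simp add: sum_mono mult_left_mono assms(1))
qed

lemma mex_add: "mex w n (\<lambda>\<sigma>. f \<sigma> + g \<sigma>) = mex w n f + mex w n g"
  by (induction n arbitrary: f g) (simp_all add: sum.distrib distrib_left)

lemma mex_cmult: "mex w n (\<lambda>\<sigma>. a * f \<sigma>) = a * mex w n f"
  by (induction n arbitrary: f) (simp_all add: sum_distrib_left mult_ac)

lemma mex_0: "mex w n (\<lambda>\<sigma>. 0) = 0"
  by (induction n) simp_all

lemma mex_multc: "mex w n (\<lambda>\<sigma>. f \<sigma> * a) = mex w n f * a"
  using mex_cmult[of w n a f] by (simp add: mult.commute)

lemma mex_diff: "mex w n (\<lambda>\<sigma>. f \<sigma> - g \<sigma>) = mex w n f - mex w n g"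
  by (induction n arbitrary: f g) (simp_all add: sum_subtractf right_diff_distrib)

lemma mex_sum: "mex w n (\<lambda>\<sigma>. \<Sum>i\<in>I. f i \<sigma>) = (\<Sum>i\<in>I. mex w n (f i))"
proof (induction n arbitrary: f)
  case (Suc n)
  show ?case by (simp add: Suc sum_distrib_left sum.swap[of _ I])
qed simp

lemma mex_const: "(\<Sum>\<beta>\<in>UNIV. w \<beta>) = 1 \<Longrightarrow> mex w n (\<lambda>\<sigma>. a) = a"
  by (induction n) (simp_all flip: sum_distrib_right)

text \<open>\<open>\<sigma> \<beta>\<close> counts the colluders holding \<open>\<beta>\<close>; by
  symmetry each contributes its weight \<open>w \<beta>\<close> times the expectation over the other
  \<open>n\<close>, with \<open>\<beta>\<close> added back.\<close>

lemma mex_size_bias: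
  "mex w (Suc n) (\<lambda>\<sigma>. real (\<sigma> \<beta>) * g \<sigma>) = real (Suc n) * (w \<beta> * mex w n (\<lambda>\<sigma>. g (incr \<beta> \<sigma>)))"
proof (induction n arbitrary: g)
  case 0
  have "(\<Sum>\<alpha>\<in>UNIV. w \<alpha> * (real (incr \<alpha> (\<lambda>_. 0) \<beta>) * g (incr \<alpha> (\<lambda>_. 0)))) =
      (\<Sum>\<alpha>\<in>{\<beta>}. w \<alpha> * (real (incr \<alpha> (\<lambda>_. 0) \<beta>) * g (incr \<alpha> (\<lambda>_. 0))))"
    by (rule sum.mono_neutral_right) (auto simp: incr_apply)
  moreover have "incr \<beta> (\<lambda>_. 0) \<beta> = 1"
    by (simp add: incr_apply)
  ultimately show ?case by simp
next
  case (Suc n)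
  have step: "real (incr \<alpha> \<sigma> \<beta>) * g (incr \<alpha> \<sigma>) =
      real (\<sigma> \<beta>) * g (incr \<alpha> \<sigma>) + (if \<alpha> = \<beta> then g (incr \<beta> \<sigma>) else 0)" for \<alpha> \<sigma>
    by (simp add: incr_apply algebra_simps)
  define h where "h \<alpha> = (if \<alpha> = \<beta> then mex w (Suc n) (\<lambda>\<sigma>. g (incr \<beta> \<sigma>)) else 0)" for \<alpha>
  have mh: "mex w (Suc n) (\<lambda>\<sigma>. if \<alpha> = \<beta> then g (incr \<beta> \<sigma>) else 0) = h \<alpha>" for \<alpha>
    unfolding h_def by (cases "\<alpha> = \<beta>") (simp_all add: mex_0 del: mex.simps)
  have "mex w (Suc (Suc n)) (\<lambda>\<sigma>. real (\<sigma> \<beta>) * g \<sigma>) =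
      (\<Sum>\<alpha>\<in>UNIV. w \<alpha> * (mex w (Suc n) (\<lambda>\<sigma>. real (\<sigma> \<beta>) * g (incr \<alpha> \<sigma>)) + h \<alpha>))"
    unfolding mex.simps(2)[of w "Suc n"] step mex_add mh ..
  also have "\<dots> = (\<Sum>\<alpha>\<in>UNIV. w \<alpha> * (real (Suc n) * (w \<beta> * mex w n (\<lambda>\<sigma>. g (incr \<alpha> (incr \<beta> \<sigma>)))))) +
      (\<Sum>\<alpha>\<in>UNIV. w \<alpha> * h \<alpha>)"
    unfolding Suc distrib_left sum.distrib ..
  also have "(\<Sum>\<alpha>\<in>UNIV. w \<alpha> * h \<alpha>) = w \<beta> * mex w (Suc n) (\<lambda>\<sigma>. g (incr \<beta> \<sigma>))"
    by (simp add: h_def sum.remove[of UNIV \<beta>] del: mex.simps)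
  also have "(\<Sum>\<alpha>\<in>UNIV. w \<alpha> * (real (Suc n) * (w \<beta> * mex w n (\<lambda>\<sigma>. g (incr \<alpha> (incr \<beta> \<sigma>)))))) =
      real (Suc n) * (w \<beta> * mex w (Suc n) (\<lambda>\<sigma>. g (incr \<beta> \<sigma>)))"
    by (simp add: sum_distrib_left incr_commute mult_ac)
  finally show ?case by (simp add: algebra_simps del: mex.simps)
qed

lemma mex_absent:
  assumes "(\<Sum>\<beta>\<in>UNIV. w \<beta>) = 1"
  shows "mex w n (\<lambda>\<sigma>. if \<sigma> \<beta> = 0 then 1 else 0) = (1 - w \<beta>) ^ n"
proof (induction n)
  case (Suc n)
  have "mex w (Suc n) (\<lambda>\<sigma>. if \<sigma> \<beta> = 0 then 1 else 0) =
      (\<Sum>\<alpha>\<in>UNIV. w \<alpha> * (if \<alpha> = \<beta> then 0 else (1 - w \<beta>) ^ n))"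
    using Suc by (auto intro!: sum.cong simp: incr_apply mex_0)
  also have "\<dots> = (\<Sum>\<alpha>\<in>UNIV. w \<alpha> * (1 - w \<beta>) ^ n) - w \<beta> * (1 - w \<beta>) ^ n"
    by (simp add: if_distrib[of "\<lambda>x. _ * x"] sum.remove[of UNIV \<beta>] cong: if_cong)
  also have "\<dots> = (1 - w \<beta>) ^ Suc n"
    by (simp flip: sum_distrib_right add: assms algebra_simps)
  finally show ?case .
qed simp

lemma mex_eq_expectation:
  assumes p: "p \<in> bias_vectors"
  shows "mex (\<lambda>\<alpha>. p $ \<alpha>) n f = measure_pmf.expectation (tally_pmf n p) f"
proof (induction n arbitrary: f)
  case 0
  have "count_list [] = (\<lambda>x :: 'a. 0)" by (simp add: fun_eq_iff)
  then show ?case by (simp add: tally_pmf_def)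
next
  case (Suc n)
  have fin: "finite (set_pmf (tally_pmf n p))" for n
    by (rule finite_subset[OF _ finite_tallies[of n]])
      (auto simp: set_pmf_iff pmf_tally_pmf[OF p] split: if_splits)
  have "count_list (x # xs) = incr x (count_list xs)" for x :: 'a and xs
    by (auto simp: fun_eq_iff incr_apply)
  then have "tally_pmf (Suc n) p = symbol_pmf p \<bind> (\<lambda>\<beta>. map_pmf (incr \<beta>) (tally_pmf n p))"
    by (simp add: tally_pmf_def map_bind_pmf map_pmf_comp)
      (simp add: map_pmf_def)
  then show ?case
    by (simp add: Suc pmf_expectation_bind[of UNIV] fin pmf_symbol_pmf[OF p])
qed

lemma mex_eq_sum:
  assumes p: "p \<in> bias_vectors"
  shows "mex (\<lambda>\<alpha>. p $ \<alpha>) n f = (\<Sum>\<sigma>\<in>tallies n. pmf (tally_pmf n p) \<sigma> * f \<sigma>)"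
  unfolding mex_eq_expectation[OF p]
  by (subst integral_measure_pmf_real[OF finite_tallies[of n]])
    (auto simp: set_pmf_iff pmf_tally_pmf[OF p] mult.commute split: if_splits)

section \<open>The entropy functional and its identification with mutual information\<close>

definition xlnx :: "real \<Rightarrow> real" where
  "xlnx x = x * ln x"

definition ent :: "('a :: finite \<Rightarrow> real) \<Rightarrow> nat \<Rightarrow> (('a \<Rightarrow> nat) \<Rightarrow> real) \<Rightarrow> real" where
  "ent w n f = mex w n (\<lambda>\<sigma>. xlnx (f \<sigma>)) - xlnx (mex w n f)"

lemma countable_UNIV_fun: "countable (UNIV :: ('a :: finite \<Rightarrow> nat) set)"
  using countable_PiE[of "UNIV :: 'a set" "\<lambda>_. UNIV :: nat set"] by (simp add: PiE_def)

lemma distributed_pmf: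
  "distributed (measure_pmf P) (count_space UNIV) X (\<lambda>x. ennreal (pmf (map_pmf X P) x))"
proof -
  have "distr (measure_pmf P) (count_space UNIV) X = measure_pmf (map_pmf X P)"
    by (simp add: map_pmf_rep_eq)
  also have "\<dots> = density (count_space UNIV) (\<lambda>x. ennreal (pmf (map_pmf X P) x))"
    by (rule measure_pmf_eq_density)
  finally show ?thesis by (simp add: distributed_def)
qed

text \<open>In the ratio of the joint law to the product of its marginals the tally probability
  cancels. What is left is \<open>\<theta>\<close> over its mean \<open>G y\<close>, so each
  \<open>y\<close> contributes one entropy.\<close>

lemma mutual_info_at_eq_ent:
  fixes p :: "real ^ 'a :: finite"
  assumes p: "p \<in> bias_vectors" and q: "CARD('a) \<ge> 2"
  shows "mutual_info_at c \<theta> p =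
    (\<Sum>y\<in>UNIV. ent (\<lambda>\<alpha>. p $ \<alpha>) c (\<lambda>\<sigma>. pmf (\<theta> \<sigma>) y)) / ln (real CARD('a))"
proof -
  define J where "J = tally_output_pmf c \<theta> p"
  define T where "T = tally_pmf c p"
  define G where "G y = mex (\<lambda>\<alpha>. p $ \<alpha>) c (\<lambda>\<sigma>. pmf (\<theta> \<sigma>) y)" for y
  define f where "f = (\<lambda>x. pmf (map_pmf (\<lambda>x. (snd x, fst x)) J) x * log (real CARD('a))
    (pmf (map_pmf (\<lambda>x. (snd x, fst x)) J) x / (pmf (map_pmf snd J) (fst x) * pmf (map_pmf fst J) (snd x))))"
  interpret information_space "measure_pmf J" "real CARD('a)"
    using q by unfold_locales auto
  have cs: "count_space (UNIV :: 'a set) \<Otimes>\<^sub>M count_space (UNIV :: ('a \<Rightarrow> nat) set) = count_space UNIV"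
    by (simp add: pair_measure_countable countable_UNIV_fun countable_finite)
  have "mutual_info_at c \<theta> p = integral\<^sup>L (count_space (UNIV :: 'a set) \<Otimes>\<^sub>M count_space (UNIV :: ('a \<Rightarrow> nat) set)) f"
    unfolding mutual_info_at_def f_def J_def[symmetric]
    by (rule mutual_information_distr)
      (auto simp: cs distributed_pmf intro!: sigma_finite_measure_count_space_countable countable_UNIV_fun countable_finite)
  then have mi: "mutual_info_at c \<theta> p = (\<integral>x. f x \<partial>count_space UNIV)"
    by (simp add: cs)
  have J: "pmf J (\<sigma>, y) = pmf T \<sigma> * pmf (\<theta> \<sigma>) y" for \<sigma> y
  proof -
    have "pmf J (\<sigma>, y) = measure_pmf.expectation T (\<lambda>\<tau>. if \<tau> = \<sigma> then pmf (\<theta> \<sigma>) y else 0)"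
      unfolding J_def tally_output_pmf_def T_def pmf_bind
    proof (intro Bochner_Integration.integral_cong refl)
      fix \<tau>
      show "pmf (map_pmf (Pair \<tau>) (\<theta> \<tau>)) (\<sigma>, y) = (if \<tau> = \<sigma> then pmf (\<theta> \<sigma>) y else 0)"
        using pmf_map_inj'[of "Pair \<tau>" "\<theta> \<tau>" y]
        by (auto simp: pmf_eq_0_set_pmf inj_def)
    qed
    also have "\<dots> = pmf T \<sigma> * pmf (\<theta> \<sigma>) y"
      by (subst integral_measure_pmf_real[of "{\<sigma>}"]) (auto split: if_splits)
    finally show ?thesis .
  qed
  have Jswap: "pmf (map_pmf (\<lambda>x. (snd x, fst x)) J) (y, \<sigma>) = pmf T \<sigma> * pmf (\<theta> \<sigma>) y" for \<sigma> y
    using pmf_map_inj'[of "\<lambda>x. (snd x, fst x)" J "(\<sigma>, y)"] by (simp add: J inj_def prod_eq_iff)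
  have Jfst: "map_pmf fst J = T"
    by (simp add: J_def T_def tally_output_pmf_def map_bind_pmf map_pmf_comp bind_return_pmf')
  have Jsnd: "pmf (map_pmf snd J) y = G y" for y
    by (simp add: J_def tally_output_pmf_def map_bind_pmf map_pmf_comp pmf_bind G_def mex_eq_expectation[OF p])
  have T0: "pmf T \<sigma> = 0" if "\<sigma> \<notin> tallies c" for \<sigma>
    using that by (simp add: T_def pmf_tally_pmf[OF p])
  have f: "f (y, \<sigma>) = pmf T \<sigma> * (pmf (\<theta> \<sigma>) y * ln (pmf (\<theta> \<sigma>) y) - pmf (\<theta> \<sigma>) y * ln (G y)) / ln (real CARD('a))" for y \<sigma>
  \<comment> \<open>Splitting the logarithm needs positive arguments; where the joint mass is zero,
    both sides are zero.\<close>
  proof (cases "pmf T \<sigma> = 0 \<or> pmf (\<theta> \<sigma>) y = 0")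
    case True
    then show ?thesis by (auto simp: f_def Jswap)
  next
    case False
    then have pos: "pmf T \<sigma> > 0" "pmf (\<theta> \<sigma>) y > 0" by (simp_all add: pmf_positive_iff set_pmf_iff)
    have "pmf T \<sigma> * pmf (\<theta> \<sigma>) y \<le> G y"
      unfolding G_def mex_eq_sum[OF p] T_def
      using T0[of \<sigma>] False
      by (intro member_le_sum[of \<sigma> _ "\<lambda>\<sigma>. pmf (tally_pmf c p) \<sigma> * pmf (\<theta> \<sigma>) y"]) (auto simp: finite_tallies)
    with pos have "G y > 0" by (smt (verit) mult_pos_pos)
    with pos show ?thesis
      by (simp add: f_def Jswap Jfst Jsnd log_def ln_div ln_mult algebra_simps)
  qed
  note mi
  also have "(\<integral>x. f x \<partial>count_space UNIV) = (\<Sum>x\<in>UNIV \<times> tallies c. f x)"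
  proof -
    have sub: "{x. f x \<noteq> 0} \<subseteq> UNIV \<times> tallies c"
    proof
      fix x assume "x \<in> {x. f x \<noteq> 0}"
      then have "pmf T (snd x) \<noteq> 0" using f[of "fst x" "snd x"] by auto
      with T0[of "snd x"] show "x \<in> UNIV \<times> tallies c" by (cases x) auto
    qed
    have fin: "finite (UNIV \<times> tallies c :: ('a \<times> ('a \<Rightarrow> nat)) set)"
      by (simp add: finite_tallies)
    have "(\<integral>x. f x \<partial>count_space UNIV) = sum f {x. f x \<noteq> 0}"
      using lebesgue_integral_count_space_finite_support[of UNIV f] finite_subset[OF sub fin] by simp
    also have "\<dots> = (\<Sum>x\<in>UNIV \<times> tallies c. f x)"
      by (rule sum.mono_neutral_left[OF fin sub]) blast
    finally show ?thesis .
  qed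
  also have "\<dots> = (\<Sum>y\<in>UNIV. \<Sum>\<sigma>\<in>tallies c. f (y, \<sigma>))"
    by (simp add: sum.cartesian_product)
  also have "\<dots> = (\<Sum>y\<in>UNIV. ent (\<lambda>\<alpha>. p $ \<alpha>) c (\<lambda>\<sigma>. pmf (\<theta> \<sigma>) y) / ln (real CARD('a)))"
  proof (intro sum.cong refl)
    fix y
    have "(\<Sum>\<sigma>\<in>tallies c. f (y, \<sigma>)) =
        (\<Sum>\<sigma>\<in>tallies c. pmf T \<sigma> * xlnx (pmf (\<theta> \<sigma>) y) - (pmf T \<sigma> * pmf (\<theta> \<sigma>) y) * ln (G y)) / ln (real CARD('a))"
      unfolding sum_divide_distrib by (intro sum.cong refl) (simp add: f xlnx_def algebra_simps)
    also have "\<dots> = ent (\<lambda>\<alpha>. p $ \<alpha>) c (\<lambda>\<sigma>. pmf (\<theta> \<sigma>) y) / ln (real CARD('a))"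
      unfolding sum_subtractf sum_distrib_right[symmetric]
      by (simp add: ent_def xlnx_def[of "mex _ _ _"] T_def G_def flip: mex_eq_sum[OF p])
    finally show "(\<Sum>\<sigma>\<in>tallies c. f (y, \<sigma>)) =
      ent (\<lambda>\<alpha>. p $ \<alpha>) c (\<lambda>\<sigma>. pmf (\<theta> \<sigma>) y) / ln (real CARD('a))" .
  qed
  finally show ?thesis
    by (simp add: sum_divide_distrib)
qed

section \<open>Entropy under product measures\<close>

text \<open>The Bregman divergence of x ln x. The linear terms make it nonnegative for unnormalised
  arguments and cancel when summed over two probability vectors.\<close>

definition kl :: "real \<Rightarrow> real \<Rightarrow> real" where
  "kl x a = x * ln (x / a) - x + a"

text \<open>For fixed \<open>s\<close> the left side is linear in \<open>x\<close> and
  \<open>a\<close> jointly, with equality at \<open>s = ln (x / a)\<close>; this dual form is what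
  yields joint convexity.\<close>

lemma kl_ge_tangent:
  assumes "x \<ge> 0" "a > 0"
  shows "x * s - a * exp s + a \<le> kl x a"
proof (cases "x = 0")
  case False
  with assms have x: "x > 0" by simp
  have "ln (a * exp s / x) \<le> a * exp s / x - 1"
    using x assms by (intro ln_le_minus_one) simp
  then have "x * ln (a * exp s / x) \<le> a * exp s - x"
    using x by (simp add: field_simps)
  then show ?thesis
    using x assms by (simp add: kl_def ln_div ln_mult algebra_simps)
qed (use assms in \<open>simp add: kl_def\<close>)

lemma kl_eq: "x \<ge> 0 \<Longrightarrow> a > 0 \<Longrightarrow> kl x a = xlnx x - x * ln a - x + a"
  by (cases "x = 0") (simp_all add: kl_def xlnx_def ln_div algebra_simps)

lemma kl_nonneg: "x \<ge> 0 \<Longrightarrow> a > 0 \<Longrightarrow> kl x a \<ge> 0"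
  using kl_ge_tangent[of x a 0] by simp

locale weights =
  fixes w :: "'a :: finite \<Rightarrow> real"
  assumes w_nonneg: "w \<beta> \<ge> 0" and w_sum: "(\<Sum>\<beta>\<in>UNIV. w \<beta>) = 1"
begin

lemma mex_pos:
  assumes "\<And>\<sigma>. \<sigma> \<in> tallies n \<Longrightarrow> a \<sigma> > 0"
  shows "mex w n a > 0"
proof -
  obtain m where m: "m > 0" "\<And>\<sigma>. \<sigma> \<in> tallies n \<Longrightarrow> a \<sigma> \<ge> m"
  proof (cases "tallies n = ({} :: ('a \<Rightarrow> nat) set)")
    case True
    then show ?thesis using that[of 1] by auto
  next
    case False
    then show ?thesis
      using assms finite_imageI[OF finite_tallies[of n], of a] that[of "Min (a ` tallies n)"]
      by (simp add: Min_gr_iff)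
  qed
  have "m = mex w n (\<lambda>_. m)" by (simp add: mex_const w_sum)
  also have "\<dots> \<le> mex w n a" by (intro mex_mono w_nonneg m)
  finally show ?thesis using m by simp
qed

lemma mex_nonneg: "(\<And>\<sigma>. \<sigma> \<in> tallies n \<Longrightarrow> f \<sigma> \<ge> 0) \<Longrightarrow> mex w n f \<ge> 0"
  using mex_mono[of w n "\<lambda>_. 0" f] by (simp add: mex_0 w_nonneg)

text \<open>Jensen for a jointly convex function: average the linear minorants, then choose the best
  \<open>s\<close> for the averages.\<close>

lemma kl_mex_le:
  assumes f: "\<And>\<sigma>. \<sigma> \<in> tallies n \<Longrightarrow> f \<sigma> \<ge> 0" and a: "\<And>\<sigma>. \<sigma> \<in> tallies n \<Longrightarrow> a \<sigma> > 0"
  shows "kl (mex w n f) (mex w n a) \<le> mex w n (\<lambda>\<sigma>. kl (f \<sigma>) (a \<sigma>))" (is "kl ?X ?A \<le> ?M")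
proof -
  have A: "?A > 0" by (rule mex_pos[of n a, OF a])
  have X: "?X \<ge> 0" by (rule mex_nonneg[of n f, OF f])
  have *: "?X * s - ?A * exp s + ?A \<le> ?M" for s
    unfolding mex_multc[symmetric] mex_diff[symmetric] mex_add[symmetric]
    by (intro mex_mono w_nonneg kl_ge_tangent f a)
  show ?thesis
  proof (cases "?X = 0")
    case True
    \<comment> \<open>Here the optimal \<open>s\<close> is minus infinity. If the claim failed, the
      finite \<open>s\<close> that turns the left side of \<open>*\<close> into the midpoint of
      \<open>?A\<close> and \<open>?M\<close> would already contradict \<open>*\<close>.\<close>
    have "?A \<le> ?M"
    proof (rule ccontr)
      assume "\<not> ?A \<le> ?M"
      then have "?A * (1 - exp (ln ((?A - ?M) / (2 * ?A)))) = (?A + ?M) / 2"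
        using A by (simp add: field_simps)
      with *[of "ln ((?A - ?M) / (2 * ?A))"] \<open>\<not> ?A \<le> ?M\<close> show False
        by (simp add: True algebra_simps)
    qed
    then show ?thesis by (simp add: True kl_def)
  next
    case False
    with X A *[of "ln (?X / ?A)"] show ?thesis by (simp add: kl_def)
  qed
qed

text \<open>The two sides differ by \<open>kl\<close> of the mean of \<open>G\<close> against
  \<open>A\<close>, which is nonnegative; \<open>A\<close> need not be the optimal reference, the
  mean.\<close>

lemma sum_kl_ge:
  assumes G: "\<And>\<beta>. G \<beta> \<ge> 0" and A: "A > 0"
  shows "(\<Sum>\<beta>\<in>UNIV. w \<beta> * xlnx (G \<beta>)) - xlnx (\<Sum>\<beta>\<in>UNIV. w \<beta> * G \<beta>) \<le> (\<Sum>\<beta>\<in>UNIV. w \<beta> * kl (G \<beta>) A)"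
proof -
  let ?G = "\<Sum>\<beta>\<in>UNIV. w \<beta> * G \<beta>"
  have "(\<Sum>\<beta>\<in>UNIV. w \<beta> * kl (G \<beta>) A) =
      (\<Sum>\<beta>\<in>UNIV. w \<beta> * xlnx (G \<beta>) - (w \<beta> * G \<beta>) * (ln A + 1) + w \<beta> * A)"
    by (intro sum.cong refl) (simp add: kl_eq G A algebra_simps)
  also have "\<dots> = (\<Sum>\<beta>\<in>UNIV. w \<beta> * xlnx (G \<beta>)) - ?G * (ln A + 1) + A"
    by (simp add: sum.distrib sum_subtractf w_sum flip: sum_distrib_right)
  moreover have "0 \<le> kl ?G A"
    by (intro kl_nonneg A sum_nonneg mult_nonneg_nonneg G w_nonneg)
  moreover have "kl ?G A = xlnx ?G - ?G * ln A - ?G + A"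
    by (intro kl_eq A sum_nonneg mult_nonneg_nonneg G w_nonneg)
  ultimately show ?thesis by (simp add: algebra_simps)
qed

text \<open>
  Tensorization of entropy: by the chain rule and joint convexity of \<open>kl\<close>, the information about the
  output is at most the sum over colluders of the information given all other colluders. The
  reference weights \<open>a\<close> may be chosen freely for each tally of the others.
\<close>

lemma ent_tensor:
  assumes "\<And>\<sigma>. \<sigma> \<in> tallies (Suc n) \<Longrightarrow> f \<sigma> \<ge> 0" "\<And>\<sigma>. \<sigma> \<in> tallies n \<Longrightarrow> a \<sigma> > 0"
  shows "ent w (Suc n) f \<le>
    real (Suc n) * mex w n (\<lambda>\<sigma>. \<Sum>\<beta>\<in>UNIV. w \<beta> * kl (f (incr \<beta> \<sigma>)) (a \<sigma>))"
  using assms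
proof (induction n arbitrary: f a)
  case 0
  have t0: "(\<lambda>_. 0) \<in> tallies 0" by (simp add: tallies_def)
  show ?case
    using sum_kl_ge[of "\<lambda>\<beta>. f (incr \<beta> (\<lambda>_. 0))" "a (\<lambda>_. 0)", OF 0(1)[OF incr_tallies[OF t0]] 0(2)[OF t0]]
    by (simp add: ent_def)
next
  case (Suc n)
  define T where "T = mex w (Suc n) (\<lambda>\<sigma>. \<Sum>\<beta>\<in>UNIV. w \<beta> * kl (f (incr \<beta> \<sigma>)) (a \<sigma>))"
  define M where "M \<beta> = mex w (Suc n) (\<lambda>\<sigma>. f (incr \<beta> \<sigma>))" for \<beta>
  have M: "M \<beta> \<ge> 0" for \<beta>
    unfolding M_def by (intro mex_nonneg Suc.prems incr_tallies)
  \<comment> \<open>Chain rule: condition on the symbol \<open>\<beta>\<close> of one colluder; the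
    remainder is the entropy of the conditional means \<open>M \<beta>\<close>.\<close>
  have split: "ent w (Suc (Suc n)) f = (\<Sum>\<beta>\<in>UNIV. w \<beta> * ent w (Suc n) (\<lambda>\<sigma>. f (incr \<beta> \<sigma>))) +
      ((\<Sum>\<beta>\<in>UNIV. w \<beta> * xlnx (M \<beta>)) - xlnx (\<Sum>\<beta>\<in>UNIV. w \<beta> * M \<beta>))"
    unfolding ent_def mex.simps(2)[of w "Suc n"] M_def
    by (simp add: right_diff_distrib sum_subtractf del: mex.simps)
  have "(\<Sum>\<beta>\<in>UNIV. w \<beta> * ent w (Suc n) (\<lambda>\<sigma>. f (incr \<beta> \<sigma>))) \<le>
      (\<Sum>\<beta>\<in>UNIV. w \<beta> * (real (Suc n) * mex w n (\<lambda>\<sigma>. \<Sum>\<beta>'\<in>UNIV. w \<beta>' * kl (f (incr \<beta> (incr \<beta>' \<sigma>))) (a (incr \<beta> \<sigma>)))))"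
    by (intro sum_mono mult_left_mono w_nonneg Suc.IH Suc.prems incr_tallies)
  also have "\<dots> = real (Suc n) * T"
    by (simp add: T_def sum_distrib_left incr_commute mult_ac)
  finally have first: "(\<Sum>\<beta>\<in>UNIV. w \<beta> * ent w (Suc n) (\<lambda>\<sigma>. f (incr \<beta> \<sigma>))) \<le> real (Suc n) * T" .
  \<comment> \<open>With the averaged reference, convexity bounds this term by one more copy of
    \<open>T\<close>, which accounts for the colluder conditioned on.\<close>
  have "(\<Sum>\<beta>\<in>UNIV. w \<beta> * xlnx (M \<beta>)) - xlnx (\<Sum>\<beta>\<in>UNIV. w \<beta> * M \<beta>) \<le>
      (\<Sum>\<beta>\<in>UNIV. w \<beta> * kl (M \<beta>) (mex w (Suc n) a))"
    by (intro sum_kl_ge M mex_pos Suc.prems)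
  also have "\<dots> \<le> (\<Sum>\<beta>\<in>UNIV. w \<beta> * mex w (Suc n) (\<lambda>\<sigma>. kl (f (incr \<beta> \<sigma>)) (a \<sigma>)))"
    unfolding M_def by (intro sum_mono mult_left_mono w_nonneg kl_mex_le Suc.prems incr_tallies)
  also have "\<dots> = T"
    unfolding T_def mex_sum mex_cmult ..
  finally show ?case
    using first unfolding split T_def[symmetric] by (simp add: algebra_simps)
qed

lemma ent_ge_aux:
  assumes f: "\<And>\<sigma>. \<sigma> \<in> tallies n \<Longrightarrow> f \<sigma> \<ge> 0" and r: "\<And>\<sigma>. \<sigma> \<in> tallies n \<Longrightarrow> r \<sigma> \<ge> 0"
    and fr: "\<And>\<sigma>. \<sigma> \<in> tallies n \<Longrightarrow> r \<sigma> = 0 \<Longrightarrow> f \<sigma> = 0"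
    and R: "mex w n r > 0"
  shows "mex w n (\<lambda>\<sigma>. f \<sigma> * ln (r \<sigma> / mex w n r)) \<le> ent w n f"
proof -
  define R where "R = mex w n r"
  define G where "G = mex w n f"
  define D where "D = mex w n (\<lambda>\<sigma>. xlnx (f \<sigma>)) - mex w n (\<lambda>\<sigma>. f \<sigma> * ln (r \<sigma> / R))"
  have R0: "R > 0" using R by (simp add: R_def)
  \<comment> \<open>The scale \<open>\<epsilon>\<close> is best chosen as \<open>G\<close>; it stays
    free because for \<open>G = 0\<close> only the limit of small \<open>\<epsilon>\<close> is
    available.\<close>
  have *: "G * ln \<epsilon> + G - \<epsilon> \<le> D" if \<epsilon>: "\<epsilon> > 0" for \<epsilon>
  proof -
    have "f \<sigma> * (ln \<epsilon> + 1) - \<epsilon> / R * r \<sigma> \<le> xlnx (f \<sigma>) - f \<sigma> * ln (r \<sigma> / R)"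
      if \<sigma>: "\<sigma> \<in> tallies n" for \<sigma>
    proof (cases "f \<sigma> = 0")
      case True
      then show ?thesis using \<epsilon> R0 r[OF \<sigma>] by (simp add: xlnx_def)
    next
      case False
      then have pos: "f \<sigma> > 0" "r \<sigma> > 0" using f[OF \<sigma>] r[OF \<sigma>] fr[OF \<sigma>] by force+
      have "0 \<le> kl (f \<sigma>) (\<epsilon> / R * r \<sigma>)"
        using pos \<epsilon> R0 by (intro kl_nonneg) auto
      also have "\<dots> = xlnx (f \<sigma>) - f \<sigma> * (ln \<epsilon> + ln (r \<sigma> / R)) - f \<sigma> + \<epsilon> / R * r \<sigma>"
        using pos \<epsilon> R0 by (subst kl_eq) (auto simp: ln_mult ln_div)
      finally show ?thesis by (simp add: algebra_simps)
    qed
    then have "mex w n (\<lambda>\<sigma>. f \<sigma> * (ln \<epsilon> + 1) - \<epsilon> / R * r \<sigma>) \<le> D"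
      unfolding D_def mex_diff[symmetric] by (intro mex_mono w_nonneg)
    then show ?thesis
      using R0 unfolding mex_diff mex_multc mex_cmult R_def[symmetric] G_def[symmetric]
      by (simp add: algebra_simps)
  qed
  have "xlnx G \<le> D"
  proof (cases "G = 0")
    case True
    then have "0 \<le> D" using *[of "- D / 2"] by (cases "D < 0") auto
    then show ?thesis by (simp add: True xlnx_def)
  next
    case False
    moreover have "G \<ge> 0" unfolding G_def by (rule mex_nonneg[of n f, OF f])
    ultimately show ?thesis using *[of G] by (simp add: xlnx_def)
  qed
  then show ?thesis by (simp add: ent_def D_def G_def R_def)
qed

lemma ent_nonneg:
  assumes "\<And>\<sigma>. \<sigma> \<in> tallies n \<Longrightarrow> f \<sigma> \<ge> 0"
  shows "ent w n f \<ge> 0"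
  using ent_ge_aux[of n f "\<lambda>_. 1", OF assms] by (simp add: mex_const w_sum mex_0)

lemma ent_ge:
  assumes f: "\<And>\<sigma>. \<sigma> \<in> tallies n \<Longrightarrow> f \<sigma> \<ge> 0" and r: "\<And>\<sigma>. \<sigma> \<in> tallies n \<Longrightarrow> r \<sigma> \<ge> 0"
    and fr: "\<And>\<sigma>. \<sigma> \<in> tallies n \<Longrightarrow> r \<sigma> = 0 \<Longrightarrow> f \<sigma> = 0"
  shows "mex w n (\<lambda>\<sigma>. f \<sigma> * ln (r \<sigma> / mex w n r)) \<le> ent w n f"
proof (cases "mex w n r = 0")
  \<comment> \<open>With a zero normaliser the quotient and its logarithm are 0 by convention, so
    the left side vanishes.\<close>
  case True
  then show ?thesis by (simp add: mex_0 ent_nonneg f)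
next
  case False
  then show ?thesis
    using mex_nonneg[of n r, OF r] by (intro ent_ge_aux f r fr) simp_all
qed

lemma mex_component: "mex w n (\<lambda>\<sigma>. real (\<sigma> \<beta>)) = real n * w \<beta>"
proof (cases n)
  case (Suc m)
  then show ?thesis using mex_size_bias[of w m \<beta> "\<lambda>_. 1"] by (simp add: mex_const w_sum del: mex.simps)
qed simp

text \<open>Size biasing with \<open>1 / \<sigma> \<beta>\<close> turns the left side into the
  probability that \<open>\<beta>\<close> occurs, divided by \<open>n + 1\<close>. No lower bound on
  \<open>w \<beta>\<close> enters, which makes the upper bound on the capacity uniform up to the
  boundary.\<close>

lemma mex_inverse_Suc: "w \<beta> * mex w n (\<lambda>\<sigma>. 1 / (real (\<sigma> \<beta>) + 1)) \<le> 1 / (real n + 1)"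
proof -
  have "real (Suc n) * (w \<beta> * mex w n (\<lambda>\<sigma>. 1 / (real (incr \<beta> \<sigma> \<beta>)))) =
      mex w (Suc n) (\<lambda>\<sigma>. real (\<sigma> \<beta>) * (1 / real (\<sigma> \<beta>)))"
    by (rule mex_size_bias[symmetric])
  also have "\<dots> \<le> mex w (Suc n) (\<lambda>\<sigma>. 1)"
    by (intro mex_mono w_nonneg) (simp add: field_simps)
  also have "\<dots> = 1" by (rule mex_const[OF w_sum])
  finally show ?thesis by (simp add: incr_apply field_simps add.commute)
qed

end

lemma weights_bias: "p \<in> bias_vectors \<Longrightarrow> weights (\<lambda>\<alpha>. p $ \<alpha>)"
  by unfold_locales (auto simp: bias_vectors_def)

section \<open>Interpolation by smooth profiles\<close>

lemma twice_differentiable_onI: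
  assumes "\<And>x. x \<in> S \<Longrightarrow> (f has_derivative blinfun_apply (f' x)) (at x within S)" "f' differentiable_on S"
  shows "twice_differentiable_on f S"
  using assms unfolding twice_differentiable_on_def by blast

lemma twice_differentiable_on_bounded_linear:
  assumes "bounded_linear f" shows "twice_differentiable_on f S"
proof (rule twice_differentiable_onI)
  show "(f has_derivative blinfun_apply (Blinfun f)) (at x within S)" for x
    using assms by (simp add: bounded_linear_Blinfun_apply bounded_linear_imp_has_derivative)
qed simp

lemma twice_differentiable_on_const: "twice_differentiable_on (\<lambda>x. a) S"
proof (rule twice_differentiable_onI)
  show "((\<lambda>x. a) has_derivative blinfun_apply 0) (at x within S)" for x
    by (simp add: zero_blinfun.rep_eq)
qed simp

lemma twice_differentiable_on_add:
  assumes "twice_differentiable_on f S" "twice_differentiable_on g S"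
  shows "twice_differentiable_on (\<lambda>x. f x + g x) S"
proof -
  obtain f' g' where f: "\<And>x. x \<in> S \<Longrightarrow> (f has_derivative blinfun_apply (f' x)) (at x within S)" "f' differentiable_on S"
    and g: "\<And>x. x \<in> S \<Longrightarrow> (g has_derivative blinfun_apply (g' x)) (at x within S)" "g' differentiable_on S"
    using assms unfolding twice_differentiable_on_def by blast
  show ?thesis
  proof (rule twice_differentiable_onI)
    show "((\<lambda>x. f x + g x) has_derivative blinfun_apply (f' x + g' x)) (at x within S)" if "x \<in> S" for x
      using has_derivative_add[OF f(1)[OF that] g(1)[OF that]] by (simp add: blinfun.add_left[abs_def])
  qed (use f g in \<open>simp add: differentiable_on_add\<close>)
qed

lemma twice_differentiable_on_imp_differentiable_on:
  "twice_differentiable_on f S \<Longrightarrow> f differentiable_on S"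
  unfolding twice_differentiable_on_def differentiable_on_def differentiable_def by blast

lemma twice_differentiable_on_mult:
  assumes "twice_differentiable_on f S" "twice_differentiable_on g S"
  shows "twice_differentiable_on (\<lambda>x. f x * g x) S"
proof -
  obtain f' g' where f: "\<And>x. x \<in> S \<Longrightarrow> (f has_derivative blinfun_apply (f' x)) (at x within S)" "f' differentiable_on S"
    and g: "\<And>x. x \<in> S \<Longrightarrow> (g has_derivative blinfun_apply (g' x)) (at x within S)" "g' differentiable_on S"
    using assms unfolding twice_differentiable_on_def by blast
  show ?thesis
  proof (rule twice_differentiable_onI)
    show "((\<lambda>x. f x * g x) has_derivative blinfun_apply (f x *\<^sub>R g' x + g x *\<^sub>R f' x)) (at x within S)" if "x \<in> S" for x
      using has_derivative_mult[OF f(1)[OF that] g(1)[OF that]]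
      by (simp add: blinfun.add_left[abs_def] blinfun.scaleR_left[abs_def] mult.commute)
  qed (intro differentiable_on_add differentiable_on_scaleR f g assms[THEN twice_differentiable_on_imp_differentiable_on])
qed

lemma twice_differentiable_on_inverse:
  assumes "twice_differentiable_on f S" "\<And>x. x \<in> S \<Longrightarrow> f x \<noteq> 0"
  shows "twice_differentiable_on (\<lambda>x. inverse (f x)) S"
proof -
  obtain f' where f: "\<And>x. x \<in> S \<Longrightarrow> (f has_derivative blinfun_apply (f' x)) (at x within S)" "f' differentiable_on S"
    using assms(1) unfolding twice_differentiable_on_def by blast
  have inv: "(\<lambda>x. inverse (f x)) differentiable_on S"
    using assms by (simp add: twice_differentiable_on_imp_differentiable_on)
  show ?thesis
  proof (rule twice_differentiable_onI)
    show "((\<lambda>x. inverse (f x)) has_derivative blinfun_apply ((inverse (f x) *\<^sub>R inverse (f x)) *\<^sub>R (- f' x))) (at x within S)" if "x \<in> S" for x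
      using Deriv.has_derivative_inverse[OF assms(2)[OF that] f(1)[OF that]]
      by (simp add: blinfun.scaleR_left[abs_def] blinfun.minus_left[abs_def] mult_ac)
  qed (intro differentiable_on_scaleR differentiable_on_minus f inv)
qed

lemma twice_differentiable_on_sum:
  "(\<And>i. i \<in> I \<Longrightarrow> twice_differentiable_on (f i) S) \<Longrightarrow> twice_differentiable_on (\<lambda>x. \<Sum>i\<in>I. f i x) S"
  by (induction I rule: infinite_finite_induct)
    (simp_all add: twice_differentiable_on_const twice_differentiable_on_add)

lemma twice_differentiable_on_prod:
  "(\<And>i. i \<in> I \<Longrightarrow> twice_differentiable_on (f i) S) \<Longrightarrow> twice_differentiable_on (\<lambda>x. \<Prod>i\<in>I. f i x) S"
  by (induction I rule: infinite_finite_induct)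
    (simp_all add: twice_differentiable_on_const twice_differentiable_on_mult)

text \<open>
  Profiles may depend on \<open>c\<close>, so Shepard interpolation of the grid values shows that the continuum
  assumption restricts nothing beyond the marking assumption. The square of \<open>\<Sum>x - 1\<close> only keeps the
  denominator positive off the simplex.
\<close>

lemma marking_imp_continuum:
  fixes \<theta> :: "('a :: finite \<Rightarrow> nat) \<Rightarrow> 'a pmf"
  assumes c: "c > 0" and mark: "marking_assumption c \<theta>"
  shows "continuum_assumption c \<theta>"
proof -
  define grid where "grid \<sigma> = (\<chi> \<alpha>. real (\<sigma> \<alpha>) / real c)" for \<sigma> :: "'a \<Rightarrow> nat"
  define d where "d \<tau> x = (\<Sum>\<alpha>\<in>UNIV. (x $ \<alpha> - grid \<tau> $ \<alpha>) * (x $ \<alpha> - grid \<tau> $ \<alpha>))" for \<tau> and x :: "real ^ 'a"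
  \<comment> \<open>The first product vanishes at all other grid points. The second vanishes where a
    symbol present in \<open>\<sigma>\<close> has coordinate 0, which gives the marking condition
    off the grid as well.\<close>
  define v where "v \<sigma> x = (\<Prod>\<tau>\<in>tallies c - {\<sigma>}. d \<tau> x) * (\<Prod>\<alpha>\<in>{\<alpha>. \<sigma> \<alpha> > 0}. x $ \<alpha>)"
    for \<sigma> and x :: "real ^ 'a"
  define V where "V x = (\<Sum>\<sigma>\<in>tallies c. v \<sigma> x) + ((\<Sum>\<alpha>\<in>UNIV. x $ \<alpha>) + - 1) * ((\<Sum>\<alpha>\<in>UNIV. x $ \<alpha>) + - 1)" for x :: "real ^ 'a"
  define g where "g y x = (\<Sum>\<sigma>\<in>tallies c. pmf (\<theta> \<sigma>) y * v \<sigma> x) * inverse (V x)" for y x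
  have grid_inj: "\<sigma> = \<tau>" if "grid \<sigma> = grid \<tau>" for \<sigma> \<tau>
    using that c by (auto simp: grid_def vec_eq_iff fun_eq_iff)
  have d_nonneg: "d \<tau> x \<ge> 0" for \<tau> x
    unfolding d_def by (intro sum_nonneg) simp
  have d_0: "d \<tau> x = 0 \<longleftrightarrow> x = grid \<tau>" for \<tau> x
    unfolding d_def by (subst sum_nonneg_eq_0_iff) (auto simp: vec_eq_iff)
  have v_nonneg: "v \<sigma> x \<ge> 0" if "x \<in> unit_cube" for \<sigma> x
    using that unfolding v_def by (intro mult_nonneg_nonneg prod_nonneg) (auto simp: d_nonneg unit_cube_def)
  have v_pos: "v \<sigma> x > 0" if "x \<in> unit_cube" "\<And>\<alpha>. \<sigma> \<alpha> > 0 \<Longrightarrow> x $ \<alpha> > 0"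
    "\<And>\<tau>. \<tau> \<in> tallies c \<Longrightarrow> \<tau> \<noteq> \<sigma> \<Longrightarrow> x \<noteq> grid \<tau>" for \<sigma> x
  proof -
    have "d \<tau> x > 0" if "\<tau> \<in> tallies c - {\<sigma>}" for \<tau>
      using that d_nonneg[of \<tau> x] d_0[of \<tau> x] \<open>\<And>\<tau>. \<tau> \<in> tallies c \<Longrightarrow> \<tau> \<noteq> \<sigma> \<Longrightarrow> x \<noteq> grid \<tau>\<close>[of \<tau>]
      by auto
    then have "(\<Prod>\<tau>\<in>tallies c - {\<sigma>}. d \<tau> x) > 0" by (rule prod_pos)
    moreover have "(\<Prod>\<alpha>\<in>{\<alpha>. \<sigma> \<alpha> > 0}. x $ \<alpha>) > 0"
      using that(2) by (intro prod_pos) simp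
    ultimately show ?thesis by (simp add: v_def)
  qed
  have V_pos: "V x > 0" if x: "x \<in> unit_cube" for x
  proof -
    have S: "(\<Sum>\<sigma>\<in>tallies c. v \<sigma> x) \<ge> 0" by (intro sum_nonneg v_nonneg x)
    show ?thesis
    proof (cases "(\<Sum>\<alpha>\<in>UNIV. x $ \<alpha>) = 1")
      case False
      then have "((\<Sum>\<alpha>\<in>UNIV. x $ \<alpha>) + - 1) * ((\<Sum>\<alpha>\<in>UNIV. x $ \<alpha>) + - 1) > 0"
        by (auto simp: zero_less_mult_iff)
      with S show ?thesis unfolding V_def by linarith
    next
      case True
      \<comment> \<open>At a grid point its own tally has positive weight; elsewhere on the simplex
        the unanimous tally of any symbol with positive coordinate does.\<close>
      obtain \<sigma> where \<sigma>: "\<sigma> \<in> tallies c" "v \<sigma> x > 0"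
      proof (cases "\<exists>\<tau>\<in>tallies c. x = grid \<tau>")
        case True
        then obtain \<tau> where "\<tau> \<in> tallies c" "x = grid \<tau>" by blast
        then show ?thesis
          using x c grid_inj by (intro that[of \<tau>] v_pos) (auto simp: grid_def[of \<tau>])
      next
        case False
        have "\<exists>\<alpha>. x $ \<alpha> \<noteq> 0"
          using \<open>sum _ _ = 1\<close> by (auto intro: ccontr)
        then obtain \<alpha> where "x $ \<alpha> > 0" using x by (force simp: unit_cube_def less_le)
        moreover have "(\<lambda>\<beta>. if \<beta> = \<alpha> then c else 0) \<in> tallies c" by (simp add: tallies_def)
        ultimately show ?thesis
          using False x by (intro that v_pos) (auto split: if_splits)
      qed
      have "v \<sigma> x \<le> (\<Sum>\<sigma>\<in>tallies c. v \<sigma> x)"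
        by (intro member_le_sum \<sigma> v_nonneg x finite_tallies)
      with \<sigma> True show ?thesis by (simp add: V_def)
    qed
  qed
  have td_coord: "twice_differentiable_on (\<lambda>x. x $ \<alpha>) unit_cube" for \<alpha> :: 'a
    by (intro twice_differentiable_on_bounded_linear bounded_linear_vec_nth)
  have td_d: "twice_differentiable_on (d \<tau>) unit_cube" for \<tau>
    unfolding d_def diff_conv_add_uminus
    by (intro twice_differentiable_on_sum twice_differentiable_on_mult twice_differentiable_on_add
        td_coord twice_differentiable_on_const)
  have td_v: "twice_differentiable_on (v \<sigma>) unit_cube" for \<sigma>
    unfolding v_def by (intro twice_differentiable_on_mult twice_differentiable_on_prod td_d td_coord)
  have td_V: "twice_differentiable_on V unit_cube"
    unfolding V_def
    by (intro twice_differentiable_on_sum twice_differentiable_on_mult twice_differentiable_on_add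
        td_coord td_v twice_differentiable_on_const)
  have td_g: "twice_differentiable_on (g y) unit_cube" for y
    unfolding g_def
    by (intro twice_differentiable_on_sum twice_differentiable_on_mult twice_differentiable_on_inverse
        td_v td_V twice_differentiable_on_const) (use V_pos in force)
  have g_range: "g y x \<in> {0..1}" if x: "x \<in> unit_cube" for y x
  proof -
    have "(\<Sum>\<sigma>\<in>tallies c. pmf (\<theta> \<sigma>) y * v \<sigma> x) \<ge> 0"
      by (intro sum_nonneg mult_nonneg_nonneg v_nonneg x) simp
    moreover have "(\<Sum>\<sigma>\<in>tallies c. pmf (\<theta> \<sigma>) y * v \<sigma> x) \<le> (\<Sum>\<sigma>\<in>tallies c. v \<sigma> x)"
      by (intro sum_mono mult_left_le_one_le v_nonneg x) (simp_all add: pmf_le_1)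
    moreover have "(\<Sum>\<sigma>\<in>tallies c. v \<sigma> x) \<le> V x"
      by (simp add: V_def)
    ultimately show ?thesis
      using V_pos[OF x] by (simp add: g_def field_simps)
  qed
  have g_0: "g \<alpha> x = 0" if "x \<in> unit_cube" "x $ \<alpha> = 0" for \<alpha> x
  proof -
    have "pmf (\<theta> \<sigma>) \<alpha> * v \<sigma> x = 0" if "\<sigma> \<in> tallies c" for \<sigma>
    proof (cases "\<sigma> \<alpha> = 0")
      case True
      then show ?thesis using mark that by (simp add: marking_assumption_def)
    next
      case False
      then have "(\<Prod>\<alpha>\<in>{\<alpha>. \<sigma> \<alpha> > 0}. x $ \<alpha>) = 0"
        using \<open>x $ \<alpha> = 0\<close> by (intro prod_zero) auto
      then show ?thesis by (simp add: v_def)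
    qed
    then have "(\<Sum>\<sigma>\<in>tallies c. pmf (\<theta> \<sigma>) \<alpha> * v \<sigma> x) = 0" by (intro sum.neutral) blast
    then show ?thesis by (simp add: g_def)
  qed
  have g_sum: "(\<Sum>\<alpha>\<in>UNIV. g \<alpha> x) = 1" if x: "x \<in> unit_cube" "(\<Sum>\<alpha>\<in>UNIV. x $ \<alpha>) = 1" for x
  proof -
    have pmf1: "(\<Sum>\<alpha>\<in>UNIV. pmf (\<theta> \<sigma>) \<alpha>) = 1" for \<sigma>
      by (rule sum_pmf_eq_1) auto
    have "(\<Sum>\<alpha>\<in>UNIV. \<Sum>\<sigma>\<in>tallies c. pmf (\<theta> \<sigma>) \<alpha> * v \<sigma> x) = (\<Sum>\<sigma>\<in>tallies c. v \<sigma> x)"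
      by (subst sum.swap) (simp add: pmf1 flip: sum_distrib_right)
    then show ?thesis
      using V_pos[OF x(1)] x(2) by (simp add: g_def V_def flip: sum_distrib_right)
  qed
  have g_grid: "g \<alpha> (grid \<sigma>) = pmf (\<theta> \<sigma>) \<alpha>" if \<sigma>: "\<sigma> \<in> tallies c" for \<alpha> \<sigma>
  proof -
    have gs: "grid \<sigma> \<in> unit_cube"
      using c tally_le[OF \<sigma>] by (simp add: unit_cube_def grid_def)
    have "(\<Sum>\<alpha>\<in>UNIV. grid \<sigma> $ \<alpha>) = real (\<Sum>\<alpha>\<in>UNIV. \<sigma> \<alpha>) / real c"
      by (simp add: grid_def sum_divide_distrib)
    then have sum1: "(\<Sum>\<alpha>\<in>UNIV. grid \<sigma> $ \<alpha>) = 1"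
      using \<sigma> c by (simp add: tallies_def del: of_nat_sum)
    have v0: "v \<tau> (grid \<sigma>) = 0" if "\<tau> \<noteq> \<sigma>" for \<tau>
    proof -
      have "(\<Prod>\<tau>\<in>tallies c - {\<tau>}. d \<tau> (grid \<sigma>)) = 0"
        using that \<sigma> finite_tallies[of c] d_0[of \<sigma> "grid \<sigma>"] by (intro prod_zero) auto
      then show ?thesis by (simp add: v_def)
    qed
    have s: "(\<Sum>\<tau>\<in>tallies c. h \<tau> * v \<tau> (grid \<sigma>)) = h \<sigma> * v \<sigma> (grid \<sigma>)" for h
      using \<sigma> finite_tallies[of c] v0 by (subst sum.remove[of _ \<sigma>]) (auto intro!: sum.neutral)
    show ?thesis
      using s[of "\<lambda>_. 1"] s[of "\<lambda>\<tau>. pmf (\<theta> \<tau>) \<alpha>"] V_pos[OF gs] sum1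
      by (simp add: g_def V_def)
  qed
  have "continuum_profile g"
    unfolding continuum_profile_def using td_g g_range g_0 g_sum by blast
  moreover have "\<forall>\<sigma>\<in>tallies c. \<forall>\<alpha>. g \<alpha> (\<chi> \<beta>. real (\<sigma> \<beta>) / real c) = pmf (\<theta> \<sigma>) \<alpha>"
    using g_grid by (simp add: grid_def)
  ultimately show ?thesis
    unfolding continuum_assumption_def by blast
qed

section \<open>The damped interleaving attack\<close>

text \<open>
  Weight of a symbol held by \<open>x\<close> colluders. Plain interleaving (\<open>L = 0\<close>) leaks too much about symbols
  held by boundedly many colluders; the damping suppresses those, keeps \<open>r'\<^sup>2 / r \<le> 1 / x\<close> as for
  interleaving, and changes the weights by a factor \<open>1 - o(1)\<close> only as long as \<open>L = o(sqrt c)\<close>.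
  The value at \<open>x = 0\<close> is 0.
\<close>

definition damped :: "real \<Rightarrow> real \<Rightarrow> real" where
  "damped L x = x * exp (- L / sqrt x)"

lemma damped_0 [simp]: "damped L 0 = 0"
  by (simp add: damped_def)

lemma damped_pos: "x > 0 \<Longrightarrow> damped L x > 0"
  by (simp add: damped_def)

lemma damped_nonneg: "x \<ge> 0 \<Longrightarrow> damped L x \<ge> 0"
  by (simp add: damped_def)

lemma damped_le: "x \<ge> 0 \<Longrightarrow> L \<ge> 0 \<Longrightarrow> damped L x \<le> x"
  unfolding damped_def by (rule mult_left_le) auto

lemma damped_ge:
  assumes "x \<ge> 0"
  shows "damped L x \<ge> x - L * sqrt x"
proof (cases "x = 0")
  case False
  then have x: "x > 0" using assms by simp
  have "x * (1 + - L / sqrt x) \<le> damped L x"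
    unfolding damped_def by (intro mult_left_mono exp_ge_add_one_self assms)
  moreover have "x * (1 + - L / sqrt x) = x - L * sqrt x"
    using x real_sqrt_mult_self[of x] by (simp add: field_simps)
  ultimately show ?thesis by simp
qed simp

lemma damped_has_derivative:
  assumes "x > 0"
  shows "(damped L has_real_derivative exp (- L / sqrt x) * (1 + L / (2 * sqrt x))) (at x)"
proof -
  have "((\<lambda>x. x * exp (- L / sqrt x)) has_real_derivative
      exp (- L / sqrt x) * (1 + L / (2 * sqrt x))) (at x)"
    using assms
    by (auto intro!: derivative_eq_intros simp: field_simps power2_eq_square)
  then show ?thesis by (simp add: damped_def[abs_def])
qed

lemma damped_step:
  assumes "x > 0"
  obtains \<xi> where "x < \<xi>" "\<xi> < x + 1"
    "damped L (x + 1) - damped L x = exp (- L / sqrt \<xi>) * (1 + L / (2 * sqrt \<xi>))"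
  using MVT2[of x "x + 1" "damped L" "\<lambda>x. exp (- L / sqrt x) * (1 + L / (2 * sqrt x))"]
    damped_has_derivative[of _ L] assms by force

text \<open>With \<open>v = L / sqrt x\<close> the left side is x r'^2 / r for the damped weight r,
  so this is the inequality r'^2 / r \<le> 1/x.\<close>

lemma exp_minus_bound:
  fixes v :: real
  assumes "v \<ge> 0"
  shows "exp (- v) * (1 + v / 2)\<^sup>2 \<le> 1"
proof -
  have "(1 + v / 2)\<^sup>2 \<le> (exp (v / 2))\<^sup>2"
    using assms by (intro power_mono exp_ge_add_one_self) simp
  also have "\<dots> = exp v" by (simp add: power2_eq_square flip: exp_add)
  finally show ?thesis by (simp add: exp_minus field_simps)
qed

text \<open>For strongly damped symbols a spare part of the exponent still gains a factor 2, enough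
  to absorb \<open>x + 1 \<le> 2 * x\<close>. The proof uses 2 \<le> (3/2)^2 and splits the
  exponential into four equal factors.\<close>

lemma exp_minus_bound_large:
  fixes v :: real
  assumes "v \<ge> 100"
  shows "exp (- (2 / 5 * v)) * (1 + v / 2)\<^sup>2 \<le> 1 / 2"
proof -
  have "2 * (1 + v / 2)\<^sup>2 \<le> (3 / 2 * (1 + v / 2))\<^sup>2"
    by (subst power_mult_distrib) (simp add: power2_eq_square mult_right_mono)
  also have "\<dots> \<le> ((1 + v / 10)\<^sup>2)\<^sup>2"
  proof (rule power_mono)
    have "3 / 2 * (1 + v / 2) \<le> 1 + v / 5 + t / 100" if "100 * v \<le> t" for t
      using assms that by (simp add: field_simps)
    from this[of "v * v"] show "3 / 2 * (1 + v / 2) \<le> (1 + v / 10)\<^sup>2"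
      using assms by (simp add: power2_eq_square algebra_simps)
  qed (use assms in auto)
  also have "\<dots> = (1 + v / 10) ^ 4" by simp
  also have "\<dots> \<le> exp (v / 10) ^ 4"
    using assms by (intro power_mono exp_ge_add_one_self) simp
  also have "\<dots> = exp (2 / 5 * v)" by (simp flip: exp_of_nat_mult)
  finally show ?thesis by (simp add: exp_minus field_simps)
qed

lemma damped_step_nonneg:
  assumes "x \<ge> 0" "L \<ge> 0"
  shows "damped L (x + 1) - damped L x \<ge> 0"
proof (cases "x = 0")
  case False
  then obtain \<xi> where "x < \<xi>" "damped L (x + 1) - damped L x = exp (- L / sqrt \<xi>) * (1 + L / (2 * sqrt \<xi>))"
    using damped_step[of x L] assms by auto
  then show ?thesis using assms by simp
qed (simp add: damped_def)

lemma damped_step_ge: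
  assumes "x \<ge> 1 \<or> x = 0" "L \<ge> 1"
  shows "damped L (x + 1) - damped L x \<ge> 1 - 2 * L / sqrt (x + 1)"
proof (cases "x = 0")
  case True
  have "0 \<le> damped L 1" by (rule damped_nonneg) simp
  with True assms show ?thesis by simp
next
  case False
  then have x: "x \<ge> 1" using assms by simp
  then obtain \<xi> where \<xi>: "x < \<xi>" and eq: "damped L (x + 1) - damped L x = exp (- L / sqrt \<xi>) * (1 + L / (2 * sqrt \<xi>))"
    using damped_step[of x L] by auto
  have "sqrt (x + 1) \<le> sqrt (4 * \<xi>)" using x \<xi> by (intro real_sqrt_le_mono) simp
  then have s: "sqrt (x + 1) \<le> 2 * sqrt \<xi>" by (simp add: real_sqrt_mult)
  have "1 - 2 * L / sqrt (x + 1) \<le> 1 + - L / sqrt \<xi>"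
    using s x \<xi> assms by (simp add: field_simps)
  also have "\<dots> \<le> exp (- L / sqrt \<xi>)" by (rule exp_ge_add_one_self)
  also have "\<dots> \<le> exp (- L / sqrt \<xi>) * (1 + L / (2 * sqrt \<xi>))"
    using x \<xi> assms by simp
  finally show ?thesis using eq by simp
qed

text \<open>Discrete form of r'^2 / r \<le> 1/x. For \<open>v \<ge> 100\<close> the spare decay pays
  for replacing the derivative by a difference. For \<open>v < 100\<close>, x = L^2 / v^2 is large
  and the loss is at most exp((1 + v)/x) = exp((1 + v) v^2 / L^2); here (1 + v) v^2 is at most 101 *
  100^2 = 1010000.\<close>

lemma damped_step_square_le:
  assumes x: "x \<ge> 1" and L: "L > 0" and \<eta>: "exp (1010000 / L\<^sup>2) \<le> 1 + \<eta>"
  shows "(x + 1) * (damped L (x + 1) - damped L x)\<^sup>2 \<le> (1 + \<eta>) * damped L x"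
proof -
  define v where "v = L / sqrt x"
  define \<delta> where "\<delta> = damped L (x + 1) - damped L x"
  have v: "v > 0" using x L by (simp add: v_def)
  obtain \<xi> where \<xi>: "x < \<xi>" "\<xi> < x + 1" and eq: "\<delta> = exp (- L / sqrt \<xi>) * (1 + L / (2 * sqrt \<xi>))"
    using damped_step[of x L] x unfolding \<delta>_def by (metis less_le_trans zero_less_one)
  have \<delta>0: "\<delta> \<ge> 0" using x L \<xi> by (simp add: eq)
  have "\<delta> \<le> exp (- L / sqrt (x + 1)) * (1 + L / (2 * sqrt x))"
    unfolding eq using x L \<xi> by (intro mult_mono) (auto intro!: divide_left_mono)
  then have "\<delta>\<^sup>2 \<le> (exp (- L / sqrt (x + 1)) * (1 + v / 2))\<^sup>2"
    using \<delta>0 by (intro power_mono) (auto simp: v_def mult.commute)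
  also have "\<dots> = exp (- 2 * L / sqrt (x + 1)) * (1 + v / 2)\<^sup>2"
    by (simp add: power_mult_distrib flip: exp_double)
  finally have \<delta>2: "\<delta>\<^sup>2 \<le> exp (- 2 * L / sqrt (x + 1)) * (1 + v / 2)\<^sup>2" .
  have dx: "damped L x = x * exp (- v)" by (simp add: damped_def v_def)
  have L_eq: "L / sqrt (x + 1) = v * sqrt (x / (x + 1))"
    using x by (simp add: v_def real_sqrt_divide)
  have m2: "- 2 * L / sqrt (x + 1) = - 2 * (L / sqrt (x + 1))" by simp
  have key: "(x + 1) * (exp (- 2 * L / sqrt (x + 1)) * (1 + v / 2)\<^sup>2) \<le> (1 + \<eta>) * (x * exp (- v))"
  proof (cases "v \<ge> 100")
    case True
    \<comment> \<open>7/10 lies below sqrt(1/2), and 2 * 7/10 = 1 + 2/5 leaves the exponent 2/5 to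
      spare.\<close>
    have "sqrt ((7 / 10)\<^sup>2) \<le> sqrt (x / (x + 1))"
      using x by (intro real_sqrt_le_mono) (simp add: field_simps power2_eq_square)
    then have "7 / 10 \<le> sqrt (x / (x + 1))" by simp
    then have "v * (7 / 10) \<le> L / sqrt (x + 1)"
      unfolding L_eq using v by (intro mult_left_mono) auto
    then have "exp (- 2 * L / sqrt (x + 1)) \<le> exp (- v) * exp (- (2 / 5 * v))"
      unfolding exp_add[symmetric] exp_le_cancel_iff m2 by linarith
    then have "exp (- 2 * L / sqrt (x + 1)) * (1 + v / 2)\<^sup>2 \<le> exp (- v) * exp (- (2 / 5 * v)) * (1 + v / 2)\<^sup>2"
      by (rule mult_right_mono) simp
    also have "\<dots> = exp (- v) * (exp (- (2 / 5 * v)) * (1 + v / 2)\<^sup>2)" by simp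
    also have "\<dots> \<le> exp (- v) * (1 / 2)"
      by (intro mult_left_mono exp_minus_bound_large True) simp
    finally have "(x + 1) * (exp (- 2 * L / sqrt (x + 1)) * (1 + v / 2)\<^sup>2) \<le> (x + 1) * (exp (- v) * (1 / 2))"
      using x by (intro mult_left_mono) auto
    also have "\<dots> = ((x + 1) / 2) * exp (- v)" by simp
    also have "\<dots> \<le> ((1 + \<eta>) * x) * exp (- v)"
    proof (rule mult_right_mono)
      have "1 \<le> exp (1010000 / L\<^sup>2)" by simp
      with \<eta> have "1 \<le> 1 + \<eta>" by (rule order_trans[rotated])
      then have "1 * x \<le> (1 + \<eta>) * x" using x by (intro mult_right_mono) auto
      moreover have "(x + 1) / 2 \<le> 1 * x" using x by simp
      ultimately show "(x + 1) / 2 \<le> (1 + \<eta>) * x" by (rule order_trans[rotated])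
    qed simp
    finally show ?thesis by (simp add: mult_ac)
  next
    case False
    have "(1 - 1 / (2 * x))\<^sup>2 \<le> x / (x + 1)"
      using x by (simp add: field_simps power2_eq_square)
    then have "sqrt ((1 - 1 / (2 * x))\<^sup>2) \<le> sqrt (x / (x + 1))"
      by (rule real_sqrt_le_mono)
    then have "1 - 1 / (2 * x) \<le> sqrt (x / (x + 1))"
      using x by simp
    then have "v * (1 - 1 / (2 * x)) \<le> L / sqrt (x + 1)"
      unfolding L_eq using v by (intro mult_left_mono) auto
    also have "v * (1 - 1 / (2 * x)) = v - 1 / 2 * (v / x)"
      by (simp add: algebra_simps)
    finally have "exp (- 2 * L / sqrt (x + 1)) \<le> exp (- v) * exp (- v) * exp (v / x)"
      unfolding exp_add[symmetric] exp_le_cancel_iff m2 by linarith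
    then have "exp (- 2 * L / sqrt (x + 1)) * (1 + v / 2)\<^sup>2 \<le> exp (- v) * exp (- v) * exp (v / x) * (1 + v / 2)\<^sup>2"
      by (rule mult_right_mono) simp
    also have "\<dots> = exp (- v) * exp (v / x) * (exp (- v) * (1 + v / 2)\<^sup>2)" by simp
    also have "\<dots> \<le> exp (- v) * exp (v / x) * 1"
      using v by (intro mult_left_mono exp_minus_bound) auto
    finally have "(x + 1) * (exp (- 2 * L / sqrt (x + 1)) * (1 + v / 2)\<^sup>2) \<le> (x + 1) * (exp (- v) * exp (v / x))"
      using x by (intro mult_left_mono) auto
    also have "\<dots> = (1 + 1 / x) * exp (v / x) * (x * exp (- v))"
      using x by (simp add: field_simps)
    also have "\<dots> \<le> (1 + \<eta>) * (x * exp (- v))"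
    proof (rule mult_right_mono)
      have x_eq: "x = L\<^sup>2 / v\<^sup>2" using x L by (simp add: v_def power_divide)
      have "v\<^sup>2 \<le> 100\<^sup>2" using v False by (intro power_mono) auto
      then have "(1 + v) * v\<^sup>2 \<le> 101 * 100\<^sup>2" using v False by (intro mult_mono) auto
      then have "(1 + v) * v\<^sup>2 / L\<^sup>2 \<le> 1010000 / L\<^sup>2"
        by (intro divide_right_mono) auto
      then have "(1 + v) / x \<le> 1010000 / L\<^sup>2"
        unfolding x_eq by simp
      moreover have "(1 + 1 / x) * exp (v / x) \<le> exp (1 / x) * exp (v / x)"
        by (intro mult_right_mono exp_ge_add_one_self) simp
      moreover have "exp (1 / x) * exp (v / x) = exp ((1 + v) / x)"
        by (simp add: add_divide_distrib flip: exp_add)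
      ultimately show "(1 + 1 / x) * exp (v / x) \<le> 1 + \<eta>"
        using \<eta> by (smt (verit) exp_le_cancel_iff)
    qed (use x in simp)
    finally show ?thesis .
  qed
  have "(x + 1) * \<delta>\<^sup>2 \<le> (x + 1) * (exp (- 2 * L / sqrt (x + 1)) * (1 + v / 2)\<^sup>2)"
    using \<delta>2 x by (intro mult_left_mono) auto
  with key show ?thesis by (simp add: \<delta>_def dx)
qed

text \<open>The quadratic term is essential: with \<open>u\<close> about 1/c it produces the -1 in q
  - 1.\<close>

lemma ln_one_minus_le:
  fixes u :: real
  assumes "0 \<le> u" "u < 1"
  shows "ln (1 - u) \<le> - u - u\<^sup>2 / 2"
proof -
  define f where "f u = - u - u\<^sup>2 / 2 - ln (1 - u)" for u :: real
  have "f 0 \<le> f u"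
  proof (rule DERIV_nonneg_imp_nondecreasing[OF assms(1)])
    fix x assume x: "0 \<le> x" "x \<le> u"
    have "(f has_real_derivative (x\<^sup>2 / (1 - x))) (at x)"
      unfolding f_def using x assms
      by (auto intro!: derivative_eq_intros simp: field_simps power2_eq_square)
    then show "\<exists>y. (f has_real_derivative y) (at x) \<and> 0 \<le> y"
      using x assms by force
  qed
  then show ?thesis by (simp add: f_def)
qed

text \<open>To the right of \<open>a\<close> the Taylor remainder has the favourable sign. The
  general bound (x - a)^2 / a would lose a factor 2 and with it the sharp constant;
  \<open>x \<ge> a\<close> holds in the application because one more holder increases the
  weight.\<close>

lemma kl_le_square:
  assumes "a > 0" "x \<ge> a"
  shows "kl x a \<le> (x - a)\<^sup>2 / (2 * a)"
proof -
  define f where "f x = (x - a)\<^sup>2 / (2 * a) - kl x a" for x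
  have "f a \<le> f x"
  proof (rule DERIV_nonneg_imp_nondecreasing[OF assms(2)])
    fix x assume x: "a \<le> x"
    have "(f has_real_derivative (x / a - 1 - ln (x / a))) (at x)"
      unfolding f_def kl_def using x assms(1)
      by (auto intro!: derivative_eq_intros simp: field_simps power2_eq_square)
    moreover have "ln (x / a) \<le> x / a - 1"
      using x assms(1) by (intro ln_le_minus_one) simp
    ultimately show "\<exists>y. (f has_real_derivative y) (at x) \<and> 0 \<le> y"
      by force
  qed
  moreover have "f a = 0" using assms by (simp add: f_def kl_def)
  ultimately show ?thesis by (simp add: f_def)
qed

section \<open>Divergence of the attack under a change of one colluder's symbol\<close>

definition attack :: "real \<Rightarrow> ('a :: finite \<Rightarrow> nat) \<Rightarrow> 'a pmf" where
  "attack L \<sigma> = embed_pmf (\<lambda>y. damped L (\<sigma> y) / (\<Sum>\<alpha>\<in>UNIV. damped L (\<sigma> \<alpha>)))"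

lemma damped_sum_pos:
  fixes \<sigma> :: "'a :: finite \<Rightarrow> nat"
  assumes "\<sigma> \<in> tallies c" "c > 0"
  shows "(\<Sum>\<alpha>\<in>UNIV. damped L (\<sigma> \<alpha>)) > 0"
proof -
  have "(\<Sum>\<alpha>\<in>UNIV. \<sigma> \<alpha>) \<noteq> 0" using assms by (simp add: tallies_def)
  then obtain \<alpha> where "\<sigma> \<alpha> > 0" by auto
  then have "0 < damped L (\<sigma> \<alpha>)" by (simp add: damped_pos)
  also have "\<dots> \<le> (\<Sum>\<alpha>\<in>UNIV. damped L (\<sigma> \<alpha>))"
    by (rule member_le_sum) (simp_all add: damped_nonneg)
  finally show ?thesis .
qed

lemma pmf_attack:
  fixes \<sigma> :: "'a :: finite \<Rightarrow> nat"
  assumes "\<sigma> \<in> tallies c" "c > 0"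
  shows "pmf (attack L \<sigma>) y = damped L (\<sigma> y) / (\<Sum>\<alpha>\<in>UNIV. damped L (\<sigma> \<alpha>))"
  unfolding attack_def
proof (rule pmf_embed_pmf)
  note pos = damped_sum_pos[OF assms, of L]
  show nonneg: "0 \<le> damped L (\<sigma> x) / (\<Sum>\<alpha>\<in>UNIV. damped L (\<sigma> \<alpha>))" for x
    using pos by (simp add: damped_nonneg)
  have "(\<Sum>x\<in>UNIV. damped L (\<sigma> x) / (\<Sum>\<alpha>\<in>UNIV. damped L (\<sigma> \<alpha>))) = 1"
    using pos by (simp flip: sum_divide_distrib)
  then show "(\<integral>\<^sup>+ x. ennreal (damped L (\<sigma> x) / (\<Sum>\<alpha>\<in>UNIV. damped L (\<sigma> \<alpha>))) \<partial>count_space UNIV) = 1"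
    using nonneg by (simp add: nn_integral_count_space_finite)
qed

lemma attack_in_strategies:
  assumes "c > 0"
  shows "(attack L :: ('a :: finite \<Rightarrow> nat) \<Rightarrow> 'a pmf) \<in> attack_strategies c"
proof -
  have "marking_assumption c (attack L :: ('a \<Rightarrow> nat) \<Rightarrow> 'a pmf)"
    unfolding marking_assumption_def
  proof (intro ballI allI conjI impI)
    fix \<sigma> :: "'a \<Rightarrow> nat" and \<alpha> assume \<sigma>: "\<sigma> \<in> tallies c"
    show "pmf (attack L \<sigma>) \<alpha> = 0" if "\<sigma> \<alpha> = 0"
      by (simp add: pmf_attack[OF \<sigma> assms] that)
    show "pmf (attack L \<sigma>) \<alpha> = 1" if "\<sigma> \<alpha> = c"
    proof -
      have "(\<Sum>\<beta>\<in>UNIV - {\<alpha>}. \<sigma> \<beta>) = 0"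
        using \<sigma> that by (simp add: tallies_def sum.remove[of UNIV \<alpha>])
      then have "(\<Sum>\<beta>\<in>UNIV - {\<alpha>}. damped L (\<sigma> \<beta>)) = 0"
        by (intro sum.neutral) auto
      then have "(\<Sum>\<beta>\<in>UNIV. damped L (\<sigma> \<beta>)) = damped L (\<sigma> \<alpha>)"
        by (simp add: sum.remove[of UNIV \<alpha>])
      then show ?thesis
        using damped_sum_pos[OF \<sigma> assms, of L] by (simp add: pmf_attack[OF \<sigma> assms])
    qed
  qed
  then show ?thesis
    using marking_imp_continuum[OF assms] by (simp add: attack_strategies_def)
qed

text \<open>
  The reference \<open>b\<close> replaces the weight 0 of absent symbols by the weight of a symbol held once, which
  keeps the divergence finite.
\<close>

lemma attack_kl_le:
  fixes \<sigma> :: "'a :: finite \<Rightarrow> nat" and L \<eta> R\<^sub>0 :: real and n :: nat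
  defines "c \<equiv> real (Suc n)" and "q \<equiv> real CARD('a)"
    and "b \<equiv> \<lambda>y. if \<sigma> y = 0 then exp (- L) else damped L (\<sigma> y)"
  assumes \<sigma>: "\<sigma> \<in> tallies n" and L: "L \<ge> 1" and \<eta>: "exp (1010000 / L\<^sup>2) \<le> 1 + \<eta>"
    and R\<^sub>0: "R\<^sub>0 > 0" "R\<^sub>0 \<le> real n - q * L * sqrt c"
  shows "(\<Sum>y\<in>UNIV. kl (pmf (attack L (incr \<beta> \<sigma>)) y) (b y / sum b UNIV)) \<le>
    (q * exp (- L) / R\<^sub>0 - 1 / (2 * c\<^sup>2) + L / (c\<^sup>2 * sqrt c)) +
    ((1 + \<eta>) / (2 * R\<^sub>0) + L * sqrt c / c\<^sup>2) * (1 / (real (\<sigma> \<beta>) + 1))"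
proof -
  define k where "k = real (\<sigma> \<beta>)"
  define a where "a y = damped L (\<sigma> y)" for y
  define a' where "a' y = damped L (incr \<beta> \<sigma> y)" for y
  define R where "R = sum a UNIV"
  define R' where "R' = sum a' UNIV"
  define B where "B = sum b UNIV"
  define \<delta> where "\<delta> = a' \<beta> - a \<beta>"
  define u where "u = \<delta> / R'"
  have c: "c \<ge> 1" by (simp add: c_def)
  have q0: "q \<ge> 0" by (simp add: q_def)
  have k0: "k \<ge> 1 \<or> k = 0" by (auto simp: k_def)
  have b_pos: "b y > 0" for y by (simp add: b_def damped_pos)
  have a_nonneg: "a y \<ge> 0" for y by (simp add: a_def damped_nonneg)
  have a'_nonneg: "a' y \<ge> 0" for y by (simp add: a'_def damped_nonneg)
  have a'_eq: "a' y = a y" if "y \<noteq> \<beta>" for y using that by (simp add: a_def a'_def incr_apply)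
  have a\<beta>: "a \<beta> = damped L k" and a'\<beta>: "a' \<beta> = damped L (k + 1)"
    by (simp_all add: a_def a'_def k_def incr_apply add.commute)
  have \<delta>0: "\<delta> \<ge> 0"
    unfolding \<delta>_def a\<beta> a'\<beta> using damped_step_nonneg[of k L] L by (simp add: k_def)
  have a'_pos: "a' \<beta> > 0" unfolding a'\<beta> by (rule damped_pos) (simp add: k_def)
  have R': "R' = R + \<delta>"
    by (simp add: R'_def R_def \<delta>_def sum.remove[of UNIV \<beta>] a'_eq)
  have sum_\<sigma>: "(\<Sum>y\<in>UNIV. real (\<sigma> y)) = real n"
    using \<sigma> by (simp add: tallies_def flip: of_nat_sum)
  \<comment> \<open>Damping costs each of the q symbols at most \<open>L * sqrt c\<close> of its
    weight.\<close>
  have "R\<^sub>0 \<le> (\<Sum>y\<in>UNIV. real (\<sigma> y)) - (\<Sum>y\<in>(UNIV :: 'a set). L * sqrt c)"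
    using R\<^sub>0 by (simp add: sum_\<sigma> q_def)
  also have "\<dots> = (\<Sum>y\<in>UNIV. real (\<sigma> y) - L * sqrt c)" by (simp add: sum_subtractf)
  also have "\<dots> \<le> R"
    unfolding R_def
  proof (rule sum_mono)
    fix y
    have "real (\<sigma> y) \<le> c" using tally_le[OF \<sigma>, of y] by (simp add: c_def)
    then have "L * sqrt (real (\<sigma> y)) \<le> L * sqrt c" using L by (intro mult_left_mono real_sqrt_le_mono) auto
    then show "real (\<sigma> y) - L * sqrt c \<le> a y"
      using damped_ge[of "real (\<sigma> y)" L] by (simp add: a_def)
  qed
  finally have R: "R\<^sub>0 \<le> R" .
  with R\<^sub>0 have Rpos: "R > 0" by simp
  have R'pos: "R' > 0" using R' Rpos \<delta>0 by simp
  have "R' \<le> (\<Sum>y\<in>UNIV. real (incr \<beta> \<sigma> y))"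
    unfolding R'_def a'_def using L by (intro sum_mono damped_le) auto
  also have "\<dots> = c"
    using incr_tallies[OF \<sigma>, of \<beta>] by (simp add: c_def tallies_def flip: of_nat_sum)
  finally have R'c: "R' \<le> c" .
  have u: "0 \<le> u" "u < 1" using \<delta>0 R'pos R' Rpos by (auto simp: u_def)
  have Bpos: "B > 0" unfolding B_def by (rule sum_pos) (auto simp: b_pos)
  have "B \<le> (\<Sum>y\<in>UNIV. a y + exp (- L))"
    unfolding B_def by (intro sum_mono) (auto simp: b_def a_def)
  also have "\<dots> = R + q * exp (- L)" by (simp add: sum.distrib R_def q_def)
  finally have "B / R \<le> 1 + q * exp (- L) / R" using Rpos by (simp add: field_simps)
  moreover have "ln (B / R) \<le> B / R - 1" using Bpos Rpos by (intro ln_le_minus_one) simp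
  moreover have "q * exp (- L) / R \<le> q * exp (- L) / R\<^sub>0"
    using R R\<^sub>0 q0 by (intro divide_left_mono) auto
  ultimately have lnB: "ln (B / R) \<le> q * exp (- L) / R\<^sub>0" by simp
  have "R / R' = 1 - u" using R' R'pos by (simp add: u_def field_simps)
  then have lnR: "ln (R / R') \<le> - u - u\<^sup>2 / 2" using ln_one_minus_le[OF u] by simp
  have lnBR': "ln (B / R') = ln (B / R) + ln (R / R')"
    using Bpos Rpos R'pos by (simp add: ln_div)
  have attack: "pmf (attack L (incr \<beta> \<sigma>)) y = a' y / R'" for y
    using pmf_attack[OF incr_tallies[OF \<sigma>, of \<beta>], of L y] by (simp add: a'_def R'_def)
  \<comment> \<open>Only \<open>\<beta>\<close> changes its weight; all other present symbols feel
    just the common normalisation \<open>B / R'\<close>. The linear terms cancel on summation over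
    \<open>y\<close>.\<close>
  have kl_term: "kl (a' y / R') (b y / B) = a' y / R' * ln (B / R') +
      (if y = \<beta> then a' \<beta> / R' * ln (a' \<beta> / b \<beta>) else 0) - a' y / R' + b y / B" for y
  proof (cases "a' y = 0")
    case True
    then show ?thesis using a'_pos by (auto simp: kl_def)
  next
    case False
    then have pos: "a' y > 0" using a'_nonneg[of y] by simp
    have "ln (a' y / R' / (b y / B)) = ln (B / R') + ln (a' y / b y)"
      using pos Bpos R'pos b_pos[of y] by (simp add: ln_div ln_mult)
    moreover have "a' y = b y" if "y \<noteq> \<beta>"
      using a'_eq[OF that] False by (cases "\<sigma> y = 0") (auto simp: b_def a_def)
    ultimately show ?thesis using b_pos[of y] by (auto simp: kl_def algebra_simps)
  qed
  have "(\<Sum>y\<in>UNIV. kl (pmf (attack L (incr \<beta> \<sigma>)) y) (b y / sum b UNIV)) =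
      ln (B / R') + a' \<beta> / R' * ln (a' \<beta> / b \<beta>)"
    using R'pos Bpos
    by (simp add: attack B_def[symmetric] kl_term sum.distrib sum_subtractf
        flip: sum_distrib_right sum_divide_distrib R'_def)
  \<comment> \<open>The leading \<open>u\<close> cancels against the \<open>- u\<close> from the
    normalisation, so only second-order terms survive.\<close>
  also have "a' \<beta> / R' * ln (a' \<beta> / b \<beta>) \<le> u + (1 + \<eta>) / (2 * R\<^sub>0) * (1 / (k + 1))"
  proof -
    have \<eta>1: "1 + \<eta> \<ge> 0" using \<eta> by (rule order_trans[rotated]) simp
    show ?thesis
    proof (cases "k = 0")
      case True
      \<comment> \<open>\<open>damped L 1 = exp (- L)\<close> is the reference weight of an absent
        symbol, so the logarithm vanishes on first occurrence.\<close>
      then have "a' \<beta> = b \<beta>" by (simp add: a'\<beta> b_def k_def damped_def)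
      then show ?thesis using u \<eta>1 R\<^sub>0 k0 b_pos[of \<beta>] by (auto intro!: add_nonneg_nonneg)
    next
      case False
      then have k1: "k \<ge> 1" using k0 by simp
      have ba: "b \<beta> = a \<beta>" using False by (simp add: b_def a_def k_def)
      have apos: "a \<beta> > 0" using b_pos[of \<beta>] by (simp add: ba)
      have "a' \<beta> * ln (a' \<beta> / a \<beta>) = \<delta> + kl (a' \<beta>) (a \<beta>)" by (simp add: kl_def \<delta>_def)
      also have "kl (a' \<beta>) (a \<beta>) \<le> \<delta>\<^sup>2 / (2 * a \<beta>)"
        unfolding \<delta>_def using apos \<delta>0 by (intro kl_le_square) (auto simp: \<delta>_def)
      also have "\<delta>\<^sup>2 / (2 * a \<beta>) \<le> (1 + \<eta>) / 2 * (1 / (k + 1))"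
      proof -
        have "(k + 1) * \<delta>\<^sup>2 \<le> (1 + \<eta>) * a \<beta>"
          unfolding \<delta>_def a\<beta> a'\<beta> using damped_step_square_le[OF k1 _ \<eta>] L by simp
        then show ?thesis using k1 apos by (simp add: field_simps)
      qed
      finally have "a' \<beta> * ln (a' \<beta> / a \<beta>) / R' \<le> (\<delta> + (1 + \<eta>) / 2 * (1 / (k + 1))) / R'"
        using R'pos by (intro divide_right_mono) auto
      also have "\<dots> = u + ((1 + \<eta>) / 2 * (1 / (k + 1))) / R'"
        by (simp add: u_def add_divide_distrib)
      also have "((1 + \<eta>) / 2 * (1 / (k + 1))) / R' \<le> ((1 + \<eta>) / 2 * (1 / (k + 1))) / R\<^sub>0"
        using R\<^sub>0 R R' \<delta>0 \<eta>1 k1 by (intro divide_left_mono) auto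
      also have "((1 + \<eta>) / 2 * (1 / (k + 1))) / R\<^sub>0 = (1 + \<eta>) / (2 * R\<^sub>0) * (1 / (k + 1))"
        by (simp add: mult_ac)
      finally show ?thesis by (simp add: ba)
    qed
  qed
  also have "ln (B / R') \<le> q * exp (- L) / R\<^sub>0 + (- u - u\<^sup>2 / 2)"
    unfolding lnBR' using lnB lnR by simp
  also have "- u - u\<^sup>2 / 2 \<le> - u + (- 1 / (2 * c\<^sup>2) + L / (c\<^sup>2 * sqrt c) + L * sqrt c / c\<^sup>2 * (1 / (k + 1)))"
  proof -
    define s where "s = sqrt (k + 1)"
    have s: "s > 0" "s * s = k + 1" using k0 by (auto simp: s_def)
    have "\<delta> / c \<le> u" unfolding u_def using R'c R'pos c \<delta>0 by (intro divide_left_mono) auto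
    then have "(\<delta> / c)\<^sup>2 \<le> u\<^sup>2" using \<delta>0 c by (intro power_mono) auto
    moreover have "1 - 2 * L / s \<le> \<delta>"
      unfolding \<delta>_def a\<beta> a'\<beta> s_def using k0 L by (intro damped_step_ge)
    \<comment> \<open>A linear minorant of the square keeps the argument valid when
      \<open>1 - 2 * L / s\<close> is negative.\<close>
    moreover have "2 * \<delta> - 1 \<le> \<delta>\<^sup>2" using zero_le_power2[of "\<delta> - 1"] by (simp add: power2_diff)
    ultimately have "(\<delta> / c)\<^sup>2 \<le> u\<^sup>2" "1 - 2 * (2 * L / s) \<le> \<delta>\<^sup>2" by linarith+
    from this(1) divide_right_mono[OF this(2), of "c\<^sup>2"]
    have "(1 - 2 * (2 * L / s)) / c\<^sup>2 \<le> u\<^sup>2"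
      by (simp add: power_divide)
    moreover have "(1 - 2 * (2 * L / s)) / c\<^sup>2 = 1 / c\<^sup>2 - 2 * (2 * L / c\<^sup>2 * (1 / s))"
      by (simp add: diff_divide_distrib)
    ultimately have u2: "1 / c\<^sup>2 - 2 * (2 * L / c\<^sup>2 * (1 / s)) \<le> u\<^sup>2" by simp
    \<comment> \<open>Only the mean of \<open>1 / (k + 1)\<close> is controlled, so the
      arithmetic-geometric mean inequality trades its square root for it.\<close>
    have "1 / s \<le> (1 / sqrt c + sqrt c * (1 / (k + 1))) / 2"
    proof -
      have sq: "(1 / r - 1 / s)\<^sup>2 * r = 1 / r - 2 / s + r / (s * s)" if "r > 0" for r
        using that s(1) by (simp add: power2_eq_square field_simps)
      have "0 \<le> (1 / sqrt c - 1 / s)\<^sup>2 * sqrt c" using c by simp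
      also have "\<dots> = 1 / sqrt c - 2 / s + sqrt c / (s * s)"
        using c by (intro sq) simp
      finally show ?thesis by (simp add: s)
    qed
    then have "2 * L / c\<^sup>2 * (1 / s) \<le> 2 * L / c\<^sup>2 * ((1 / sqrt c + sqrt c * (1 / (k + 1))) / 2)"
      using L by (intro mult_left_mono) auto
    also have "\<dots> = L / (c\<^sup>2 * sqrt c) + L * sqrt c / c\<^sup>2 * (1 / (k + 1))"
    proof -
      have "2 * L / C * ((X + y * Y) / 2) = L / C * X + L * y / C * Y" for C X y Y :: real
        by (simp add: add_divide_distrib distrib_left)
      moreover have "L / (c\<^sup>2 * sqrt c) = L / c\<^sup>2 * (1 / sqrt c)" by simp
      ultimately show ?thesis by (simp only:)
    qed
    finally show ?thesis using u2 by simp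
  qed
  finally show ?thesis
    by (simp add: k_def algebra_simps)
qed

text \<open>After tensorization and exchange of the sums, each \<open>\<beta>\<close> contributes
  \<open>p $ \<beta>\<close> times the mean of \<open>1 / (\<sigma> \<beta> + 1)\<close>, at most
  \<open>1 / c\<close>. Together they give \<open>q / c\<close>, whatever \<open>p\<close>
  is.\<close>

lemma attack_info_le:
  fixes p :: "real ^ 'a :: finite" and L \<eta> R\<^sub>0 :: real and n :: nat
  defines "c \<equiv> real (Suc n)" and "q \<equiv> real CARD('a)"
  assumes p: "p \<in> bias_vectors" and L: "L \<ge> 1" and \<eta>: "exp (1010000 / L\<^sup>2) \<le> 1 + \<eta>"
    and R\<^sub>0: "R\<^sub>0 > 0" "R\<^sub>0 \<le> real n - q * L * sqrt c"
  shows "(\<Sum>y\<in>UNIV. ent (\<lambda>\<alpha>. p $ \<alpha>) (Suc n) (\<lambda>\<sigma>. pmf (attack L \<sigma>) y)) \<le>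
    c * ((q * exp (- L) / R\<^sub>0 - 1 / (2 * c\<^sup>2) + L / (c\<^sup>2 * sqrt c)) +
    ((1 + \<eta>) / (2 * R\<^sub>0) + L * sqrt c / c\<^sup>2) * (q / c))"
proof -
  interpret weights "\<lambda>\<alpha>. p $ \<alpha>" by (rule weights_bias[OF p])
  define E where "E = mex (\<lambda>\<alpha>. p $ \<alpha>) n"
  define b where "b \<sigma> y = (if \<sigma> y = 0 then exp (- L) else damped L (\<sigma> y))" for \<sigma> :: "'a \<Rightarrow> nat" and y
  define D where "D \<beta> y \<sigma> = kl (pmf (attack L (incr \<beta> \<sigma>)) y) (b \<sigma> y / sum (b \<sigma>) UNIV)" for \<beta> y \<sigma>
  define A where "A = q * exp (- L) / R\<^sub>0 - 1 / (2 * c\<^sup>2) + L / (c\<^sup>2 * sqrt c)"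
  define B where "B = (1 + \<eta>) / (2 * R\<^sub>0) + L * sqrt c / c\<^sup>2"
  have "1 + \<eta> \<ge> 0" using \<eta> by (rule order_trans[rotated]) simp
  then have B: "B \<ge> 0" using R\<^sub>0 L by (simp add: B_def c_def)
  have b_pos: "b \<sigma> y / sum (b \<sigma>) UNIV > 0" for \<sigma> y
    by (intro divide_pos_pos sum_pos) (auto simp: b_def damped_pos)
  have "(\<Sum>y\<in>UNIV. ent (\<lambda>\<alpha>. p $ \<alpha>) (Suc n) (\<lambda>\<sigma>. pmf (attack L \<sigma>) y)) \<le>
      (\<Sum>y\<in>UNIV. c * E (\<lambda>\<sigma>. \<Sum>\<beta>\<in>UNIV. p $ \<beta> * D \<beta> y \<sigma>))"
    unfolding c_def E_def D_def by (intro sum_mono ent_tensor b_pos) simp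
  also have "\<dots> = c * (\<Sum>\<beta>\<in>UNIV. p $ \<beta> * E (\<lambda>\<sigma>. \<Sum>y\<in>UNIV. D \<beta> y \<sigma>))"
    unfolding E_def mex_sum mex_cmult sum_distrib_left[symmetric]
    by (subst sum.swap) (simp add: sum_distrib_left)
  also have "\<dots> \<le> c * (\<Sum>\<beta>\<in>UNIV. p $ \<beta> * E (\<lambda>\<sigma>. A + B * (1 / (real (\<sigma> \<beta>) + 1))))"
    unfolding E_def
  proof (intro mult_left_mono sum_mono mex_mono w_nonneg)
    fix \<beta> :: 'a and \<sigma> :: "'a \<Rightarrow> nat" assume \<sigma>: "\<sigma> \<in> tallies n"
    show "(\<Sum>y\<in>UNIV. D \<beta> y \<sigma>) \<le> A + B * (1 / (real (\<sigma> \<beta>) + 1))"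
      using attack_kl_le[OF \<sigma> L \<eta> R\<^sub>0[unfolded q_def c_def], of \<beta>]
      by (simp add: D_def b_def A_def B_def c_def q_def)
  qed (simp add: c_def)
  also have "\<dots> = c * (\<Sum>\<beta>\<in>UNIV. p $ \<beta> * A + B * (p $ \<beta> * E (\<lambda>\<sigma>. 1 / (real (\<sigma> \<beta>) + 1))))"
    unfolding E_def mex_add mex_cmult mex_const[OF w_sum] by (simp add: algebra_simps)
  also have "\<dots> \<le> c * (\<Sum>\<beta>\<in>UNIV. p $ \<beta> * A + B * (1 / (real n + 1)))"
    unfolding E_def by (intro mult_left_mono sum_mono add_mono mex_inverse_Suc B order_refl) (simp add: c_def)
  also have "\<dots> = c * (A + B * (q / c))"
    by (simp add: sum.distrib w_sum q_def c_def add.commute flip: sum_distrib_right)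
  finally show ?thesis by (simp add: A_def B_def)
qed

section \<open>Dirichlet bias distributions\<close>

lemma bias_distributionsD:
  assumes "F \<in> bias_distributions"
  shows "prob_space F" "space F = bias_vectors" "f \<in> borel_measurable borel \<Longrightarrow> f \<in> borel_measurable F"
proof -
  show "prob_space F" using assms by (simp add: bias_distributions_def)
  have sets: "sets F = sets (restrict_space borel bias_vectors)"
    using assms by (simp add: bias_distributions_def)
  from sets_eq_imp_space_eq[OF this] show "space F = bias_vectors" by (simp add: space_restrict_space)
  show "f \<in> borel_measurable F" if "f \<in> borel_measurable borel"
    using measurable_restrict_space1[OF that] measurable_cong_sets[OF sets refl] by blast
qed

lemma bias_integrable:
  fixes f :: "real ^ 'a \<Rightarrow> real"
  assumes F: "F \<in> bias_distributions" and f: "f \<in> borel_measurable borel"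
    and B: "\<And>p. p \<in> bias_vectors \<Longrightarrow> \<bar>f p\<bar> \<le> B"
  shows "integrable F f"
proof -
  interpret prob_space F by (rule bias_distributionsD(1)[OF F])
  show ?thesis
    by (rule integrable_const_bound[of _ B])
      (auto simp: bias_distributionsD[OF F] B f)
qed

text \<open>The mixture is the monadic bind of the weights \<open>W\<close> with the family, so that
  convex combinations of strategies for the bias are again strategies.\<close>

lemma bias_mixture:
  fixes \<F> :: "'i :: finite \<Rightarrow> (real ^ 'a) measure"
  assumes \<F>: "\<And>i. \<F> i \<in> bias_distributions"
  obtains F where "F \<in> bias_distributions"
    "\<And>f B. f \<in> borel_measurable borel \<Longrightarrow> (\<And>p. p \<in> bias_vectors \<Longrightarrow> \<bar>f p\<bar> \<le> B) \<Longrightarrow>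
      integral\<^sup>L F f = (\<Sum>i\<in>UNIV. pmf W i * integral\<^sup>L (\<F> i) f)"
proof -
  let ?N = "restrict_space borel bias_vectors :: (real ^ 'a) measure"
  have N: "\<F> \<in> measurable (measure_pmf W) (prob_algebra ?N)"
    using \<F> by (auto simp: measurable_def space_prob_algebra bias_distributions_def)
  have W: "measure_pmf W \<in> space (prob_algebra (count_space UNIV))"
    by (simp add: space_prob_algebra measure_pmf.prob_space_axioms)
  have N': "\<F> \<in> measurable (count_space UNIV) (prob_algebra ?N)" using N by simp
  show thesis
  proof (rule that[of "measure_pmf W \<bind> \<F>"])
    show "measure_pmf W \<bind> \<F> \<in> bias_distributions"
      using prob_space_bind'[OF W N'] sets_bind'[OF W N'] by (simp add: bias_distributions_def)
    fix f :: "real ^ 'a \<Rightarrow> real" and B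
    assume f: "f \<in> borel_measurable borel" and B: "\<And>p. p \<in> bias_vectors \<Longrightarrow> \<bar>f p\<bar> \<le> B"
    have "integral\<^sup>L (measure_pmf W \<bind> \<F>) f = (\<integral>i. integral\<^sup>L (\<F> i) f \<partial>measure_pmf W)"
    proof (rule integral_bind[where K = ?N and B = B and B' = 1])
      show "f \<in> borel_measurable ?N" by (rule measurable_restrict_space1[OF f])
      show "\<bar>f p\<bar> \<le> B" if "p \<in> space ?N" for p
        using that B by (simp add: space_restrict_space)
      show "\<F> \<in> measurable (measure_pmf W) (subprob_algebra ?N)"
        using N by (rule measurable_prob_algebraD)
      show "AE i in measure_pmf W. emeasure (\<F> i) (space (\<F> i)) \<le> ennreal 1"
        using bias_distributionsD(1)[OF \<F>] by (simp add: prob_space.emeasure_space_1)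
    qed (rule measure_pmf.finite_measure_axioms)
    also have "\<dots> = (\<Sum>i\<in>UNIV. pmf W i * integral\<^sup>L (\<F> i) f)"
      by (subst integral_measure_pmf[of UNIV]) auto
    finally show "integral\<^sup>L (measure_pmf W \<bind> \<F>) f = (\<Sum>i\<in>UNIV. pmf W i * integral\<^sup>L (\<F> i) f)" .
  qed
qed

text \<open>
  A Dirichlet vector is a vector of independent Gamma variables divided by its sum. Tilting the joint
  density by the \<open>N\<close>-th power of the sum avoids the independence of the sum and the quotient: moments
  of degree at most \<open>N\<close> become polynomial moments of the Gamma variables.
\<close>

definition gamma_density :: "real \<Rightarrow> real \<Rightarrow> real" where
  "gamma_density k x = indicator {0<..} x * (x powr (k - 1) / exp x) / Gamma k"

lemma gamma_density_nonneg: "k > 0 \<Longrightarrow> gamma_density k x \<ge> 0"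
  by (simp add: gamma_density_def Gamma_real_pos less_imp_le)

lemma gamma_density_measurable [measurable]: "gamma_density k \<in> borel_measurable borel"
  unfolding gamma_density_def[abs_def] by measurable

lemma gamma_density_moment:
  assumes k: "k > 0"
  shows "has_bochner_integral lborel (\<lambda>x. gamma_density k x * x ^ n) (pochhammer k n)"
proof (rule has_bochner_integral_nn_integral)
  have G: "Gamma k > 0" using k by (rule Gamma_real_pos)
  have poch: "pochhammer k n = Gamma (k + real n) / Gamma k"
    using k by (intro pochhammer_Gamma) (auto simp: nonpos_Ints_def)
  show "AE x in lborel. 0 \<le> gamma_density k x * x ^ n"
    using k by (intro AE_I2) (auto simp: gamma_density_def Gamma_real_pos less_imp_le indicator_def)
  show "0 \<le> pochhammer k n" using k by (simp add: pochhammer_nonneg)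
  have "(\<integral>\<^sup>+ x. ennreal (gamma_density k x * x ^ n) \<partial>lborel) =
      (\<integral>\<^sup>+ x. ennreal (1 / Gamma k) * ennreal (indicator {0..} x * x powr (k + real n - 1) / exp x) \<partial>lborel)"
  proof (rule nn_integral_cong_AE)
    \<comment> \<open>The density excludes 0 while the Gamma integral includes it; a null
      set.\<close>
    have "AE x in lborel. x \<noteq> (0 :: real)"
      by (rule AE_lborel_singleton)
    then show "AE x in lborel. ennreal (gamma_density k x * x ^ n) =
        ennreal (1 / Gamma k) * ennreal (indicator {0..} x * x powr (k + real n - 1) / exp x)"
    proof eventually_elim
      case (elim x)
      have "x powr (k - 1) * x ^ n = x powr (k + real n - 1)" if "x > 0"
        using that by (simp add: powr_realpow[symmetric] powr_add[symmetric] algebra_simps)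
      then show ?case
        using elim G by (auto simp: gamma_density_def indicator_def ennreal_mult'[symmetric])
    qed
  qed
  also have "\<dots> = ennreal (1 / Gamma k) * ennreal (Gamma (k + real n))"
    using k by (subst nn_integral_cmult) (auto simp: Gamma_conv_nn_integral_real)
  also have "\<dots> = ennreal (pochhammer k n)"
    using G by (simp add: poch ennreal_mult'[symmetric])
  finally show "(\<integral>\<^sup>+ x. ennreal (gamma_density k x * x ^ n) \<partial>lborel) = ennreal (pochhammer k n)" .
qed simp

text \<open>Expanding one factor of the sum raises one exponent at a time; the resulting factors
  \<open>k \<beta> + n \<beta>\<close> add up to the next factor of the outer
  \<open>pochhammer\<close>.\<close>

lemma gamma_product_moment:
  fixes k :: "'a :: finite \<Rightarrow> real"
  assumes k: "\<And>\<alpha>. k \<alpha> > 0"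
  shows "has_bochner_integral (Pi\<^sub>M UNIV (\<lambda>_ :: 'a. lborel))
    (\<lambda>x. (\<Prod>\<alpha>\<in>UNIV. gamma_density (k \<alpha>) (x \<alpha>)) * (\<Prod>\<alpha>\<in>UNIV. x \<alpha> ^ n \<alpha>) * (\<Sum>\<alpha>\<in>UNIV. x \<alpha>) ^ j)
    ((\<Prod>\<alpha>\<in>UNIV. pochhammer (k \<alpha>) (n \<alpha>)) * pochhammer ((\<Sum>\<alpha>\<in>UNIV. k \<alpha>) + (\<Sum>\<alpha>\<in>UNIV. n \<alpha>)) j)"
proof (induction j arbitrary: n)
  case 0
  interpret product_sigma_finite "\<lambda>_ :: 'a. lborel :: real measure" ..
  have int: "integrable lborel (\<lambda>x. gamma_density (k \<alpha>) x * x ^ n \<alpha>)"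
    "integral\<^sup>L lborel (\<lambda>x. gamma_density (k \<alpha>) x * x ^ n \<alpha>) = pochhammer (k \<alpha>) (n \<alpha>)" for \<alpha>
    using gamma_density_moment[OF k, of \<alpha> "n \<alpha>"] by (auto simp: has_bochner_integral_iff)
  show ?case
    using product_integrable_prod[of UNIV "\<lambda>\<alpha> x. gamma_density (k \<alpha>) x * x ^ n \<alpha>"]
      product_integral_prod[of UNIV "\<lambda>\<alpha> x. gamma_density (k \<alpha>) x * x ^ n \<alpha>"] int
    by (simp add: has_bochner_integral_iff prod.distrib)
next
  case (Suc j)
  define K where "K = (\<Sum>\<alpha>\<in>UNIV. k \<alpha>)"
  define P where "P = (\<Prod>\<alpha>\<in>UNIV. pochhammer (k \<alpha>) (n \<alpha>))"
  have prod_incr: "(\<Prod>\<alpha>\<in>UNIV. f \<alpha> (incr \<beta> n \<alpha>)) = f \<beta> (Suc (n \<beta>)) * (\<Prod>\<alpha>\<in>UNIV - {\<beta>}. f \<alpha> (n \<alpha>))"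
    for f :: "'a \<Rightarrow> nat \<Rightarrow> real" and \<beta>
    by (simp add: prod.remove[of UNIV \<beta>] incr_apply)
  have xs: "(\<Prod>\<alpha>\<in>UNIV. x \<alpha> ^ incr \<beta> n \<alpha>) = x \<beta> * (\<Prod>\<alpha>\<in>UNIV. x \<alpha> ^ n \<alpha>)" for \<beta> and x :: "'a \<Rightarrow> real"
    using prod_incr[of "\<lambda>\<alpha> m. x \<alpha> ^ m" \<beta>] by (simp add: prod.remove[of UNIV \<beta>])
  have ps: "(\<Prod>\<alpha>\<in>UNIV. pochhammer (k \<alpha>) (incr \<beta> n \<alpha>)) = (k \<beta> + real (n \<beta>)) * P" for \<beta>
    using prod_incr[of "\<lambda>\<alpha> m. pochhammer (k \<alpha>) m" \<beta>]
    by (simp add: P_def prod.remove[of UNIV \<beta>] pochhammer_rec')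
  have ns: "(\<Sum>\<alpha>\<in>UNIV. incr \<beta> n \<alpha>) = Suc (\<Sum>\<alpha>\<in>UNIV. n \<alpha>)" for \<beta>
    by (simp add: sum.remove[of UNIV \<beta>] incr_apply)
  have "has_bochner_integral (Pi\<^sub>M UNIV (\<lambda>_ :: 'a. lborel))
    (\<lambda>x. \<Sum>\<beta>\<in>UNIV. (\<Prod>\<alpha>\<in>UNIV. gamma_density (k \<alpha>) (x \<alpha>)) * (\<Prod>\<alpha>\<in>UNIV. x \<alpha> ^ incr \<beta> n \<alpha>) * (\<Sum>\<alpha>\<in>UNIV. x \<alpha>) ^ j)
    (\<Sum>\<beta>\<in>UNIV. (\<Prod>\<alpha>\<in>UNIV. pochhammer (k \<alpha>) (incr \<beta> n \<alpha>)) * pochhammer (K + (\<Sum>\<alpha>\<in>UNIV. incr \<beta> n \<alpha>)) j)"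
    unfolding K_def by (intro has_bochner_integral_sum Suc)
  also have "(\<lambda>x. \<Sum>\<beta>\<in>UNIV. (\<Prod>\<alpha>\<in>UNIV. gamma_density (k \<alpha>) (x \<alpha>)) * (\<Prod>\<alpha>\<in>UNIV. x \<alpha> ^ incr \<beta> n \<alpha>) * (\<Sum>\<alpha>\<in>UNIV. x \<alpha>) ^ j) =
    (\<lambda>x. (\<Prod>\<alpha>\<in>UNIV. gamma_density (k \<alpha>) (x \<alpha>)) * (\<Prod>\<alpha>\<in>UNIV. x \<alpha> ^ n \<alpha>) * (\<Sum>\<alpha>\<in>UNIV. x \<alpha>) ^ Suc j)"
    by (simp add: xs sum_distrib_left sum_distrib_right mult_ac fun_eq_iff)
  also have "(\<Sum>\<beta>\<in>UNIV. (\<Prod>\<alpha>\<in>UNIV. pochhammer (k \<alpha>) (incr \<beta> n \<alpha>)) * pochhammer (K + (\<Sum>\<alpha>\<in>UNIV. incr \<beta> n \<alpha>)) j) =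
    (\<Sum>\<beta>\<in>UNIV. (k \<beta> + real (n \<beta>)) * (P * pochhammer (K + real (\<Sum>\<alpha>\<in>UNIV. n \<alpha>) + 1) j))"
    by (simp add: ps ns add_ac mult_ac)
  also have "\<dots> = P * pochhammer (K + real (\<Sum>\<alpha>\<in>UNIV. n \<alpha>)) (Suc j)"
    by (simp add: pochhammer_rec sum.distrib K_def flip: sum_distrib_right)
  finally show ?case by (simp add: P_def K_def)
qed

lemma prod_simplex:
  assumes "p \<in> bias_vectors" shows "(\<Prod>\<alpha>\<in>UNIV. p $ \<alpha> ^ n \<alpha>) \<in> {0..1}"
  using assms by (auto simp: bias_vectors_def intro!: prod_nonneg prod_le_1 power_le_one)

lemma dirichlet_exists:
  fixes k :: "'a :: finite \<Rightarrow> real"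
  assumes k: "\<And>\<alpha>. k \<alpha> > 0"
  obtains F where "F \<in> bias_distributions"
    "\<And>n. (\<Sum>\<alpha>\<in>UNIV. n \<alpha>) \<le> N \<Longrightarrow> (\<integral>p. (\<Prod>\<alpha>\<in>UNIV. p $ \<alpha> ^ n \<alpha>) \<partial>F) =
      (\<Prod>\<alpha>\<in>UNIV. pochhammer (k \<alpha>) (n \<alpha>)) / pochhammer (\<Sum>\<alpha>\<in>UNIV. k \<alpha>) (\<Sum>\<alpha>\<in>UNIV. n \<alpha>)"
proof -
  define M where "M = Pi\<^sub>M UNIV (\<lambda>_ :: 'a. lborel :: real measure)"
  define K where "K = (\<Sum>\<alpha>\<in>UNIV. k \<alpha>)"
  define g where "g x = (\<Prod>\<alpha>\<in>UNIV. gamma_density (k \<alpha>) (x \<alpha>))" for x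
  define s where "s x = (\<Sum>\<alpha>\<in>UNIV. x \<alpha>)" for x :: "'a \<Rightarrow> real"
  define d where "d x = g x * s x ^ N / pochhammer K N" for x
  \<comment> \<open>Off the positive orthant the density vanishes; the uniform vector only makes
    \<open>P\<close> map everything into the simplex.\<close>
  define P where "P x = (if \<forall>\<alpha>. x \<alpha> > 0 then (\<chi> \<alpha>. x \<alpha> / s x) else (\<chi> \<alpha>. 1 / real CARD('a)))" for x
  have K: "K > 0" using k by (auto simp: K_def intro!: sum_pos)
  have poch: "pochhammer K m > 0" for m using K by (rule pochhammer_pos)
  have [measurable]: "(\<lambda>x. x \<alpha>) \<in> borel_measurable M" for \<alpha>
    using measurable_component_singleton[of \<alpha> UNIV "\<lambda>_. lborel :: real measure"] by (simp add: M_def)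
  have [measurable]: "g \<in> borel_measurable M" "s \<in> borel_measurable M"
    unfolding g_def[abs_def] s_def[abs_def] by measurable
  have [measurable]: "d \<in> borel_measurable M"
    unfolding d_def[abs_def] by measurable
  have g_nonneg: "g x \<ge> 0" for x
    unfolding g_def by (intro prod_nonneg) (simp add: gamma_density_nonneg k)
  have g_pos: "x \<alpha> > 0" if "g x \<noteq> 0" for x \<alpha>
    using that unfolding g_def by (auto simp: gamma_density_def indicator_def split: if_splits)
  have s_pos: "s x > 0" if "\<forall>\<alpha>. x \<alpha> > 0" for x
    unfolding s_def using that by (intro sum_pos) auto
  have d_nonneg: "d x \<ge> 0" for x
  proof (cases "g x = 0")
    case False
    then have "s x > 0" using s_pos g_pos by blast
    then show ?thesis using g_nonneg[of x] poch[of N] by (simp add: d_def)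
  qed (simp add: d_def)
  have P_bias: "P x \<in> bias_vectors" for x
  proof (cases "\<forall>\<alpha>. x \<alpha> > 0")
    case True
    have "x \<alpha> \<le> s x" for \<alpha>
      unfolding s_def using True by (intro member_le_sum) (auto intro: less_imp_le)
    moreover have "(\<Sum>\<alpha>\<in>UNIV. x \<alpha> / s x) = 1"
      using s_pos[OF True] by (simp add: s_def flip: sum_divide_distrib)
    ultimately show ?thesis
      using True s_pos[OF True] by (simp add: P_def bias_vectors_def less_imp_le)
  next
    case False
    have "real CARD('a) \<ge> 1" by (simp add: Suc_le_eq)
    then show ?thesis using False by (auto simp: P_def bias_vectors_def)
  qed
  have P_meas: "P \<in> measurable M (restrict_space borel bias_vectors)"
  proof (rule measurable_restrict_space2)
    show "P \<in> borel_measurable M"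
    proof (subst borel_measurable_euclidean_space, rule ballI)
      fix b :: "real ^ 'a" assume "b \<in> Basis"
      then obtain i where b: "b = axis i 1" by (auto simp: Basis_vec_def)
      have "(\<lambda>x. P x \<bullet> b) = (\<lambda>x. if \<forall>\<alpha>. x \<alpha> > 0 then x i / s x else 1 / real CARD('a))"
        by (auto simp: fun_eq_iff b inner_axis P_def)
      then show "(\<lambda>x. P x \<bullet> b) \<in> borel_measurable M" by simp
    qed
  qed (use P_bias in auto)
  have d_int: "has_bochner_integral M d 1"
    using has_bochner_integral_divide_zero[OF gamma_product_moment[of k "\<lambda>_. 0" N, OF k], of "pochhammer K N"] poch[of N]
    by (simp add: M_def d_def[abs_def] g_def s_def K_def)
  have "prob_space (density M d)"
  proof (rule prob_spaceI)
    have "emeasure (density M d) (space (density M d)) = (\<integral>\<^sup>+x. ennreal (d x) \<partial>M)"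
      by (simp add: emeasure_density cong: nn_integral_cong)
    also have "\<dots> = 1"
      using d_int d_nonneg by (subst nn_integral_eq_integral) (auto simp: has_bochner_integral_iff)
    finally show "emeasure (density M d) (space (density M d)) = 1" .
  qed
  then interpret D: prob_space "density M d" .
  show thesis
  proof (rule that[of "distr (density M d) (restrict_space borel bias_vectors) P"])
    show "distr (density M d) (restrict_space borel bias_vectors) P \<in> bias_distributions"
      using D.prob_space_distr[of P "restrict_space borel bias_vectors"] P_meas
      by (simp add: bias_distributions_def)
    fix n :: "'a \<Rightarrow> nat" assume n: "(\<Sum>\<alpha>\<in>UNIV. n \<alpha>) \<le> N"
    define m where "m = (\<Sum>\<alpha>\<in>UNIV. n \<alpha>)"
    have [measurable]: "(\<lambda>p :: real ^ 'a. p $ \<alpha>) \<in> borel_measurable borel" for \<alpha>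
      by (intro borel_measurable_continuous_onI continuous_intros)
    have mf: "(\<lambda>p :: real ^ 'a. \<Prod>\<alpha>\<in>UNIV. p $ \<alpha> ^ n \<alpha>) \<in> borel_measurable (restrict_space borel bias_vectors)"
      by (rule measurable_restrict_space1) measurable
    have "(\<integral>p. (\<Prod>\<alpha>\<in>UNIV. p $ \<alpha> ^ n \<alpha>) \<partial>distr (density M d) (restrict_space borel bias_vectors) P) =
        (\<integral>x. (\<Prod>\<alpha>\<in>UNIV. P x $ \<alpha> ^ n \<alpha>) \<partial>density M d)"
      using P_meas mf by (subst integral_distr) auto
    also have "\<dots> = (\<integral>x. d x *\<^sub>R (\<Prod>\<alpha>\<in>UNIV. P x $ \<alpha> ^ n \<alpha>) \<partial>M)"
      using measurable_compose[OF P_meas mf] d_nonneg by (subst integral_density) auto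
    also have "\<dots> = (\<integral>x. g x * (\<Prod>\<alpha>\<in>UNIV. x \<alpha> ^ n \<alpha>) * s x ^ (N - m) / pochhammer K N \<partial>M)"
    proof (intro Bochner_Integration.integral_cong refl)
      fix x
      show "d x *\<^sub>R (\<Prod>\<alpha>\<in>UNIV. P x $ \<alpha> ^ n \<alpha>) =
          g x * (\<Prod>\<alpha>\<in>UNIV. x \<alpha> ^ n \<alpha>) * s x ^ (N - m) / pochhammer K N"
      proof (cases "g x = 0")
        case False
        then have pos: "\<forall>\<alpha>. x \<alpha> > 0" using g_pos by blast
        have "(\<Prod>\<alpha>\<in>UNIV. P x $ \<alpha> ^ n \<alpha>) = (\<Prod>\<alpha>\<in>UNIV. x \<alpha> ^ n \<alpha>) / s x ^ m"
          using pos by (simp add: P_def power_divide prod_dividef m_def power_sum)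
        \<comment> \<open>The tilt pays for the denominator of the quotient; this is where the
          degree must not exceed \<open>N\<close>.\<close>
        moreover have "s x ^ N = s x ^ m * s x ^ (N - m)"
          using n by (simp add: m_def flip: power_add)
        ultimately show ?thesis using s_pos[OF pos] by (simp add: d_def)
      qed (simp add: d_def)
    qed
    also have "\<dots> = (\<Prod>\<alpha>\<in>UNIV. pochhammer (k \<alpha>) (n \<alpha>)) * pochhammer (K + real m) (N - m) / pochhammer K N"
      using gamma_product_moment[of k n "N - m", OF k]
      by (simp add: has_bochner_integral_iff M_def g_def s_def K_def m_def)
    also have "pochhammer K N = pochhammer K m * pochhammer (K + real m) (N - m)"
      using n by (intro pochhammer_product) (simp add: m_def)
    also have "(\<Prod>\<alpha>\<in>UNIV. pochhammer (k \<alpha>) (n \<alpha>)) * pochhammer (K + real m) (N - m) / \<dots> =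
        (\<Prod>\<alpha>\<in>UNIV. pochhammer (k \<alpha>) (n \<alpha>)) / pochhammer K m"
      using K pochhammer_pos[of "K + real m" "N - m"] by simp
    finally show "(\<integral>p. (\<Prod>\<alpha>\<in>UNIV. p $ \<alpha> ^ n \<alpha>) \<partial>distr (density M d) (restrict_space borel bias_vectors) P) =
      (\<Prod>\<alpha>\<in>UNIV. pochhammer (k \<alpha>) (n \<alpha>)) / pochhammer (\<Sum>\<alpha>\<in>UNIV. k \<alpha>) (\<Sum>\<alpha>\<in>UNIV. n \<alpha>)"
      by (simp add: K_def m_def)
  qed
qed

section \<open>Lower bound on the capacity\<close>

text \<open>The third Taylor polynomial of \<open>-ln\<close> at 1.\<close>

definition neg_ln_cubic :: "real \<Rightarrow> real" where
  "neg_ln_cubic x = 11 / 6 - 3 * x + 3 / 2 * x ^ 2 - x ^ 3 / 3"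

text \<open>The difference has derivative (y - 1)^3 / y, hence a global minimum at 1; this requires
  odd degree. Degree 3 is the first odd one that keeps the quadratic term, and being polynomial it
  has explicit Dirichlet means.\<close>

lemma neg_ln_cubic_le:
  assumes "x > 0"
  shows "neg_ln_cubic x \<le> - ln x"
proof -
  define f where "f x = - ln x - neg_ln_cubic x" for x
  have D: "(f has_real_derivative ((y - 1) ^ 3 / y)) (at y)" if "y > 0" for y
  proof -
    have "(f has_real_derivative (- (1 / y) - (- 3 + 3 * y - y\<^sup>2))) (at y)"
      unfolding f_def neg_ln_cubic_def using that
      by (auto intro!: derivative_eq_intros)
    also have "- (1 / y) - (- 3 + 3 * y - y\<^sup>2) = (y - 1) ^ 3 / y"
      using that by (simp add: divide_simps) (simp add: power2_eq_square power3_eq_cube algebra_simps)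
    finally show ?thesis .
  qed
  have "f 1 \<le> f x"
  proof (cases "x \<ge> 1")
    case True
    show ?thesis
    proof (rule DERIV_nonneg_imp_nondecreasing[OF True])
      fix y :: real assume "1 \<le> y"
      then show "\<exists>d. (f has_real_derivative d) (at y) \<and> 0 \<le> d"
        using D[of y] by (intro exI conjI) auto
    qed
  next
    case False
    show ?thesis
    proof (rule DERIV_nonpos_imp_nonincreasing[of x 1])
      fix y :: real assume "x \<le> y" "y \<le> 1"
      then show "\<exists>d. (f has_real_derivative d) (at y) \<and> d \<le> 0"
        using D[of y] assms by (intro exI conjI) (auto intro!: divide_nonpos_pos simp: power_le_zero_eq)
    qed (use False in simp)
  qed
  then show ?thesis by (simp add: f_def neg_ln_cubic_def)
qed

text \<open>Convexity of the power. The minorant is affine in \<open>x\<close>, so only a first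
  posterior moment is needed to integrate it.\<close>

lemma power_ge_tangent:
  fixes x y :: real
  assumes "x \<ge> 0" "y \<ge> 0"
  shows "x ^ Suc n \<ge> y ^ Suc n + real (Suc n) * y ^ n * (x - y)"
proof (induction n)
  case (Suc n)
  have "0 \<le> real (Suc n) * y ^ n * (x - y)\<^sup>2" using assms by simp
  then have "y ^ Suc (Suc n) + real (Suc (Suc n)) * y ^ Suc n * (x - y) \<le>
      x * (y ^ Suc n + real (Suc n) * y ^ n * (x - y))"
    by (simp add: algebra_simps power2_eq_square)
  also have "\<dots> \<le> x * x ^ Suc n" by (intro mult_left_mono Suc assms)
  finally show ?case by simp
qed simp

text \<open>
  The posterior mean of \<open>neg_ln_cubic (c * p $ y / m)\<close> given a tally \<open>\<sigma>\<close> with \<open>\<sigma> y = m\<close>, when the bias is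
  Dirichlet distributed with parameter \<open>\<kappa>\<close> at \<open>y\<close> and total parameter \<open>K\<close>.
\<close>

definition cubic_mean :: "real \<Rightarrow> real \<Rightarrow> real \<Rightarrow> real \<Rightarrow> real" where
  "cubic_mean \<kappa> K c m = 11 / 6 - 3 * (c / m * ((\<kappa> + m) / (K + c)))
    + 3 / 2 * ((c / m) ^ 2 * (pochhammer (\<kappa> + m) 2 / pochhammer (K + c) 2))
    - (c / m) ^ 3 * (pochhammer (\<kappa> + m) 3 / pochhammer (K + c) 3) / 3"

text \<open>The posterior moments of c p/m are products of factors \<open>1 + f j\<close>, with
  \<open>f j\<close> close to \<open>l j\<close> and of order 1/m. First-order terms are evaluated
  exactly, everything else is error of order 1/m^2.\<close>

lemma cubic_mean_ge:
  fixes \<kappa> K c m Q :: real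
  assumes m: "1 \<le> m" "m \<le> c" and \<kappa>: "0 \<le> \<kappa>" "\<kappa> \<le> 1" and K: "0 \<le> K" "K + 3 \<le> Q"
  shows "cubic_mean \<kappa> K c m \<ge> (1 / 2 - \<kappa>) / m + (K - 1 / 2) / c - 7 * Q ^ 3 / m\<^sup>2"
proof -
  define a where "a = 1 / m"
  define e where "e = 1 / c"
  define l where "l j = (\<kappa> + j) * a - (K + j) * e" for j
  define f where "f j = l j / (1 + (K + j) * e)" for j
  have a: "0 < a" "a \<le> 1" and e: "0 < e" "e \<le> a"
    using m by (auto simp: a_def e_def field_simps)
  have Q: "Q \<ge> 3" using K by simp
  have l: "\<bar>l j\<bar> \<le> Q * a" if j: "j \<in> {0, 1, 2}" for j
  proof -
    have "(\<kappa> + j) * a \<le> Q * a" using \<kappa> K a j by (intro mult_right_mono) auto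
    moreover have "(K + j) * e \<le> Q * a" using K a e j by (intro mult_mono) auto
    moreover have "0 \<le> (\<kappa> + j) * a" "0 \<le> (K + j) * e" using \<kappa> K a e j by auto
    ultimately show ?thesis by (auto simp: l_def abs_if)
  qed
  have den: "1 + (K + j) * e \<ge> 1" if "j \<in> {0, 1, 2}" for j using that K e by auto
  have f: "\<bar>f j\<bar> \<le> Q * a" if j: "j \<in> {0, 1, 2}" for j
  proof -
    have "\<bar>f j\<bar> = \<bar>l j\<bar> / (1 + (K + j) * e)" using den[OF j] by (simp add: f_def abs_divide)
    also have "\<dots> \<le> \<bar>l j\<bar> / 1" using den[OF j] by (intro divide_left_mono) auto
    finally show ?thesis using l[OF j] by simp
  qed
  have fl: "\<bar>f j - l j\<bar> \<le> Q\<^sup>2 * a\<^sup>2" if j: "j \<in> {0, 1, 2}" for j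
  proof -
    have "f j - l j = - (f j * ((K + j) * e))"
      using den[OF j] by (simp add: f_def field_simps)
    then have "\<bar>f j - l j\<bar> = \<bar>f j\<bar> * ((K + j) * e)" using j K e by (auto simp: abs_mult)
    also have "\<dots> \<le> (Q * a) * (Q * a)"
      using f[OF j] j K e a Q by (intro mult_mono) auto
    finally show ?thesis by (simp add: power2_eq_square mult_ac)
  qed
  have F: "c / m * ((\<kappa> + j + m) / (K + j + c)) = 1 + f j" if j: "j \<in> {0, 1, 2}" for j
  proof -
    have "1 + f j = (1 + (K + j) * e + l j) / (1 + (K + j) * e)"
      using den[OF j] by (simp add: f_def add_divide_distrib)
    also have "1 + (K + j) * e + l j = (\<kappa> + j + m) / m"
      using m by (simp add: l_def a_def field_simps)
    also have "1 + (K + j) * e = (K + j + c) / c"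
      using m by (simp add: e_def field_simps)
    finally show ?thesis by simp
  qed
  have F0: "c / m * ((\<kappa> + m) / (K + c)) = 1 + f 0" using F[of 0] by simp
  have F1: "c / m * ((\<kappa> + m + 1) / (K + c + 1)) = 1 + f 1" using F[of 1] by (simp add: add_ac)
  have F2: "c / m * ((\<kappa> + m + 2) / (K + c + 2)) = 1 + f 2" using F[of 2] by (simp add: add_ac)
  have p2: "(c / m) ^ 2 * (pochhammer (\<kappa> + m) 2 / pochhammer (K + c) 2) = (1 + f 0) * (1 + f 1)"
    unfolding F0[symmetric] F1[symmetric] by (simp add: numeral_2_eq_2 pochhammer_Suc mult_ac)
  have p3: "(c / m) ^ 3 * (pochhammer (\<kappa> + m) 3 / pochhammer (K + c) 3) = (1 + f 0) * (1 + f 1) * (1 + f 2)"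
    unfolding F0[symmetric] F1[symmetric] F2[symmetric] by (simp add: numeral_3_eq_3 pochhammer_Suc mult_ac)
  define A where "A = Q * a"
  have A: "A \<ge> 0" using Q a by (simp add: A_def)
  have fa: "\<bar>f 0\<bar> \<le> A" "\<bar>f 1\<bar> \<le> A" "\<bar>f 2\<bar> \<le> A" using f by (auto simp: A_def)
  have ff: "\<bar>f i * f j\<bar> \<le> A\<^sup>2" if "i \<in> {0, 1, 2}" "j \<in> {0, 1, 2}" for i j
    unfolding abs_mult power2_eq_square using f that A by (intro mult_mono) (auto simp: A_def)
  have fff: "\<bar>f 0 * f 1 * f 2\<bar> \<le> A\<^sup>2 * A"
    unfolding abs_mult[of "f 0 * f 1"] using ff[of 0 1] fa A by (intro mult_mono) auto
  have fll: "\<bar>f 0 - l 0\<bar> \<le> A\<^sup>2" "\<bar>f 1 - l 1\<bar> \<le> A\<^sup>2" "\<bar>f 2 - l 2\<bar> \<le> A\<^sup>2"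
    using fl[of 0] fl[of 1] fl[of 2] by (auto simp: A_def power_mult_distrib)
  have "cubic_mean \<kappa> K c m = - (11 / 6) * f 0 + 7 / 6 * f 1 - 1 / 3 * f 2
      + 7 / 6 * (f 0 * f 1) - 1 / 3 * (f 0 * f 2) - 1 / 3 * (f 1 * f 2) - 1 / 3 * (f 0 * f 1 * f 2)"
    unfolding cubic_mean_def F0 p2 p3 by (simp add: field_simps)
  \<comment> \<open>The coefficients sum to -1, giving -\<kappa> and K, and their first moment in j
    is 1/2, giving the variance contribution.\<close>
  moreover have "- (11 / 6) * l 0 + 7 / 6 * l 1 - 1 / 3 * l 2 = (1 / 2 - \<kappa>) * a + (K - 1 / 2) * e"
    by (simp add: l_def field_simps)
  \<comment> \<open>Linearisation contributes 10/3 and the pairwise products 11/6 to the coefficient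
    of \<open>A\<^sup>2\<close>, in all less than 6.\<close>
  ultimately have "cubic_mean \<kappa> K c m \<ge> (1 / 2 - \<kappa>) * a + (K - 1 / 2) * e - 6 * A\<^sup>2 - A\<^sup>2 * A"
    using fll ff[of 0 1] ff[of 0 2] ff[of 1 2] fff by (simp add: abs_le_iff)
  moreover have "6 * A\<^sup>2 + A\<^sup>2 * A \<le> 7 * Q ^ 3 * a\<^sup>2"
  proof -
    have "A\<^sup>2 = Q\<^sup>2 * a\<^sup>2" by (simp add: A_def power_mult_distrib)
    moreover have "Q\<^sup>2 * a\<^sup>2 \<le> Q ^ 3 * a\<^sup>2"
      using Q by (intro mult_right_mono power_increasing) auto
    moreover have "Q\<^sup>2 * a\<^sup>2 * A \<le> Q\<^sup>2 * a\<^sup>2 * Q"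
      using Q a by (intro mult_left_mono) (auto simp: A_def mult_left_le)
    ultimately show ?thesis by (simp add: power2_eq_square power3_eq_cube mult_ac)
  qed
  ultimately show ?thesis by (simp add: a_def e_def power_divide)
qed

text \<open>Factorwise, \<open>\<kappa> / 2 + i\<close> is at least half of
  \<open>\<kappa> + i\<close>. The loss is harmless because the bound is decisive only for boundedly
  many \<open>m\<close>.\<close>

lemma pochhammer_ratio_ge:
  fixes \<kappa> :: real
  assumes "\<kappa> > 0"
  shows "pochhammer (\<kappa> / 2) m \<ge> (1 / 2) ^ m * pochhammer \<kappa> m"
proof (induction m)
  case (Suc m)
  have "(1 / 2) ^ m * pochhammer \<kappa> m * (1 / 2 * (\<kappa> + real m)) \<le> pochhammer (\<kappa> / 2) m * (\<kappa> / 2 + real m)"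
    using Suc assms pochhammer_nonneg[of "\<kappa> / 2" m] by (intro mult_mono) auto
  then show ?case by (simp add: pochhammer_Suc mult_ac)
qed simp

text \<open>The ratio is the product of the factors 1 + (a - b)/(b + i), at least one plus their
  harmonic sum. Logarithmic growth in \<open>n\<close> is enough to beat every constant, so no Gamma
  asymptotics enter.\<close>

lemma pochhammer_ratio_ln:
  fixes a b :: real
  assumes "0 < b" "b \<le> a"
  shows "pochhammer a n \<ge> (1 + (a - b) * ln ((b + real n) / b)) * pochhammer b n"
proof (induction n)
  case (Suc n)
  define t where "t = (a - b) * ln ((b + real n) / b)"
  have pos: "b + real n > 0" using assms by simp
  have t: "t \<ge> 0" using assms by (simp add: t_def)
  have "ln ((b + real (Suc n)) / b) = ln ((b + real n) / b) + ln ((b + real (Suc n)) / (b + real n))"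
    using pos assms by (simp add: ln_div)
  moreover have "ln ((b + real (Suc n)) / (b + real n)) \<le> (b + real (Suc n)) / (b + real n) - 1"
    using pos by (intro ln_le_minus_one) simp
  moreover have "(b + real (Suc n)) / (b + real n) - 1 = 1 / (b + real n)"
    using pos by (simp add: field_simps)
  ultimately have "(a - b) * ln ((b + real (Suc n)) / b) \<le> (a - b) * (ln ((b + real n) / b) + 1 / (b + real n))"
    using assms by (intro mult_left_mono) auto
  then have "1 + (a - b) * ln ((b + real (Suc n)) / b) \<le> 1 + t + (a - b) / (b + real n)"
    by (simp add: t_def distrib_left)
  also have "\<dots> \<le> 1 + t + (a - b) / (b + real n) + t * ((a - b) / (b + real n))"
    using t assms pos by simp
  also have "\<dots> = (1 + t) * (1 + (a - b) / (b + real n))"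
    by (simp add: ring_distribs del: times_divide_eq_left times_divide_eq_right)
  finally have "(1 + (a - b) * ln ((b + real (Suc n)) / b)) * (b + real n) \<le>
      (1 + t) * (1 + (a - b) / (b + real n)) * (b + real n)"
    using pos by (intro mult_right_mono) auto
  also have "\<dots> = (1 + t) * (a + real n)" using pos by (simp add: field_simps)
  finally have "(1 + (a - b) * ln ((b + real (Suc n)) / b)) * (b + real n) * pochhammer b n \<le>
      (1 + t) * (a + real n) * pochhammer b n"
    using assms by (intro mult_right_mono) (auto simp: pochhammer_nonneg)
  also have "\<dots> = (a + real n) * ((1 + t) * pochhammer b n)" by simp
  also have "\<dots> \<le> (a + real n) * pochhammer a n"
    using Suc assms by (intro mult_left_mono) (auto simp: t_def)
  finally show ?case by (simp add: pochhammer_rec' mult_ac)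
qed (use assms in simp)

section \<open>Moments of tally monomials\<close>

definition multinomial :: "nat \<Rightarrow> ('a :: finite \<Rightarrow> nat) \<Rightarrow> real" where
  "multinomial c \<sigma> = fact c / (\<Prod>\<alpha>\<in>UNIV. fact (\<sigma> \<alpha>))"

definition mono_at :: "('a :: finite \<Rightarrow> nat) \<Rightarrow> real ^ 'a \<Rightarrow> real" where
  "mono_at n p = (\<Prod>\<alpha>\<in>UNIV. p $ \<alpha> ^ n \<alpha>)"

lemma multinomial_nonneg: "multinomial c \<sigma> \<ge> 0"
  by (auto simp: multinomial_def intro!: divide_nonneg_nonneg prod_nonneg)

lemma pmf_tally: "p \<in> bias_vectors \<Longrightarrow> \<sigma> \<in> tallies c \<Longrightarrow> pmf (tally_pmf c p) \<sigma> = multinomial c \<sigma> * mono_at \<sigma> p"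
  by (simp add: pmf_tally_pmf multinomial_def mono_at_def)

lemma mono_at_bounds: "p \<in> bias_vectors \<Longrightarrow> 0 \<le> mono_at n p \<and> mono_at n p \<le> 1"
  using prod_simplex[of p n] by (simp add: mono_at_def)

lemma component_measurable [measurable]: "(\<lambda>p :: real ^ 'a. p $ \<alpha>) \<in> borel_measurable borel"
  by (intro borel_measurable_continuous_onI continuous_intros)

lemma mono_at_measurable [measurable]: "mono_at n \<in> borel_measurable borel"
  unfolding mono_at_def[abs_def] by measurable

lemma mex_measurable [measurable]:
  "(\<lambda>p :: real ^ 'a :: finite. mex (\<lambda>\<alpha>. p $ \<alpha>) n f) \<in> borel_measurable borel"
proof (induction n arbitrary: f)
  case (Suc n)
  note [measurable] = Suc
  show ?case by simp
qed simp

lemma ent_measurable [measurable]: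
  "(\<lambda>p :: real ^ 'a :: finite. ent (\<lambda>\<alpha>. p $ \<alpha>) n f) \<in> borel_measurable borel"
  unfolding ent_def xlnx_def by measurable

lemma xlnx_bounds:
  assumes "0 \<le> x" "x \<le> 1"
  shows "\<bar>xlnx x\<bar> \<le> 1"
proof (cases "x = 0")
  case False
  then have x: "x > 0" using assms by simp
  have "ln (1 / x) \<le> 1 / x - 1" using x by (intro ln_le_minus_one) simp
  then have "x * ln (1 / x) \<le> 1 - x" using x by (simp add: field_simps)
  moreover have "x * ln x \<le> 0" using x assms by (simp add: mult_nonneg_nonpos)
  ultimately show ?thesis using x by (simp add: xlnx_def ln_div abs_le_iff)
qed (simp add: xlnx_def)

lemma (in weights) ent_bounds:
  assumes "\<And>\<sigma>. \<sigma> \<in> tallies n \<Longrightarrow> 0 \<le> f \<sigma>" "\<And>\<sigma>. \<sigma> \<in> tallies n \<Longrightarrow> f \<sigma> \<le> 1"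
  shows "\<bar>ent w n f\<bar> \<le> 2"
proof -
  have "mex w n (\<lambda>_. -1) \<le> mex w n (\<lambda>\<sigma>. xlnx (f \<sigma>))" "mex w n (\<lambda>\<sigma>. xlnx (f \<sigma>)) \<le> mex w n (\<lambda>_. 1)"
    "mex w n f \<le> mex w n (\<lambda>_. 1)" "mex w n (\<lambda>_. 0) \<le> mex w n f"
    using xlnx_bounds assms by (intro mex_mono w_nonneg; force simp: abs_le_iff)+
  with xlnx_bounds[of "mex w n f"] show ?thesis
    by (simp add: mex_const[OF w_sum] ent_def)
qed

definition dirichlet_moments :: "(real ^ 'a) measure \<Rightarrow> ('a :: finite \<Rightarrow> real) \<Rightarrow> nat \<Rightarrow> bool" where
  "dirichlet_moments F k N \<longleftrightarrow> F \<in> bias_distributions \<and> (\<forall>\<alpha>. k \<alpha> > 0) \<and>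
    (\<forall>n. (\<Sum>\<alpha>\<in>UNIV. n \<alpha>) \<le> N \<longrightarrow> integral\<^sup>L F (mono_at n) =
      (\<Prod>\<alpha>\<in>UNIV. pochhammer (k \<alpha>) (n \<alpha>)) / pochhammer (\<Sum>\<alpha>\<in>UNIV. k \<alpha>) (\<Sum>\<alpha>\<in>UNIV. n \<alpha>))"

lemma dirichlet_moments_exists:
  assumes "\<And>\<alpha>. k \<alpha> > 0" obtains F where "dirichlet_moments F k N"
proof (rule dirichlet_exists[of k N, OF assms])
  fix F assume "F \<in> bias_distributions"
    "\<And>n. (\<Sum>\<alpha>\<in>UNIV. n \<alpha>) \<le> N \<Longrightarrow> (\<integral>p. (\<Prod>\<alpha>\<in>UNIV. p $ \<alpha> ^ n \<alpha>) \<partial>F) =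
      (\<Prod>\<alpha>\<in>UNIV. pochhammer (k \<alpha>) (n \<alpha>)) / pochhammer (\<Sum>\<alpha>\<in>UNIV. k \<alpha>) (\<Sum>\<alpha>\<in>UNIV. n \<alpha>)"
  with assms show thesis
    by (intro that[of F]) (simp add: dirichlet_moments_def mono_at_def[abs_def])
qed

lemma mono_at_integrable:
  assumes "F \<in> bias_distributions"
  shows "integrable F (\<lambda>p. mono_at n p * p $ y ^ j)"
proof (rule bias_integrable[OF assms])
  fix p :: "real ^ 'a" assume p: "p \<in> bias_vectors"
  then have "0 \<le> p $ y" "p $ y \<le> 1" by (auto simp: bias_vectors_def)
  then show "\<bar>mono_at n p * p $ y ^ j\<bar> \<le> 1"
    using mono_at_bounds[OF p, of n] by (simp add: abs_mult mult_le_one power_le_one)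
qed measurable

text \<open>Conjugacy of Dirichlet and multinomial laws: the last factor is the \<open>j\<close>-th
  posterior moment of \<open>p $ y\<close> given the tally.\<close>

lemma dirichlet_shift:
  assumes F: "dirichlet_moments F k N" and \<sigma>: "\<sigma> \<in> tallies c" and N: "c + j \<le> N"
  shows "(\<integral>p. mono_at \<sigma> p * p $ y ^ j \<partial>F) =
    integral\<^sup>L F (mono_at \<sigma>) * (pochhammer (k y + real (\<sigma> y)) j / pochhammer ((\<Sum>\<alpha>\<in>UNIV. k \<alpha>) + real c) j)"
proof -
  define n where "n = \<sigma>(y := \<sigma> y + j)"
  have sum_n: "(\<Sum>\<alpha>\<in>UNIV. n \<alpha>) = c + j" and sum_\<sigma>: "(\<Sum>\<alpha>\<in>UNIV. \<sigma> \<alpha>) = c"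
    using \<sigma> by (simp_all add: tallies_def n_def sum.remove[of UNIV y])
  have k: "k \<alpha> > 0" for \<alpha> using F by (simp add: dirichlet_moments_def)
  have prod_n: "(\<Prod>\<alpha>\<in>UNIV. f \<alpha> (n \<alpha>)) = f y (\<sigma> y + j) * (\<Prod>\<alpha>\<in>UNIV - {y}. f \<alpha> (\<sigma> \<alpha>))"
    for f :: "'a \<Rightarrow> nat \<Rightarrow> real"
    by (simp add: prod.remove[of UNIV y] n_def)
  have prod_\<sigma>: "(\<Prod>\<alpha>\<in>UNIV. f \<alpha> (\<sigma> \<alpha>)) = f y (\<sigma> y) * (\<Prod>\<alpha>\<in>UNIV - {y}. f \<alpha> (\<sigma> \<alpha>))"
    for f :: "'a \<Rightarrow> nat \<Rightarrow> real"
    by (simp add: prod.remove[of UNIV y])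
  have "(\<lambda>p. mono_at \<sigma> p * p $ y ^ j) = mono_at n"
    using prod_n[of "\<lambda>\<alpha> i. p $ \<alpha> ^ i" for p] prod_\<sigma>[of "\<lambda>\<alpha> i. p $ \<alpha> ^ i" for p]
    by (simp add: mono_at_def fun_eq_iff power_add mult_ac)
  moreover have "integral\<^sup>L F (mono_at n) = (\<Prod>\<alpha>\<in>UNIV. pochhammer (k \<alpha>) (n \<alpha>)) / pochhammer (\<Sum>\<alpha>\<in>UNIV. k \<alpha>) (c + j)"
    using F N sum_n unfolding dirichlet_moments_def by metis
  moreover have "integral\<^sup>L F (mono_at \<sigma>) = (\<Prod>\<alpha>\<in>UNIV. pochhammer (k \<alpha>) (\<sigma> \<alpha>)) / pochhammer (\<Sum>\<alpha>\<in>UNIV. k \<alpha>) c"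
    using F N sum_\<sigma> unfolding dirichlet_moments_def by (metis add_leD1)
  ultimately show ?thesis
    using prod_n[of "\<lambda>\<alpha>. pochhammer (k \<alpha>)"] prod_\<sigma>[of "\<lambda>\<alpha>. pochhammer (k \<alpha>)"]
    by (simp add: pochhammer_product' mult_ac)
qed

section \<open>Information lower bounds for a fixed strategy\<close>

locale coalition =
  fixes c :: nat and \<theta> :: "('a :: finite \<Rightarrow> nat) \<Rightarrow> 'a pmf"
  assumes c_pos: "c > 0" and marking: "marking_assumption c \<theta>"
begin

lemma absent: "\<sigma> \<in> tallies c \<Longrightarrow> \<sigma> y = 0 \<Longrightarrow> pmf (\<theta> \<sigma>) y = 0"
  using marking by (simp add: marking_assumption_def)

abbreviation info :: "'a \<Rightarrow> real ^ 'a \<Rightarrow> real" where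
  "info y p \<equiv> ent (\<lambda>\<alpha>. p $ \<alpha>) c (\<lambda>\<sigma>. pmf (\<theta> \<sigma>) y)"

lemma info_nonneg: "p \<in> bias_vectors \<Longrightarrow> info y p \<ge> 0"
  by (intro weights.ent_nonneg[OF weights_bias]) auto

lemma info_bounds: "p \<in> bias_vectors \<Longrightarrow> \<bar>info y p\<bar> \<le> 2"
  by (intro weights.ent_bounds[OF weights_bias]) (auto simp: pmf_le_1)

lemma mono_at_0: "p $ y = 0 \<Longrightarrow> \<sigma> y \<noteq> 0 \<Longrightarrow> mono_at \<sigma> p = 0"
  unfolding mono_at_def by (intro prod_zero) auto

text \<open>Test function: the likelihood ratio \<open>\<sigma> y / (c * p $ y)\<close> of the interleaving attack.\<close>

lemma info_ge_cubic:
  assumes p: "p \<in> bias_vectors"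
  shows "(\<Sum>\<sigma>\<in>tallies c. multinomial c \<sigma> * pmf (\<theta> \<sigma>) y *
    (mono_at \<sigma> p * neg_ln_cubic (real c / real (\<sigma> y) * p $ y))) \<le> info y p"
proof (cases "p $ y = 0")
  \<comment> \<open>Every term vanishes: tallies containing \<open>y\<close> have probability 0, the
    others are excluded by the marking assumption.\<close>
  case True
  have "pmf (\<theta> \<sigma>) y * mono_at \<sigma> p = 0" if "\<sigma> \<in> tallies c" for \<sigma>
    using absent[OF that, of y] mono_at_0[OF True, of \<sigma>] by (cases "\<sigma> y = 0") auto
  then have "(\<Sum>\<sigma>\<in>tallies c. multinomial c \<sigma> * pmf (\<theta> \<sigma>) y *
      (mono_at \<sigma> p * neg_ln_cubic (real c / real (\<sigma> y) * p $ y))) = 0"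
    by (intro sum.neutral) auto
  then show ?thesis using info_nonneg[OF p] by simp
next
  case False
  interpret weights "\<lambda>\<alpha>. p $ \<alpha>" by (rule weights_bias[OF p])
  have py: "p $ y > 0" using False w_nonneg[of y] by simp
  have "(\<Sum>\<sigma>\<in>tallies c. multinomial c \<sigma> * pmf (\<theta> \<sigma>) y *
      (mono_at \<sigma> p * neg_ln_cubic (real c / real (\<sigma> y) * p $ y))) =
      mex (\<lambda>\<alpha>. p $ \<alpha>) c (\<lambda>\<sigma>. pmf (\<theta> \<sigma>) y * neg_ln_cubic (real c / real (\<sigma> y) * p $ y))"
    by (simp add: mex_eq_sum[OF p] pmf_tally[OF p] mult_ac)
  also have "\<dots> \<le> mex (\<lambda>\<alpha>. p $ \<alpha>) c (\<lambda>\<sigma>. pmf (\<theta> \<sigma>) y * ln (real (\<sigma> y) / mex (\<lambda>\<alpha>. p $ \<alpha>) c (\<lambda>\<sigma>. real (\<sigma> y))))"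
  proof (intro mex_mono w_nonneg)
    fix \<sigma> :: "'a \<Rightarrow> nat" assume \<sigma>: "\<sigma> \<in> tallies c"
    show "pmf (\<theta> \<sigma>) y * neg_ln_cubic (real c / real (\<sigma> y) * p $ y) \<le>
        pmf (\<theta> \<sigma>) y * ln (real (\<sigma> y) / mex (\<lambda>\<alpha>. p $ \<alpha>) c (\<lambda>\<sigma>. real (\<sigma> y)))"
    proof (cases "\<sigma> y = 0")
      case True
      then show ?thesis by (simp add: absent[OF \<sigma>])
    next
      case False
      have "neg_ln_cubic (real c / real (\<sigma> y) * p $ y) \<le> - ln (real c / real (\<sigma> y) * p $ y)"
        using False c_pos py by (intro neg_ln_cubic_le) auto
      also have "\<dots> = ln (real (\<sigma> y) / mex (\<lambda>\<alpha>. p $ \<alpha>) c (\<lambda>\<sigma>. real (\<sigma> y)))"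
        unfolding mex_component using False c_pos py by (simp add: ln_div ln_mult)
      finally show ?thesis by (intro mult_left_mono) auto
    qed
  qed
  also have "\<dots> \<le> info y p"
    by (rule ent_ge) (auto simp: absent)
  finally show ?thesis .
qed

text \<open>Test function: the likelihood ratio of the event that \<open>y\<close> occurs at all.\<close>

lemma info_ge_flat:
  assumes p: "p \<in> bias_vectors"
  shows "(\<Sum>\<sigma>\<in>tallies c. multinomial c \<sigma> * pmf (\<theta> \<sigma>) y * (mono_at \<sigma> p * (1 - p $ y) ^ c)) \<le> info y p"
proof (cases "p $ y = 0")
  case True
  have "pmf (\<theta> \<sigma>) y * mono_at \<sigma> p = 0" if "\<sigma> \<in> tallies c" for \<sigma>
    using absent[OF that, of y] mono_at_0[OF True, of \<sigma>] by (cases "\<sigma> y = 0") auto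
  then have "(\<Sum>\<sigma>\<in>tallies c. multinomial c \<sigma> * pmf (\<theta> \<sigma>) y * (mono_at \<sigma> p * (1 - p $ y) ^ c)) = 0"
    by (intro sum.neutral) auto
  then show ?thesis using info_nonneg[OF p] by simp
next
  case False
  interpret weights "\<lambda>\<alpha>. p $ \<alpha>" by (rule weights_bias[OF p])
  define R where "R = 1 - (1 - p $ y) ^ c"
  have py: "0 < p $ y" "p $ y \<le> 1" using False w_nonneg[of y] p by (simp_all add: bias_vectors_def less_le)
  then have "(1 - p $ y) ^ c < 1" using c_pos by (intro power_less_one_iff[THEN iffD2]) auto
  then have R: "R > 0" by (simp add: R_def)
  have "mex (\<lambda>\<alpha>. p $ \<alpha>) c (\<lambda>\<sigma>. 1 - (if \<sigma> y = 0 then 1 else 0)) = R"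
    unfolding mex_diff mex_const[OF w_sum] mex_absent[OF w_sum] by (simp add: R_def)
  moreover have "(\<lambda>\<sigma> :: 'a \<Rightarrow> nat. 1 - (if \<sigma> y = 0 then 1 else 0 :: real)) = (\<lambda>\<sigma>. if \<sigma> y = 0 then 0 else 1)"
    by auto
  ultimately have mR: "mex (\<lambda>\<alpha>. p $ \<alpha>) c (\<lambda>\<sigma>. if \<sigma> y = 0 then 0 else 1) = R" by simp
  have "(\<Sum>\<sigma>\<in>tallies c. multinomial c \<sigma> * pmf (\<theta> \<sigma>) y * (mono_at \<sigma> p * (1 - p $ y) ^ c)) =
      mex (\<lambda>\<alpha>. p $ \<alpha>) c (\<lambda>\<sigma>. pmf (\<theta> \<sigma>) y * (1 - p $ y) ^ c)"
    by (simp add: mex_eq_sum[OF p] pmf_tally[OF p] mult_ac)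
  also have "\<dots> \<le> mex (\<lambda>\<alpha>. p $ \<alpha>) c (\<lambda>\<sigma>. pmf (\<theta> \<sigma>) y *
      ln ((if \<sigma> y = 0 then 0 else 1) / mex (\<lambda>\<alpha>. p $ \<alpha>) c (\<lambda>\<sigma>. if \<sigma> y = 0 then 0 else 1)))"
  proof (intro mex_mono w_nonneg)
    fix \<sigma> :: "'a \<Rightarrow> nat" assume \<sigma>: "\<sigma> \<in> tallies c"
    \<comment> \<open>This is -ln(1 - t) \<ge> t, with t the probability that \<open>y\<close> is
      absent.\<close>
    have "(1 - p $ y) ^ c \<le> ln (1 / R)"
      using ln_le_minus_one[OF R] R by (simp add: ln_div R_def)
    then show "pmf (\<theta> \<sigma>) y * (1 - p $ y) ^ c \<le> pmf (\<theta> \<sigma>) y *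
        ln ((if \<sigma> y = 0 then 0 else 1) / mex (\<lambda>\<alpha>. p $ \<alpha>) c (\<lambda>\<sigma>. if \<sigma> y = 0 then 0 else 1))"
      unfolding mR by (auto simp: absent[OF \<sigma>] intro!: mult_left_mono)
  qed
  also have "\<dots> \<le> info y p"
    by (rule ent_ge) (auto simp: absent split: if_splits)
  finally show ?thesis .
qed

lemma info_integrable: "F \<in> bias_distributions \<Longrightarrow> integrable F (info y)"
  by (rule bias_integrable[of _ _ 2]) (auto simp: info_bounds)

text \<open>Passes from pointwise to averaged bounds. Tallies without \<open>y\<close> have
  coefficient 0, so nothing is required of \<open>h\<close> there.\<close>

lemma integral_info_ge:
  fixes h :: "('a \<Rightarrow> nat) \<Rightarrow> real ^ 'a \<Rightarrow> real"
  assumes F: "F \<in> bias_distributions"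
    and h: "\<And>\<sigma>. \<sigma> \<in> tallies c \<Longrightarrow> \<sigma> y > 0 \<Longrightarrow> has_bochner_integral F (h \<sigma>) (H \<sigma>)"
    and le: "\<And>p. p \<in> bias_vectors \<Longrightarrow>
      (\<Sum>\<sigma>\<in>tallies c. multinomial c \<sigma> * pmf (\<theta> \<sigma>) y * h \<sigma> p) \<le> info y p"
  shows "(\<Sum>\<sigma>\<in>tallies c. multinomial c \<sigma> * pmf (\<theta> \<sigma>) y * H \<sigma>) \<le> integral\<^sup>L F (info y)"
proof -
  have "has_bochner_integral F (\<lambda>p. \<Sum>\<sigma>\<in>tallies c. multinomial c \<sigma> * pmf (\<theta> \<sigma>) y * h \<sigma> p)
      (\<Sum>\<sigma>\<in>tallies c. multinomial c \<sigma> * pmf (\<theta> \<sigma>) y * H \<sigma>)"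
  proof (intro has_bochner_integral_sum)
    fix \<sigma> :: "'a \<Rightarrow> nat" assume \<sigma>: "\<sigma> \<in> tallies c"
    show "has_bochner_integral F (\<lambda>p. multinomial c \<sigma> * pmf (\<theta> \<sigma>) y * h \<sigma> p) (multinomial c \<sigma> * pmf (\<theta> \<sigma>) y * H \<sigma>)"
    proof (cases "\<sigma> y = 0")
      case True
      then show ?thesis by (simp add: absent[OF \<sigma>] has_bochner_integral_zero)
    next
      case False
      then show ?thesis using h[OF \<sigma>] by (intro has_bochner_integral_mult_right) auto
    qed
  qed
  then have int: "integrable F (\<lambda>p. \<Sum>\<sigma>\<in>tallies c. multinomial c \<sigma> * pmf (\<theta> \<sigma>) y * h \<sigma> p)"
    and eq: "(\<Sum>\<sigma>\<in>tallies c. multinomial c \<sigma> * pmf (\<theta> \<sigma>) y * H \<sigma>) =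
      (\<integral>p. (\<Sum>\<sigma>\<in>tallies c. multinomial c \<sigma> * pmf (\<theta> \<sigma>) y * h \<sigma> p) \<partial>F)"
    by (simp_all add: has_bochner_integral_iff)
  show ?thesis
    unfolding eq using le
    by (intro integral_mono int info_integrable[OF F]) (simp add: bias_distributionsD(2)[OF F])
qed

text \<open>A tally monomial times the cubic has degree \<open>c + 3\<close>, hence the range of
  moments.\<close>

lemma integral_info_ge_cubic:
  assumes F: "dirichlet_moments F k (c + 3)"
  shows "(\<Sum>\<sigma>\<in>tallies c. multinomial c \<sigma> * pmf (\<theta> \<sigma>) y *
    (integral\<^sup>L F (mono_at \<sigma>) * cubic_mean (k y) (\<Sum>\<alpha>\<in>UNIV. k \<alpha>) (real c) (real (\<sigma> y)))) \<le> integral\<^sup>L F (info y)"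
proof (rule integral_info_ge[OF _ _ info_ge_cubic])
  show bias: "F \<in> bias_distributions" using F by (simp add: dirichlet_moments_def)
  fix \<sigma> :: "'a \<Rightarrow> nat" assume \<sigma>: "\<sigma> \<in> tallies c" "\<sigma> y > 0"
  define r where "r = real c / real (\<sigma> y)"
  define J where "J j = integral\<^sup>L F (mono_at \<sigma>) *
    (pochhammer (k y + real (\<sigma> y)) j / pochhammer ((\<Sum>\<alpha>\<in>UNIV. k \<alpha>) + real c) j)" for j
  have J: "has_bochner_integral F (\<lambda>p. a * (mono_at \<sigma> p * p $ y ^ j)) (a * J j)" if "j \<le> 3" for j a
    unfolding J_def using dirichlet_shift[OF F \<sigma>(1), of j y] mono_at_integrable[OF bias, of \<sigma> y j] that
    by (intro has_bochner_integral_mult_right) (simp add: has_bochner_integral_iff)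
  have "has_bochner_integral F (\<lambda>p. 11 / 6 * (mono_at \<sigma> p * p $ y ^ 0) + (- 3 * r) * (mono_at \<sigma> p * p $ y ^ 1)
      + (3 / 2 * r ^ 2) * (mono_at \<sigma> p * p $ y ^ 2) + (- (r ^ 3) / 3) * (mono_at \<sigma> p * p $ y ^ 3))
    (11 / 6 * J 0 + (- 3 * r) * J 1 + (3 / 2 * r ^ 2) * J 2 + (- (r ^ 3) / 3) * J 3)"
    by (intro has_bochner_integral_add J) auto
  moreover have "11 / 6 * J 0 + (- 3 * r) * J 1 + (3 / 2 * r ^ 2) * J 2 + (- (r ^ 3) / 3) * J 3 =
      integral\<^sup>L F (mono_at \<sigma>) * cubic_mean (k y) (\<Sum>\<alpha>\<in>UNIV. k \<alpha>) (real c) (real (\<sigma> y))"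
  proof -
    have "11 / 6 * D + (- 3 * r) * (D * X) + (3 / 2 * r ^ 2) * (D * Y) + (- (r ^ 3) / 3) * (D * Z) =
        D * (11 / 6 - 3 * (r * X) + 3 / 2 * (r ^ 2 * Y) - r ^ 3 * Z / 3)" for D X Y Z :: real
      by (simp add: algebra_simps)
    moreover have "J 0 = integral\<^sup>L F (mono_at \<sigma>)"
      "J 1 = integral\<^sup>L F (mono_at \<sigma>) * ((k y + real (\<sigma> y)) / ((\<Sum>\<alpha>\<in>UNIV. k \<alpha>) + real c))"
      by (simp_all add: J_def)
    ultimately show ?thesis
      unfolding cubic_mean_def r_def[symmetric] by (simp only: J_def[of 2] J_def[of 3])
  qed
  moreover have "(\<lambda>p. 11 / 6 * (mono_at \<sigma> p * p $ y ^ 0) + (- 3 * r) * (mono_at \<sigma> p * p $ y ^ 1)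
      + (3 / 2 * r ^ 2) * (mono_at \<sigma> p * p $ y ^ 2) + (- (r ^ 3) / 3) * (mono_at \<sigma> p * p $ y ^ 3)) =
      (\<lambda>p. mono_at \<sigma> p * neg_ln_cubic (r * p $ y))"
    by (simp add: neg_ln_cubic_def fun_eq_iff algebra_simps power_mult_distrib)
  ultimately show "has_bochner_integral F (\<lambda>p. mono_at \<sigma> p * neg_ln_cubic (real c / real (\<sigma> y) * p $ y))
    (integral\<^sup>L F (mono_at \<sigma>) * cubic_mean (k y) (\<Sum>\<alpha>\<in>UNIV. k \<alpha>) (real c) (real (\<sigma> y)))"
    by (simp add: r_def)
qed

text \<open>Jensen for the posterior: the power is replaced by its tangent at the posterior mean,
  whose linear part integrates to 0. Thus only degree \<open>c + 1\<close> is used; the condition on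
  \<open>k\<close> keeps the mean at most 1.\<close>

lemma integral_info_ge_flat:
  assumes F: "dirichlet_moments F k (c + 3)" and k: "k y \<le> (\<Sum>\<alpha>\<in>UNIV. k \<alpha>)"
  shows "(\<Sum>\<sigma>\<in>tallies c. multinomial c \<sigma> * pmf (\<theta> \<sigma>) y *
    (integral\<^sup>L F (mono_at \<sigma>) * (1 - (k y + real (\<sigma> y)) / ((\<Sum>\<alpha>\<in>UNIV. k \<alpha>) + real c)) ^ c)) \<le> integral\<^sup>L F (info y)"
proof -
  define K where "K = (\<Sum>\<alpha>\<in>UNIV. k \<alpha>)"
  obtain n where n: "c = Suc n" using c_pos by (cases c) auto
  have bias: "F \<in> bias_distributions" and k0: "k y > 0" using F by (simp_all add: dirichlet_moments_def)
  define P where "P \<sigma> = (k y + real (\<sigma> y)) / (K + real c)" for \<sigma> :: "'a \<Rightarrow> nat"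
  define h where "h \<sigma> p = mono_at \<sigma> p * ((1 - P \<sigma>) ^ c + real c * (1 - P \<sigma>) ^ n * (P \<sigma> - p $ y))"
    for \<sigma> :: "'a \<Rightarrow> nat" and p
  have P: "P \<sigma> \<le> 1" if "\<sigma> \<in> tallies c" for \<sigma>
    using tally_le[OF that, of y] k k0 by (simp add: P_def K_def)
  have "(\<Sum>\<sigma>\<in>tallies c. multinomial c \<sigma> * pmf (\<theta> \<sigma>) y *
      (integral\<^sup>L F (mono_at \<sigma>) * (1 - P \<sigma>) ^ c)) \<le> integral\<^sup>L F (info y)"
  proof (rule integral_info_ge[OF bias, of y h])
    fix \<sigma> :: "'a \<Rightarrow> nat" assume \<sigma>: "\<sigma> \<in> tallies c"
    have int: "has_bochner_integral F (\<lambda>p. mono_at \<sigma> p * p $ y ^ 1) (integral\<^sup>L F (mono_at \<sigma>) * P \<sigma>)"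
      using dirichlet_shift[OF F \<sigma>, of 1 y] mono_at_integrable[OF bias, of \<sigma> y 1]
      by (simp add: has_bochner_integral_iff P_def K_def)
    have "integrable F (mono_at \<sigma>)" using mono_at_integrable[OF bias, of \<sigma> y 0] by simp
    then have int0: "has_bochner_integral F (mono_at \<sigma>) (integral\<^sup>L F (mono_at \<sigma>))"
      by (simp add: has_bochner_integral_iff)
    have "has_bochner_integral F
        (\<lambda>p. mono_at \<sigma> p * ((1 - P \<sigma>) ^ c + real c * (1 - P \<sigma>) ^ n * P \<sigma>) - mono_at \<sigma> p * p $ y ^ 1 * (real c * (1 - P \<sigma>) ^ n))
        (integral\<^sup>L F (mono_at \<sigma>) * ((1 - P \<sigma>) ^ c + real c * (1 - P \<sigma>) ^ n * P \<sigma>)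
          - integral\<^sup>L F (mono_at \<sigma>) * P \<sigma> * (real c * (1 - P \<sigma>) ^ n))"
      by (intro has_bochner_integral_diff has_bochner_integral_mult_left int int0)
    moreover have "(\<lambda>p. mono_at \<sigma> p * ((1 - P \<sigma>) ^ c + real c * (1 - P \<sigma>) ^ n * P \<sigma>)
        - mono_at \<sigma> p * p $ y ^ 1 * (real c * (1 - P \<sigma>) ^ n)) = h \<sigma>"
      by (simp add: h_def fun_eq_iff algebra_simps)
    moreover have "integral\<^sup>L F (mono_at \<sigma>) * ((1 - P \<sigma>) ^ c + real c * (1 - P \<sigma>) ^ n * P \<sigma>)
          - integral\<^sup>L F (mono_at \<sigma>) * P \<sigma> * (real c * (1 - P \<sigma>) ^ n) = integral\<^sup>L F (mono_at \<sigma>) * (1 - P \<sigma>) ^ c"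
      by (simp add: algebra_simps)
    ultimately show "has_bochner_integral F (h \<sigma>) (integral\<^sup>L F (mono_at \<sigma>) * (1 - P \<sigma>) ^ c)" by simp
  next
    fix p :: "real ^ 'a" assume p: "p \<in> bias_vectors"
    have py: "p $ y \<le> 1" using p by (simp add: bias_vectors_def)
    have "h \<sigma> p \<le> mono_at \<sigma> p * (1 - p $ y) ^ c" if \<sigma>: "\<sigma> \<in> tallies c" for \<sigma>
    proof -
      have "(1 - P \<sigma>) ^ c + real c * (1 - P \<sigma>) ^ n * (P \<sigma> - p $ y) \<le> (1 - p $ y) ^ c"
        using power_ge_tangent[of "1 - p $ y" "1 - P \<sigma>" n] py P[OF \<sigma>] by (simp add: n del: power_Suc)
      then show ?thesis
        unfolding h_def using mono_at_bounds[OF p, of \<sigma>] by (intro mult_left_mono) auto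
    qed
    then have "(\<Sum>\<sigma>\<in>tallies c. multinomial c \<sigma> * pmf (\<theta> \<sigma>) y * h \<sigma> p) \<le>
        (\<Sum>\<sigma>\<in>tallies c. multinomial c \<sigma> * pmf (\<theta> \<sigma>) y * (mono_at \<sigma> p * (1 - p $ y) ^ c))"
      by (intro sum_mono mult_left_mono) (auto simp: multinomial_nonneg)
    with info_ge_flat[OF p, of y] show "(\<Sum>\<sigma>\<in>tallies c. multinomial c \<sigma> * pmf (\<theta> \<sigma>) y * h \<sigma> p) \<le> info y p"
      by linarith
  qed
  then show ?thesis by (simp add: P_def K_def)
qed

end

section \<open>One bias distribution against all strategies\<close>

lemma sum_multinomial_moment:
  assumes F: "F \<in> bias_distributions"
  shows "(\<Sum>\<sigma>\<in>tallies c. multinomial c \<sigma> * integral\<^sup>L F (mono_at \<sigma>)) = 1"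
proof -
  interpret prob_space F by (rule bias_distributionsD(1)[OF F])
  have "integrable F (mono_at \<sigma>)" for \<sigma> using mono_at_integrable[OF F, of \<sigma> undefined 0] by simp
  then have "(\<Sum>\<sigma>\<in>tallies c. multinomial c \<sigma> * integral\<^sup>L F (mono_at \<sigma>)) =
      (\<integral>p. (\<Sum>\<sigma>\<in>tallies c. multinomial c \<sigma> * mono_at \<sigma> p) \<partial>F)"
    by (subst Bochner_Integration.integral_sum) auto
  also have "\<dots> = (\<integral>p. 1 \<partial>F)"
  proof (rule Bochner_Integration.integral_cong[OF refl])
    fix p assume "p \<in> space F"
    then have p: "p \<in> bias_vectors" by (simp add: bias_distributionsD(2)[OF F])
    then show "(\<Sum>\<sigma>\<in>tallies c. multinomial c \<sigma> * mono_at \<sigma> p) = 1"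
      using mex_eq_sum[OF p, of c "\<lambda>_. 1"] mex_const[OF weights.w_sum[OF weights_bias[OF p]], of c 1]
      by (simp add: pmf_tally)
  qed
  finally show ?thesis by (simp add: prob_space)
qed

lemma cond_mutual_info_eq:
  fixes \<theta> :: "('a :: finite \<Rightarrow> nat) \<Rightarrow> 'a pmf"
  assumes F: "F \<in> bias_distributions" and q: "CARD('a) \<ge> 2" and c: "c > 0" and \<theta>: "\<theta> \<in> attack_strategies c"
  shows "cond_mutual_info c F \<theta> =
    (\<Sum>y\<in>UNIV. \<integral>p. ent (\<lambda>\<alpha>. p $ \<alpha>) c (\<lambda>\<sigma>. pmf (\<theta> \<sigma>) y) \<partial>F) / ln (real CARD('a))"
proof -
  interpret coalition c \<theta>
    using c \<theta> by unfold_locales (auto simp: attack_strategies_def)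
  have "cond_mutual_info c F \<theta> = (\<integral>p. (\<Sum>y\<in>UNIV. info y p) / ln (real CARD('a)) \<partial>F)"
    unfolding cond_mutual_info_def
    by (intro Bochner_Integration.integral_cong refl mutual_info_at_eq_ent q)
      (simp add: bias_distributionsD(2)[OF F])
  also have "\<dots> = (\<Sum>y\<in>UNIV. integral\<^sup>L F (info y)) / ln (real CARD('a))"
    by (simp add: Bochner_Integration.integral_sum[OF info_integrable[OF F]])
  finally show ?thesis .
qed

text \<open>
  For \<open>m \<ge> K\<^sub>0\<close> the cubic bound suffices because \<open>\<kappa> < 1 / 2\<close>. For smaller \<open>m\<close> the error of the cubic
  bound is compensated by the mixture component with halved parameter at \<open>y\<close>, under which such tallies
  are more likely by an unbounded factor.
\<close>

lemma bracket_ge: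
  fixes m c K\<^sub>0 :: nat and q \<kappa> \<eta> D D' P :: real
  defines "b \<equiv> (q - 1) * \<kappa> + \<kappa> / 2"
  assumes q: "q \<ge> 1" and \<kappa>: "0 < \<kappa>" "\<kappa> < 1 / 2" and \<eta>: "0 < \<eta>" "\<eta> < 1"
    and m: "1 \<le> m" "m \<le> c" and K\<^sub>0: "7 * (q + 3) ^ 3 \<le> real K\<^sub>0 * (1 / 2 - \<kappa>)" "K\<^sub>0 < c"
    and D: "D \<ge> 0" "D' \<ge> (1 / 2) ^ m * (1 + \<kappa> / 2 * ln ((b + real c) / b)) * D"
    and big: "7 * (q + 3) ^ 3 \<le> \<eta> / q * (1 / 2) ^ K\<^sub>0 * (1 + \<kappa> / 2 * ln ((b + real c) / b)) * (1 - real K\<^sub>0 / real c) ^ c"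
    and P: "P = (\<kappa> / 2 + real m) / (b + real c)"
  shows "(1 - \<eta>) * (D * cubic_mean \<kappa> (q * \<kappa>) (real c) (real m)) + \<eta> / q * (D' * (1 - P) ^ c) \<ge>
    (1 - \<eta>) * ((q * \<kappa> - 1 / 2) / real c) * D"
proof -
  define C where "C = 7 * (q + 3) ^ 3"
  define T where "T = 1 + \<kappa> / 2 * ln ((b + real c) / b)"
  define V where "V = cubic_mean \<kappa> (q * \<kappa>) (real c) (real m)"
  define v where "v = (q * \<kappa> - 1 / 2) / real c"
  have b: "b > 0" unfolding b_def using q \<kappa> by (intro add_nonneg_pos mult_nonneg_nonneg) auto
  have "ln ((b + real c) / b) \<ge> 0" using b by (intro ln_ge_zero) simp
  then have T: "T \<ge> 1" using \<kappa> by (simp add: T_def)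
  have C: "C \<ge> 0" using q by (simp add: C_def)
  have "\<kappa> * q \<le> 1 * q" using \<kappa> q by (intro mult_right_mono) auto
  then have V: "V \<ge> (1 / 2 - \<kappa>) / real m + v - C / (real m)\<^sup>2"
    using cubic_mean_ge[of "real m" "real c" \<kappa> "q * \<kappa>" "q + 3"] m \<kappa> q
    by (simp add: V_def v_def C_def mult.commute)
  have D': "D' \<ge> 0" using D T unfolding T_def[symmetric] by (intro order_trans[OF _ D(2)[folded T_def]]) simp
  have P1: "0 \<le> 1 - P" 
  proof -
    have "\<kappa> / 2 \<le> b" unfolding b_def using q \<kappa> by simp
    then show ?thesis unfolding P using b m by (simp add: divide_le_eq)
  qed
  show ?thesis
  proof (cases "m \<ge> K\<^sub>0")
    case True
    have "real K\<^sub>0 * (1 / 2 - \<kappa>) \<le> real m * (1 / 2 - \<kappa>)"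
      using True \<kappa> by (intro mult_right_mono) auto
    with K\<^sub>0(1) have "C \<le> real m * (1 / 2 - \<kappa>)" by (simp only: C_def)
    then have "C / (real m)\<^sup>2 \<le> real m * (1 / 2 - \<kappa>) / (real m)\<^sup>2" by (intro divide_right_mono) auto
    also have "\<dots> = (1 / 2 - \<kappa>) / real m" using m by (simp add: power2_eq_square)
    finally have "v \<le> V" using V by simp
    then have "(1 - \<eta>) * (D * v) \<le> (1 - \<eta>) * (D * V)" using D \<eta> by (intro mult_left_mono) auto
    moreover have "0 \<le> \<eta> / q * (D' * (1 - P) ^ c)" using D' P1 \<eta> q by simp
    ultimately show ?thesis by (simp add: V_def v_def mult_ac)
  next
    case False
    \<comment> \<open>Since \<open>m < K\<^sub>0\<close> are integers and
      \<open>\<kappa> / 2 < 1\<close>, the numerator is at most \<open>K\<^sub>0\<close>.\<close>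
    have "P \<le> (\<kappa> / 2 + real m) / real c"
      unfolding P using b \<kappa> m by (intro divide_left_mono) auto
    also have "\<dots> \<le> real K\<^sub>0 / real c" using False \<kappa> m by (intro divide_right_mono) auto
    finally have "(1 - real K\<^sub>0 / real c) ^ c \<le> (1 - P) ^ c" using K\<^sub>0 by (intro power_mono) auto
    moreover have "(1 / 2) ^ K\<^sub>0 \<le> (1 / 2 :: real) ^ m" using False by (intro power_decreasing) auto
    ultimately have "(1 / 2) ^ K\<^sub>0 * T * D * (1 - real K\<^sub>0 / real c) ^ c \<le> (1 / 2) ^ m * T * D * (1 - P) ^ c"
      using T D K\<^sub>0 by (intro mult_mono) auto
    also have "\<dots> \<le> D' * (1 - P) ^ c" using D P1 by (intro mult_right_mono) (auto simp: T_def)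
    finally have "\<eta> / q * ((1 / 2) ^ K\<^sub>0 * T * D * (1 - real K\<^sub>0 / real c) ^ c) \<le> \<eta> / q * (D' * (1 - P) ^ c)"
      using \<eta> q by (intro mult_left_mono) auto
    moreover have "C * D \<le> \<eta> / q * (1 / 2) ^ K\<^sub>0 * T * (1 - real K\<^sub>0 / real c) ^ c * D"
      using big D by (intro mult_right_mono) (auto simp: C_def T_def)
    ultimately have flat: "C * D \<le> \<eta> / q * (D' * (1 - P) ^ c)" by (simp add: mult_ac)
    have "C / (real m)\<^sup>2 \<le> C / 1" using C m by (intro divide_left_mono) auto
    moreover have "(1 / 2 - \<kappa>) / real m \<ge> 0" using \<kappa> by simp
    ultimately have "v - C \<le> V" using V by simp
    then have "(1 - \<eta>) * (D * (v - C)) \<le> (1 - \<eta>) * (D * V)" using D \<eta> by (intro mult_left_mono) auto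
    moreover have "(1 - \<eta>) * (C * D) \<le> 1 * (C * D)" using C D \<eta> by (intro mult_right_mono) auto
    ultimately show ?thesis using flat by (simp add: V_def v_def algebra_simps)
  qed
qed

text \<open>The order of choices matters: \<open>K\<^sub>0\<close> depends only on \<open>q\<close>
  and \<open>\<kappa>\<close>, so \<open>c\<close> may be taken large afterwards, and
  \<open>F\<close> is fixed before \<open>\<theta>\<close>.\<close>

lemma eventually_good_distribution:
  fixes \<kappa> \<eta> :: real
  assumes q: "CARD('a :: finite) \<ge> 2" and \<kappa>: "0 < \<kappa>" "\<kappa> < 1 / 2" and \<eta>: "0 < \<eta>" "\<eta> < 1"
  shows "\<forall>\<^sub>F c in at_top. \<exists>F\<in>(bias_distributions :: (real ^ 'a) measure set). \<forall>\<theta>\<in>attack_strategies c.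
    (1 - \<eta>) * ((real CARD('a) * \<kappa> - 1 / 2) / real c) \<le> ln (real CARD('a)) * cond_mutual_info c F \<theta>"
proof -
  define q' where "q' = real CARD('a)"
  define b where "b = (q' - 1) * \<kappa> + \<kappa> / 2"
  have q': "q' \<ge> 2" using q by (simp add: q'_def)
  have b: "b > 0" unfolding b_def using q' \<kappa> by (intro add_nonneg_pos mult_nonneg_nonneg) auto
  obtain K\<^sub>0 :: nat where K\<^sub>0: "7 * (q' + 3) ^ 3 / (1 / 2 - \<kappa>) \<le> real K\<^sub>0"
    using real_arch_simple by blast
  then have K\<^sub>0': "7 * (q' + 3) ^ 3 \<le> real K\<^sub>0 * (1 / 2 - \<kappa>)" using \<kappa> by (simp add: field_simps)
  have "LIM c at_top. \<eta> / q' * (1 / 2) ^ K\<^sub>0 * (1 + \<kappa> / 2 * ln ((b + real c) / b)) * (1 - real K\<^sub>0 / real c) ^ c :> at_top"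
    using q' b \<eta> \<kappa> by real_asymp
  then have "\<forall>\<^sub>F c in at_top. 7 * (q' + 3) ^ 3 \<le> \<eta> / q' * (1 / 2) ^ K\<^sub>0 * (1 + \<kappa> / 2 * ln ((b + real c) / b)) * (1 - real K\<^sub>0 / real c) ^ c"
    by (simp add: filterlim_at_top)
  then show ?thesis
    using eventually_gt_at_top[of K\<^sub>0]
  proof eventually_elim
    case (elim c)
    note big = elim(1) and K\<^sub>0c = elim(2)
    have c: "c > 0" using K\<^sub>0c by simp
    define ks where "ks y = (\<lambda>\<alpha>. if \<alpha> = y then \<kappa> / 2 else \<kappa>)" for y :: 'a
    have ks_pos: "ks y \<alpha> > 0" for y \<alpha> using \<kappa> by (simp add: ks_def)
    have sum_ks: "(\<Sum>\<alpha>\<in>UNIV. ks y \<alpha>) = b" for y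
    proof -
      have "(\<Sum>\<alpha>\<in>UNIV - {y}. ks y \<alpha>) = (\<Sum>\<alpha>\<in>UNIV - {y}. \<kappa>)" by (intro sum.cong) (auto simp: ks_def)
      also have "\<dots> = (q' - 1) * \<kappa>" using q by (simp add: card_Diff_singleton q'_def of_nat_diff)
      finally show ?thesis by (simp add: sum.remove[of UNIV y] b_def) (simp add: ks_def)
    qed
    obtain F0 :: "(real ^ 'a) measure" where F0: "dirichlet_moments F0 (\<lambda>_. \<kappa>) (c + 3)"
      using dirichlet_moments_exists[of "\<lambda>_. \<kappa>" "c + 3"] \<kappa> by blast
    have "\<exists>F. dirichlet_moments F (ks y) (c + 3)" for y
      using dirichlet_moments_exists[of "ks y" "c + 3"] ks_pos by blast
    then obtain F1 :: "'a \<Rightarrow> (real ^ 'a) measure" where F1: "\<And>y. dirichlet_moments (F1 y) (ks y) (c + 3)" by metis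
    have F0b: "F0 \<in> bias_distributions" and F1b: "F1 y \<in> bias_distributions" for y
      using F0 F1 by (auto simp: dirichlet_moments_def)
    obtain G where G: "G \<in> bias_distributions"
      and G_int: "\<And>f B. f \<in> borel_measurable borel \<Longrightarrow> (\<And>p. p \<in> bias_vectors \<Longrightarrow> \<bar>f p\<bar> \<le> B) \<Longrightarrow>
        integral\<^sup>L G f = (\<Sum>i\<in>UNIV. pmf (pmf_of_set UNIV) i * integral\<^sup>L (F1 i) f)"
      using bias_mixture[of F1 "pmf_of_set UNIV"] F1b by blast
    have "(if i then G else F0) \<in> bias_distributions" for i
      using G F0b by simp
    from bias_mixture[of "\<lambda>i. if i then G else F0" "bernoulli_pmf \<eta>", OF this]
    obtain F where F: "F \<in> bias_distributions"
      and F_int: "\<And>f B. f \<in> borel_measurable borel \<Longrightarrow> (\<And>p. p \<in> bias_vectors \<Longrightarrow> \<bar>f p\<bar> \<le> B) \<Longrightarrow>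
        integral\<^sup>L F f = (\<Sum>i\<in>UNIV. pmf (bernoulli_pmf \<eta>) i * integral\<^sup>L (if i then G else F0) f)"
      by blast
    have F_split: "integral\<^sup>L F f = (1 - \<eta>) * integral\<^sup>L F0 f + \<eta> / q' * (\<Sum>y\<in>UNIV. integral\<^sup>L (F1 y) f)"
      if "f \<in> borel_measurable borel" "\<And>p. p \<in> bias_vectors \<Longrightarrow> \<bar>f p\<bar> \<le> B" for f B
      using F_int[of f B] G_int[of f B] that \<eta>
      by (simp add: UNIV_bool q'_def sum_divide_distrib[symmetric] add.commute)
    define D where "D \<sigma> = integral\<^sup>L F0 (mono_at \<sigma>)" for \<sigma>
    define D' where "D' y \<sigma> = integral\<^sup>L (F1 y) (mono_at \<sigma>)" for y \<sigma>
    define P where "P y \<sigma> = (ks y y + real (\<sigma> y)) / (b + real c)" for y and \<sigma> :: "'a \<Rightarrow> nat"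
    define T where "T = 1 + \<kappa> / 2 * ln ((b + real c) / b)"
    have D: "D \<sigma> = (\<Prod>\<alpha>\<in>UNIV. pochhammer \<kappa> (\<sigma> \<alpha>)) / pochhammer (q' * \<kappa>) c" if "\<sigma> \<in> tallies c" for \<sigma>
      using F0 that by (simp add: D_def dirichlet_moments_def tallies_def q'_def)
    have D': "D' y \<sigma> = (\<Prod>\<alpha>\<in>UNIV. pochhammer (ks y \<alpha>) (\<sigma> \<alpha>)) / pochhammer b c" if "\<sigma> \<in> tallies c" for y \<sigma>
      using F1[of y] that by (simp add: D'_def dirichlet_moments_def tallies_def sum_ks)
    have D_nonneg: "D \<sigma> \<ge> 0" if "\<sigma> \<in> tallies c" for \<sigma>
      using \<kappa> q' by (simp add: D[OF that] prod_nonneg pochhammer_nonneg)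
    have D'_ge: "D' y \<sigma> \<ge> (1 / 2) ^ \<sigma> y * T * D \<sigma>" if \<sigma>: "\<sigma> \<in> tallies c" for y \<sigma>
    proof -
      define R where "R = (\<Prod>\<alpha>\<in>UNIV - {y}. pochhammer \<kappa> (\<sigma> \<alpha>))"
      have R: "R \<ge> 0" using \<kappa> by (simp add: R_def prod_nonneg pochhammer_nonneg)
      have pos: "pochhammer (q' * \<kappa>) c > 0" "pochhammer b c > 0"
        using \<kappa> q' b by (simp_all add: pochhammer_pos)
      have eq: "q' * \<kappa> - b = \<kappa> / 2" by (simp add: b_def algebra_simps)
      have "b \<le> q' * \<kappa>" using eq \<kappa> by linarith
      then have "T * pochhammer b c \<le> pochhammer (q' * \<kappa>) c"
        using pochhammer_ratio_ln[of b "q' * \<kappa>" c, unfolded eq] b by (simp only: T_def)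
      then have "T / pochhammer (q' * \<kappa>) c \<le> 1 / pochhammer b c"
        using pos by (simp add: field_simps)
      moreover have "(1 / 2) ^ \<sigma> y * pochhammer \<kappa> (\<sigma> y) * R \<le> pochhammer (\<kappa> / 2) (\<sigma> y) * R"
        using pochhammer_ratio_ge[OF \<kappa>(1)] R by (intro mult_right_mono)
      moreover have "T \<ge> 0" using b \<kappa> by (auto simp: T_def intro!: add_nonneg_nonneg mult_nonneg_nonneg ln_ge_zero)
      ultimately have "((1 / 2) ^ \<sigma> y * pochhammer \<kappa> (\<sigma> y) * R) * (T / pochhammer (q' * \<kappa>) c) \<le>
          (pochhammer (\<kappa> / 2) (\<sigma> y) * R) * (1 / pochhammer b c)"
        using \<kappa> R pos by - (rule mult_mono, auto simp: pochhammer_nonneg)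
      moreover have "(\<Prod>\<alpha>\<in>UNIV. pochhammer \<kappa> (\<sigma> \<alpha>)) = pochhammer \<kappa> (\<sigma> y) * R"
        by (simp add: R_def prod.remove[of UNIV y])
      moreover have "(\<Prod>\<alpha>\<in>UNIV. pochhammer (ks y \<alpha>) (\<sigma> \<alpha>)) = pochhammer (\<kappa> / 2) (\<sigma> y) * R"
        by (simp add: R_def prod.remove[of UNIV y] ks_def)
      ultimately show ?thesis by (simp add: D[OF \<sigma>] D'[OF \<sigma>] mult_ac)
    qed
    show ?case
    proof (intro bexI[OF _ F] ballI)
      fix \<theta> :: "('a \<Rightarrow> nat) \<Rightarrow> 'a pmf" assume \<theta>: "\<theta> \<in> attack_strategies c"
      interpret coalition c \<theta>
        using c \<theta> by unfold_locales (auto simp: attack_strategies_def)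
      define v where "v = (1 - \<eta>) * ((q' * \<kappa> - 1 / 2) / real c)"
      have ln_q: "ln q' > 0" using q' by simp
      have pmf1: "(\<Sum>y\<in>UNIV. pmf (\<theta> \<sigma>) y) = 1" for \<sigma>
        by (rule sum_pmf_eq_1) auto
      \<comment> \<open>Both the averaged tally law and every output law have total mass 1, so the
        target \<open>v\<close> can be distributed over all pairs of tally and output and compared
        termwise.\<close>
      have "v = v * (\<Sum>\<sigma>\<in>tallies c. multinomial c \<sigma> * D \<sigma>)"
        using sum_multinomial_moment[OF F0b, of c] by (simp add: D_def)
      also have "\<dots> = (\<Sum>\<sigma>\<in>tallies c. \<Sum>y\<in>UNIV. multinomial c \<sigma> * pmf (\<theta> \<sigma>) y * (v * D \<sigma>))"
        unfolding sum_distrib_left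
      proof (intro sum.cong refl)
        fix \<sigma> :: "'a \<Rightarrow> nat"
        have "(\<Sum>y\<in>UNIV. multinomial c \<sigma> * pmf (\<theta> \<sigma>) y * (v * D \<sigma>)) = (\<Sum>y\<in>UNIV. pmf (\<theta> \<sigma>) y) * (v * (multinomial c \<sigma> * D \<sigma>))"
          unfolding sum_distrib_right by (intro sum.cong refl) simp
        then show "v * (multinomial c \<sigma> * D \<sigma>) = (\<Sum>y\<in>UNIV. multinomial c \<sigma> * pmf (\<theta> \<sigma>) y * (v * D \<sigma>))"
          by (simp add: pmf1)
      qed
      also have "\<dots> = (\<Sum>y\<in>UNIV. \<Sum>\<sigma>\<in>tallies c. multinomial c \<sigma> * pmf (\<theta> \<sigma>) y * (v * D \<sigma>))"
        by (rule sum.swap)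
      also have "\<dots> \<le> (\<Sum>y\<in>UNIV. integral\<^sup>L F (info y))"
      proof (rule sum_mono)
        fix y
        have "(\<Sum>\<sigma>\<in>tallies c. multinomial c \<sigma> * pmf (\<theta> \<sigma>) y * (v * D \<sigma>)) \<le>
            (\<Sum>\<sigma>\<in>tallies c. multinomial c \<sigma> * pmf (\<theta> \<sigma>) y *
              ((1 - \<eta>) * (D \<sigma> * cubic_mean \<kappa> (q' * \<kappa>) (real c) (real (\<sigma> y))) + \<eta> / q' * (D' y \<sigma> * (1 - P y \<sigma>) ^ c)))"
        proof (rule sum_mono)
          fix \<sigma> :: "'a \<Rightarrow> nat" assume \<sigma>: "\<sigma> \<in> tallies c"
          show "multinomial c \<sigma> * pmf (\<theta> \<sigma>) y * (v * D \<sigma>) \<le> multinomial c \<sigma> * pmf (\<theta> \<sigma>) y *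
              ((1 - \<eta>) * (D \<sigma> * cubic_mean \<kappa> (q' * \<kappa>) (real c) (real (\<sigma> y))) + \<eta> / q' * (D' y \<sigma> * (1 - P y \<sigma>) ^ c))"
          proof (cases "\<sigma> y = 0")
            case True
            then show ?thesis by (simp add: absent[OF \<sigma>])
          next
            case False
            show ?thesis
              unfolding v_def
              using False \<kappa> \<eta> q' tally_le[OF \<sigma>] K\<^sub>0' K\<^sub>0c D_nonneg[OF \<sigma>] D'_ge[OF \<sigma>, of y] big
              by (intro mult_left_mono bracket_ge[where K\<^sub>0 = K\<^sub>0])
                (auto simp: T_def b_def P_def ks_def multinomial_nonneg)
          qed
        qed
        also have "\<dots> = (1 - \<eta>) * (\<Sum>\<sigma>\<in>tallies c. multinomial c \<sigma> * pmf (\<theta> \<sigma>) y * (D \<sigma> * cubic_mean \<kappa> (q' * \<kappa>) (real c) (real (\<sigma> y))))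
            + \<eta> / q' * (\<Sum>\<sigma>\<in>tallies c. multinomial c \<sigma> * pmf (\<theta> \<sigma>) y * (D' y \<sigma> * (1 - P y \<sigma>) ^ c))"
          unfolding sum_distrib_left sum.distrib[symmetric]
          by (intro sum.cong refl) (simp add: distrib_left mult_ac)
        also have "\<dots> \<le> (1 - \<eta>) * integral\<^sup>L F0 (info y) + \<eta> / q' * integral\<^sup>L (F1 y) (info y)"
        proof (intro add_mono mult_left_mono)
          show "(\<Sum>\<sigma>\<in>tallies c. multinomial c \<sigma> * pmf (\<theta> \<sigma>) y * (D \<sigma> * cubic_mean \<kappa> (q' * \<kappa>) (real c) (real (\<sigma> y)))) \<le> integral\<^sup>L F0 (info y)"
            using integral_info_ge_cubic[OF F0, of y] by (simp add: D_def q'_def)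
          have "ks y y \<le> b" using member_le_sum[of y UNIV "ks y"] ks_pos by (simp add: sum_ks less_imp_le)
          then show "(\<Sum>\<sigma>\<in>tallies c. multinomial c \<sigma> * pmf (\<theta> \<sigma>) y * (D' y \<sigma> * (1 - P y \<sigma>) ^ c)) \<le> integral\<^sup>L (F1 y) (info y)"
            using integral_info_ge_flat[OF F1[of y], of y] by (simp add: D'_def P_def sum_ks)
        qed (use \<eta> q' in auto)
        \<comment> \<open>Only the component with the smaller parameter at \<open>y\<close> is used
          for \<open>y\<close>; the others add nonnegative information.\<close>
        also have "\<dots> \<le> (1 - \<eta>) * integral\<^sup>L F0 (info y) + \<eta> / q' * (\<Sum>y'\<in>UNIV. integral\<^sup>L (F1 y') (info y))"
        proof (intro add_left_mono mult_left_mono)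
          have "integral\<^sup>L (F1 y') (info y) \<ge> 0" for y'
            by (intro Bochner_Integration.integral_nonneg) (simp add: info_nonneg bias_distributionsD(2)[OF F1b])
          then show "integral\<^sup>L (F1 y) (info y) \<le> (\<Sum>y'\<in>UNIV. integral\<^sup>L (F1 y') (info y))"
            by (intro member_le_sum) auto
        qed (use \<eta> q' in auto)
        also have "\<dots> = integral\<^sup>L F (info y)"
          using F_split[of "info y" 2] info_bounds by simp
        finally show "(\<Sum>\<sigma>\<in>tallies c. multinomial c \<sigma> * pmf (\<theta> \<sigma>) y * (v * D \<sigma>)) \<le> integral\<^sup>L F (info y)" .
      qed
      also have "\<dots> = ln q' * cond_mutual_info c F \<theta>"
        using ln_q by (simp add: cond_mutual_info_eq[OF F q c \<theta>] q'_def)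
      finally show "(1 - \<eta>) * ((real CARD('a) * \<kappa> - 1 / 2) / real c) \<le> ln (real CARD('a)) * cond_mutual_info c F \<theta>"
        by (simp add: v_def q'_def)
    qed
  qed
qed

section \<open>Asymptotics of the capacity\<close>

text \<open>\<open>L = 2 * ln c\<close> makes \<open>exp (- L)\<close> equal to 1/c^2, so that the
  cost of absent symbols becomes q/R and vanishes, while \<open>L / sqrt c\<close> still tends to 0
  and \<open>L\<close> to infinity.\<close>

lemma eventually_attack_bound:
  fixes \<eta> a :: real
  assumes q: "CARD('a :: finite) \<ge> 2" and \<eta>: "\<eta> > 0" and a: "(1 + \<eta>) * real CARD('a) / 2 - 1 / 2 < a"
  shows "\<forall>\<^sub>F c in at_top. \<forall>F\<in>(bias_distributions :: (real ^ 'a) measure set).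
    ln (real CARD('a)) * cond_mutual_info c F (attack (2 * ln (real c))) * real c \<le> a"
proof -
  define q' where "q' = real CARD('a)"
  define R where "R c = real c - 1 - q' * (2 * ln (real c)) * sqrt (real c)" for c
  define U where "U c = q' / R c - 1 / 2 + 2 * ln (real c) / sqrt (real c) +
    (1 + \<eta>) * q' * real c / (2 * R c) + q' * (2 * ln (real c)) / sqrt (real c)" for c
  have "(U \<longlongrightarrow> (1 + \<eta>) * q' / 2 - 1 / 2) at_top"
    unfolding U_def R_def by real_asymp
  then have U: "\<forall>\<^sub>F c in at_top. U c < a"
    using a by (intro order_tendstoD) (auto simp: q'_def)
  have R: "\<forall>\<^sub>F c in at_top. R c > 0"
    unfolding R_def by real_asymp
  have exp: "\<forall>\<^sub>F c in at_top. exp (1010000 / (2 * ln (real c))\<^sup>2) \<le> 1 + \<eta>"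
    using \<eta> by real_asymp
  have L: "\<forall>\<^sub>F c in at_top. 2 * ln (real c) \<ge> 1"
    by real_asymp
  show ?thesis
    using U R exp L eventually_gt_at_top[of 0]
  proof eventually_elim
    case (elim c)
    define L where "L = 2 * ln (real c)"
    obtain n where n: "c = Suc n" using elim by (cases c) auto
    show ?case
    proof
      fix F :: "(real ^ 'a) measure" assume F: "F \<in> bias_distributions"
      interpret prob_space F by (rule bias_distributionsD(1)[OF F])
      have \<theta>: "(attack L :: ('a \<Rightarrow> nat) \<Rightarrow> 'a pmf) \<in> attack_strategies c"
        using elim by (intro attack_in_strategies) simp
      interpret coalition c "attack L :: ('a \<Rightarrow> nat) \<Rightarrow> 'a pmf"
        using elim \<theta> by unfold_locales (auto simp: attack_strategies_def)
      have "exp L = (exp (ln (real c)))\<^sup>2" unfolding L_def by (rule exp_double)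
      then have expL: "exp (- L) = 1 / (real c)\<^sup>2"
        using elim(5) by (simp add: exp_minus divide_inverse)
      have "(\<Sum>y\<in>UNIV. info y p) \<le> U c / real c" if p: "p \<in> bias_vectors" for p
      proof -
        have "(\<Sum>y\<in>UNIV. info y p) \<le> real c * ((q' * exp (- L) / R c - 1 / (2 * (real c)\<^sup>2) + L / ((real c)\<^sup>2 * sqrt (real c))) +
            ((1 + \<eta>) / (2 * R c) + L * sqrt (real c) / (real c)\<^sup>2) * (q' / real c))"
          unfolding q'_def
        proof (rule attack_info_le[OF p, of L \<eta> "R c" n, folded n])
          show "R c \<le> real n - real CARD('a) * L * sqrt (real c)"
            by (simp add: R_def n L_def q'_def)
        qed (use elim(2,3,4) in \<open>simp_all add: L_def\<close>)
        also have "\<dots> = U c / real c"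
        proof -
          define s where "s = sqrt (real c)"
          have s: "s > 0" "real c = s * s" using elim(5) by (simp_all add: s_def)
          show ?thesis
            unfolding expL U_def L_def[symmetric] s_def[symmetric] using s elim(2)
            by (simp add: field_simps power2_eq_square)
        qed
        finally show ?thesis .
      qed
      then have "(\<integral>p. (\<Sum>y\<in>UNIV. info y p) \<partial>F) \<le> U c / real c"
        by (intro integral_le_const) (auto simp: bias_distributionsD(2)[OF F] info_integrable[OF F])
      also have "(\<integral>p. (\<Sum>y\<in>UNIV. info y p) \<partial>F) = ln q' * cond_mutual_info c F (attack L)"
        using q elim(5) by (subst cond_mutual_info_eq[OF F q _ \<theta>])
          (simp_all add: q'_def Bochner_Integration.integral_sum[OF info_integrable[OF F]])
      finally have "ln q' * cond_mutual_info c F (attack L) * real c \<le> U c"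
        using elim(5) by (simp add: pos_le_divide_eq)
      with elim(1) show "ln (real CARD('a)) * cond_mutual_info c F (attack (2 * ln (real c))) * real c \<le> a"
        by (simp add: q'_def L_def)
    qed
  qed
qed

lemma cond_mutual_info_nonneg:
  fixes \<theta> :: "('a :: finite \<Rightarrow> nat) \<Rightarrow> 'a pmf"
  assumes F: "F \<in> bias_distributions" and q: "CARD('a) \<ge> 2" and c: "c > 0" and \<theta>: "\<theta> \<in> attack_strategies c"
  shows "cond_mutual_info c F \<theta> \<ge> 0"
proof -
  interpret coalition c \<theta>
    using c \<theta> by unfold_locales (auto simp: attack_strategies_def)
  have "integral\<^sup>L F (info y) \<ge> 0" for y
    by (intro Bochner_Integration.integral_nonneg) (simp add: info_nonneg bias_distributionsD(2)[OF F])
  then show ?thesis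
    using q by (simp add: cond_mutual_info_eq[OF assms] sum_nonneg)
qed

text \<open>Real suprema and infima are meaningful only for bounded nonempty sets: nonnegativity
  bounds the inner values below, the single strategy \<open>\<theta>\<^sub>0\<close> bounds the
  outer ones above.\<close>

lemma fingerprinting_capacity_bounds:
  fixes lo hi :: real
  assumes q: "CARD('a :: finite) \<ge> 2" and c: "c > 0"
    and lo: "\<exists>F\<in>(bias_distributions :: (real ^ 'a) measure set). \<forall>\<theta>\<in>attack_strategies c. lo \<le> cond_mutual_info c F \<theta> / real c"
    and hi: "\<forall>F\<in>(bias_distributions :: (real ^ 'a) measure set). cond_mutual_info c F \<theta>\<^sub>0 / real c \<le> hi"
    and \<theta>\<^sub>0: "\<theta>\<^sub>0 \<in> attack_strategies c"
  shows "lo \<le> fingerprinting_capacity TYPE('a) c" "fingerprinting_capacity TYPE('a) c \<le> hi"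
proof -
  let ?v = "\<lambda>F :: (real ^ 'a) measure. INF \<theta>\<in>attack_strategies c. cond_mutual_info c F \<theta> / real c"
  have v_hi: "?v F \<le> hi" if F: "F \<in> bias_distributions" for F
  proof -
    have "bdd_below ((\<lambda>\<theta>. cond_mutual_info c F \<theta> / real c) ` attack_strategies c)"
      by (intro bdd_belowI2[of _ 0]) (simp add: cond_mutual_info_nonneg[OF F q c])
    then have "?v F \<le> cond_mutual_info c F \<theta>\<^sub>0 / real c" by (rule cINF_lower[OF _ \<theta>\<^sub>0])
    also have "\<dots> \<le> hi" using hi F by blast
    finally show ?thesis .
  qed
  obtain F :: "(real ^ 'a) measure" where F: "F \<in> bias_distributions"
    and F_lo: "\<forall>\<theta>\<in>attack_strategies c. lo \<le> cond_mutual_info c F \<theta> / real c" using lo by blast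
  have bdd: "bdd_above (?v ` bias_distributions)" by (rule bdd_aboveI2) (rule v_hi)
  have "lo \<le> ?v F" using \<theta>\<^sub>0 F_lo by (intro cINF_greatest) auto
  also have "\<dots> \<le> fingerprinting_capacity TYPE('a) c"
    unfolding fingerprinting_capacity_def by (rule cSUP_upper[OF F bdd])
  finally show "lo \<le> fingerprinting_capacity TYPE('a) c" .
  show "fingerprinting_capacity TYPE('a) c \<le> hi"
    unfolding fingerprinting_capacity_def using F v_hi by (intro cSUP_least) auto
qed

lemma scaled_capacity_tendsto:
  assumes q: "CARD('a :: finite) \<ge> 2"
  shows "((\<lambda>c. fingerprinting_capacity TYPE('a) c * (real c)\<^sup>2 * ln (real CARD('a))) \<longlongrightarrow> (real CARD('a) - 1) / 2) at_top"
proof -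
  define q' where "q' = real CARD('a)"
  have lnq: "ln q' > 0" using q by (simp add: q'_def)
  have q0: "q' > 0" using q by (simp add: q'_def)
  \<comment> \<open>One small \<open>\<eta>\<close> serves as the gap
    \<open>1 / 2 - \<kappa>\<close>, as the mixing weight and as the slack of the attack
    bound.\<close>
  have bounds: "\<forall>\<^sub>F c in at_top. (1 - \<eta>) * (q' * (1 / 2 - \<eta>) - 1 / 2) \<le> fingerprinting_capacity TYPE('a) c * (real c)\<^sup>2 * ln q' \<and>
      fingerprinting_capacity TYPE('a) c * (real c)\<^sup>2 * ln q' \<le> a"
    if \<eta>: "0 < \<eta>" "\<eta> < 1 / 2" and a: "(1 + \<eta>) * q' / 2 - 1 / 2 < a" for \<eta> a
  proof -
    have good: "\<forall>\<^sub>F c in at_top. \<exists>F\<in>(bias_distributions :: (real ^ 'a) measure set). \<forall>\<theta>\<in>attack_strategies c.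
        (1 - \<eta>) * ((q' * (1 / 2 - \<eta>) - 1 / 2) / real c) \<le> ln q' * cond_mutual_info c F \<theta>"
      unfolding q'_def using \<eta> by (intro eventually_good_distribution q) auto
    have att: "\<forall>\<^sub>F c in at_top. \<forall>F\<in>(bias_distributions :: (real ^ 'a) measure set).
        ln q' * cond_mutual_info c F (attack (2 * ln (real c))) * real c \<le> a"
      using eventually_attack_bound[OF q \<eta>(1), of a] a unfolding q'_def by simp
    show ?thesis
      using good att eventually_gt_at_top[of 0]
    proof eventually_elim
      case (elim c)
      define lo where "lo = (1 - \<eta>) * (q' * (1 / 2 - \<eta>) - 1 / 2) / ((real c)\<^sup>2 * ln q')"
      define hi where "hi = a / ((real c)\<^sup>2 * ln q')"
      have "\<exists>F\<in>(bias_distributions :: (real ^ 'a) measure set). \<forall>\<theta>\<in>attack_strategies c. lo \<le> cond_mutual_info c F \<theta> / real c"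
      proof -
        obtain F :: "(real ^ 'a) measure" where F: "F \<in> bias_distributions"
          and ge: "\<forall>\<theta>\<in>attack_strategies c. (1 - \<eta>) * ((q' * (1 / 2 - \<eta>) - 1 / 2) / real c) \<le> ln q' * cond_mutual_info c F \<theta>"
          using elim(1) by blast
        have "lo \<le> cond_mutual_info c F \<theta> / real c" if "\<theta> \<in> attack_strategies c" for \<theta>
        proof -
          have "lo = (1 - \<eta>) * ((q' * (1 / 2 - \<eta>) - 1 / 2) / real c) / (ln q' * real c)"
            by (simp add: lo_def power2_eq_square mult_ac)
          also have "\<dots> \<le> ln q' * cond_mutual_info c F \<theta> / (ln q' * real c)"
            using ge that lnq elim(3) by (intro divide_right_mono) auto
          finally show ?thesis using lnq by simp
        qed
        with F show ?thesis by blast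
      qed
      moreover have "cond_mutual_info c F (attack (2 * ln (real c))) / real c \<le> hi" if "F \<in> bias_distributions" for F :: "(real ^ 'a) measure"
      proof -
        have "cond_mutual_info c F (attack (2 * ln (real c))) / real c =
            ln q' * cond_mutual_info c F (attack (2 * ln (real c))) * real c / ((real c)\<^sup>2 * ln q')"
          using lnq elim(3) by (simp add: power2_eq_square)
        also have "\<dots> \<le> hi"
          unfolding hi_def using elim(2) that lnq by (intro divide_right_mono) auto
        finally show ?thesis .
      qed
      ultimately have "lo \<le> fingerprinting_capacity TYPE('a) c" "fingerprinting_capacity TYPE('a) c \<le> hi"
        using fingerprinting_capacity_bounds[OF q elim(3), of lo "attack (2 * ln (real c))" hi]
          attack_in_strategies[OF elim(3)] by blast+
      then show ?case
        using lnq elim(3) by (simp add: lo_def hi_def field_simps)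
    qed
  qed
  show ?thesis
    unfolding q'_def[symmetric]
  proof (rule order_tendstoI)
    fix a assume a: "a < (q' - 1) / 2"
    have "((\<lambda>\<eta>. (1 - \<eta>) * (q' * (1 / 2 - \<eta>) - 1 / 2)) \<longlongrightarrow> (1 - 0) * (q' * (1 / 2 - 0) - 1 / 2)) (at_right 0)"
      by (intro tendsto_intros)
    then have "\<forall>\<^sub>F \<eta> in at_right 0. a < (1 - \<eta>) * (q' * (1 / 2 - \<eta>) - 1 / 2)"
      using a by (intro order_tendstoD) (auto simp: field_simps)
    moreover have "\<forall>\<^sub>F \<eta> in at_right 0. \<eta> \<in> {0<..<1 / 2 :: real}"
      by (rule eventually_at_right_real) simp
    ultimately have "\<forall>\<^sub>F \<eta> in at_right 0. \<eta> \<in> {0<..<1 / 2 :: real} \<and> a < (1 - \<eta>) * (q' * (1 / 2 - \<eta>) - 1 / 2)"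
      by eventually_elim simp
    from eventually_happens[OF this] obtain \<eta> where \<eta>: "0 < \<eta>" "\<eta> < 1 / 2" "a < (1 - \<eta>) * (q' * (1 / 2 - \<eta>) - 1 / 2)"
      by auto
    show "\<forall>\<^sub>F c in at_top. a < fingerprinting_capacity TYPE('a) c * (real c)\<^sup>2 * ln q'"
      using bounds[OF \<eta>(1,2), of "(1 + \<eta>) * q' / 2"] \<eta>(3) by (auto elim!: eventually_mono)
  next
    fix a assume a: "(q' - 1) / 2 < a"
    have "((\<lambda>\<eta>. (1 + \<eta>) * q' / 2 - 1 / 2) \<longlongrightarrow> (1 + 0) * q' / 2 - 1 / 2) (at_right 0)"
      by (intro tendsto_intros) auto
    \<comment> \<open>The bound at finite \<open>c\<close> is not strict; the intermediate
      \<open>b\<close> restores strictness.\<close>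
    moreover obtain b where b: "(q' - 1) / 2 < b" "b < a" using dense[OF a] by blast
    ultimately have "\<forall>\<^sub>F \<eta> in at_right 0. (1 + \<eta>) * q' / 2 - 1 / 2 < b"
      by (intro order_tendstoD) (auto simp: field_simps)
    moreover have "\<forall>\<^sub>F \<eta> in at_right 0. \<eta> \<in> {0<..<1 / 2 :: real}"
      by (rule eventually_at_right_real) simp
    ultimately have "\<forall>\<^sub>F \<eta> in at_right 0. \<eta> \<in> {0<..<1 / 2 :: real} \<and> (1 + \<eta>) * q' / 2 - 1 / 2 < b"
      by eventually_elim simp
    from eventually_happens[OF this] obtain \<eta> where \<eta>: "0 < \<eta>" "\<eta> < 1 / 2" "(1 + \<eta>) * q' / 2 - 1 / 2 < b"
      by auto
    show "\<forall>\<^sub>F c in at_top. fingerprinting_capacity TYPE('a) c * (real c)\<^sup>2 * ln q' < a"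
      using bounds[OF \<eta>] b(2) by (auto elim!: eventually_mono)
  qed
qed

theorem theorem3:
  assumes "CARD('a :: finite) \<ge> 2"
  shows "(\<lambda>c. fingerprinting_capacity TYPE('a) c)
    \<sim>[at_top] (\<lambda>c. (real CARD('a) - 1) / (2 * (real c)\<^sup>2 * ln (real CARD('a))))"
proof (rule asymp_equivI')
  let ?q = "real CARD('a)"
  have q: "?q - 1 > 0" "ln ?q > 0" using assms by auto
  have "((\<lambda>c. fingerprinting_capacity TYPE('a) c * (real c)\<^sup>2 * ln ?q / ((?q - 1) / 2)) \<longlongrightarrow>
      ((?q - 1) / 2) / ((?q - 1) / 2)) at_top"
    using q by (intro tendsto_divide scaled_capacity_tendsto assms tendsto_const) auto
  then show "((\<lambda>c. fingerprinting_capacity TYPE('a) c / ((?q - 1) / (2 * (real c)\<^sup>2 * ln ?q))) \<longlongrightarrow> 1) at_top"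
    using q by (simp add: mult_ac)
qed

end
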